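(* Let $M$ be a smooth finite-dimensional manifold, $F:W\to\Gamma(TM)$, $w\mapsto F_w$, a linear map into smooth vector fields on $M$, $\bar y_0\in M$, and $T>0$. There is a unique solution $\mathbf y=(y,y^\dagger)\in CRP_{\mathbf X}(M)$ to $d\mathbf y_t=F_{d\mathbf X_t}(y_t)$ with initial condition $y_0=\bar y_0$ existing either on all of $[0,T]$ or on $[0,\tau)$ for some $\tau\le T$ such that the closure of $\{y_t:0\le t<\tau\}$ is not compact.
   Context: Rough paths. $W=\mathbb R^k$, $T>0$, $1\le p<3$, $\Delta_{[0,T]}=\{(s,t):0\le s\le t\le T\}$. A control is a continuous $\omega:\Delta_{[0,T]}\to[0,\infty)$ with $\omega(s,s)=0$ and $\omega(s,t)+\omega(t,u)\le\omega(s,u)$ for $s\le t\le u$. $\mathbf X=(x,\mathbb X)$ is a fixed weak-geometric $p$-rough path with control $\omega$: $x:[0,T]\to W$ and $\mathbb X:\Delta_{[0,T]}\to W\otimes W$ are continuous and, with $x_{s,t}:=x_t-x_s$, one has $\mathbb X_{s,u}=\mathbb X_{s,t}+\mathbb X_{t,u}+x_{s,t}\otimes x_{t,u}$ for $s\le t\le u$, $|x_{s,t}|\le\omega(s,t)^{1/p}$, $|\mathbb X_{s,t}|\le\omega(s,t)^{2/p}$, and the symmetric part of $\mathbb X_{s,t}$ equals $\frac12x_{s,t}\otimes x_{s,t}$. Controlled rough paths in $M$: $\mathbf y=(y,y^\dagger)$ on an interval $I_0$ belongs to $CRP_{\mathbf X}(M)$ if $y:I_0\to M$ and $y^\dagger$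 are continuous, $y_s^\dagger\in L(W,T_{y_s}M)$, and for every chart $\phi$ with domain $D(\phi)$ and every $[a,b]\subseteq I_0$ with $y([a,b])\subseteq D(\phi)$ there is $C$ such that for all $a\le s\le t\le b$: $|\phi(y_t)-\phi(y_s)-d\phi\circ y_s^\dagger x_{s,t}|\le C\omega(s,t)^{2/p}$ and $|d\phi\circ y_t^\dagger-d\phi\circ y_s^\dagger|\le C\omega(s,t)^{1/p}$. Notation $|_{w\otimes\tilde w=\mathbb W}$: for a bilinear $\Xi$ on $W\times W$ and $\mathbb W=\sum_iw_i\otimes\tilde w_i$, $\Xi(w,\tilde w)|_{w\otimes\tilde w=\mathbb W}:=\sum_i\Xi(w_i,\tilde w_i)$. Solution: $\mathbf y=(y,y^\dagger)$ on an interval $I_0$ (of the form $[0,T_0]$ or $[0,T_0)$, $T_0\le T$) solves $d\mathbf y_t=F_{d\mathbf X_t}(y_t)$ if $y_s^\dagger w=F_w(y_s)$ for all $s\in I_0$, $w\in W$, and for every $f\in C^\infty(M)$ and every $[a,b]\subseteq I_0$ there are $C<\infty$, $\delta>0$ with $$\left|f(y_t)-f(y_s)-(F_{x_{s,t}}f)(y_s)-(F_wF_{\tilde w}f)(y_s)|_{w\otimes\tilde w=\mathbb X_{s,t}}\right|\le C\omega(s,t)^{3/p}$$ for all $a\le s\le t\le b$ with $t-s\le\delta$. *)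

theory Defs
  imports "HOL-Analysis.Analysis"
begin

section \<open>Smooth maps on open sets\<close>

text \<open>Continuous differentiability of order \<open>k\<close> through iterated directional derivatives, which
  on open subsets of finite-dimensional spaces is the usual notion. It is only used for open
  \<open>S\<close>, so that the derivatives do not depend on the values of \<open>f\<close> outside \<open>S\<close>.\<close>

primrec C_diff_on :: "nat \<Rightarrow> 'a::real_normed_vector set \<Rightarrow> ('a \<Rightarrow> 'b::real_normed_vector) \<Rightarrow> bool" where
  "C_diff_on 0 S f \<longleftrightarrow> continuous_on S f"
| "C_diff_on (Suc k) S f \<longleftrightarrow>
     (\<forall>u\<in>S. f differentiable (at u)) \<and>
     (\<forall>v. C_diff_on k S (\<lambda>u. frechet_derivative f (at u) v))"

definition smooth_on :: "'a::real_normed_vector set \<Rightarrow> ('a \<Rightarrow> 'b::real_normed_vector) \<Rightarrow> bool" where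
  "smooth_on S f \<longleftrightarrow> (\<forall>k. C_diff_on k S f)"

section \<open>Smooth manifolds\<close>

text \<open>A manifold is a Hausdorff, second countable type \<open>'m\<close> together with a smooth atlas. Charts
  take values in a type \<open>'e\<close> of sort \<open>{real_inner, heine_borel}\<close>: these are exactly the
  finite-dimensional inner product spaces. Unlike \<open>euclidean_space\<close>, this sort does not
  exclude dimension zero.

  A chart is a pair of its domain and a map of which only the values on the domain matter.\<close>

type_synonym ('m, 'e) chart = "'m set \<times> ('m \<Rightarrow> 'e)"

abbreviation chart_inv :: "('m, 'e) chart \<Rightarrow> 'e \<Rightarrow> 'm" where
  "chart_inv c \<equiv> inv_into (fst c) (snd c)"

definition topological_chart ::
    "('m::{t2_space,second_countable_topology}, 'e::{real_inner,heine_borel}) chart \<Rightarrow> bool" where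
  "topological_chart c \<longleftrightarrow>
     open (fst c) \<and> open (snd c ` fst c) \<and>
     homeomorphism (fst c) (snd c ` fst c) (snd c) (chart_inv c)"

definition smooth_compatible ::
    "('m, 'e::{real_inner,heine_borel}) chart \<Rightarrow> ('m, 'e) chart \<Rightarrow> bool" where
  "smooth_compatible c d \<longleftrightarrow>
     smooth_on (snd c ` (fst c \<inter> fst d)) (snd d \<circ> chart_inv c) \<and>
     smooth_on (snd d ` (fst c \<inter> fst d)) (snd c \<circ> chart_inv d)"

definition smooth_atlas ::
    "('m::{t2_space,second_countable_topology}, 'e::{real_inner,heine_borel}) chart set \<Rightarrow> bool" where
  "smooth_atlas A \<longleftrightarrow>
     (\<forall>c\<in>A. topological_chart c) \<and>
     (\<Union>c\<in>A. fst c) = UNIV \<and>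
     (\<forall>c\<in>A. \<forall>d\<in>A. smooth_compatible c d)"

text \<open>The maximal atlas generated by \<open>A\<close>, that is, all charts of the smooth manifold.\<close>

definition charts ::
    "('m::{t2_space,second_countable_topology}, 'e::{real_inner,heine_borel}) chart set
      \<Rightarrow> ('m, 'e) chart set" where
  "charts A = {c. topological_chart c \<and> (\<forall>d\<in>A. smooth_compatible c d)}"

definition charts_at ::
    "('m::{t2_space,second_countable_topology}, 'e::{real_inner,heine_borel}) chart set
      \<Rightarrow> 'm \<Rightarrow> ('m, 'e) chart set" where
  "charts_at A m = {c \<in> charts A. m \<in> fst c}"

definition smooth_fun ::
    "('m::{t2_space,second_countable_topology}, 'e::{real_inner,heine_borel}) chart set
      \<Rightarrow> ('m \<Rightarrow> real) \<Rightarrow> bool" where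
  "smooth_fun A f \<longleftrightarrow> (\<forall>c\<in>charts A. smooth_on (snd c ` fst c) (f \<circ> chart_inv c))"

section \<open>Tangent vectors and vector fields\<close>

text \<open>A tangent vector at \<open>m\<close> is given by its coordinates in all charts around \<open>m\<close>, which transform
  by the derivatives of the transition maps. So \<open>v c\<close> is the image of \<open>v\<close> under the differential
  of the chart \<open>c\<close>. Setting \<open>v c = 0\<close> for all other \<open>c\<close> makes tangent vectors at \<open>m\<close> equal when
  their coordinates are.\<close>

type_synonym ('m, 'e) tangent = "('m, 'e) chart \<Rightarrow> 'e"

definition tangent_space ::
    "('m::{t2_space,second_countable_topology}, 'e::{real_inner,heine_borel}) chart set
      \<Rightarrow> 'm \<Rightarrow> ('m, 'e) tangent set" where
  "tangent_space A m =
     {v. (\<forall>c\<in>charts_at A m. \<forall>d\<in>charts_at A m.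
            v d = frechet_derivative (snd d \<circ> chart_inv c) (at (snd c m)) (v c)) \<and>
         (\<forall>c. c \<notin> charts_at A m \<longrightarrow> v c = 0)}"

text \<open>The derivative of \<open>f\<close> in the direction of a tangent vector \<open>v\<close> at \<open>m\<close>. By the chain rule the
  value does not depend on the chart chosen.\<close>

definition tangent_deriv ::
    "('m::{t2_space,second_countable_topology}, 'e::{real_inner,heine_borel}) chart set
      \<Rightarrow> 'm \<Rightarrow> ('m, 'e) tangent \<Rightarrow> ('m \<Rightarrow> real) \<Rightarrow> real" where
  "tangent_deriv A m v f =
     (let c = (SOME c. c \<in> charts_at A m)
      in frechet_derivative (f \<circ> chart_inv c) (at (snd c m)) (v c))"

definition smooth_vector_field ::
    "('m::{t2_space,second_countable_topology}, 'e::{real_inner,heine_borel}) chart set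
      \<Rightarrow> ('m \<Rightarrow> ('m, 'e) tangent) \<Rightarrow> bool" where
  "smooth_vector_field A V \<longleftrightarrow>
     (\<forall>m. V m \<in> tangent_space A m) \<and>
     (\<forall>c\<in>charts A. smooth_on (snd c ` fst c) (\<lambda>u. V (chart_inv c u) c))"

definition field_deriv ::
    "('m::{t2_space,second_countable_topology}, 'e::{real_inner,heine_borel}) chart set
      \<Rightarrow> ('m \<Rightarrow> ('m, 'e) tangent) \<Rightarrow> ('m \<Rightarrow> real) \<Rightarrow> 'm \<Rightarrow> real" where
  "field_deriv A V f m = tangent_deriv A m (V m) f"

text \<open>Linear maps from \<open>W\<close> to the tangent space at \<open>m\<close>, and linear maps from \<open>W\<close> to smooth vector
  fields. The vector space operations on tangent vectors are those on coordinates.\<close>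

definition tangent_linear_maps ::
    "('m::{t2_space,second_countable_topology}, 'e::{real_inner,heine_borel}) chart set
      \<Rightarrow> 'm \<Rightarrow> ('w::real_vector \<Rightarrow> ('m, 'e) tangent) set" where
  "tangent_linear_maps A m =
     {u. (\<forall>w. u w \<in> tangent_space A m) \<and> (\<forall>c. linear (\<lambda>w. u w c))}"

definition linear_vector_fields ::
    "('m::{t2_space,second_countable_topology}, 'e::{real_inner,heine_borel}) chart set
      \<Rightarrow> ('w::real_vector \<Rightarrow> 'm \<Rightarrow> ('m, 'e) tangent) \<Rightarrow> bool" where
  "linear_vector_fields A F \<longleftrightarrow>
     (\<forall>w. smooth_vector_field A (F w)) \<and> (\<forall>m c. linear (\<lambda>w. F w m c))"

section \<open>Rough paths\<close>

definition simplex_interval :: "real \<Rightarrow> (real \<times> real) set" where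
  "simplex_interval T = {(s, t). 0 \<le> s \<and> s \<le> t \<and> t \<le> T}"

definition control :: "real \<Rightarrow> (real \<Rightarrow> real \<Rightarrow> real) \<Rightarrow> bool" where
  "control T \<omega> \<longleftrightarrow>
     continuous_on (simplex_interval T) (\<lambda>(s, t). \<omega> s t) \<and>
     (\<forall>(s, t)\<in>simplex_interval T. 0 \<le> \<omega> s t) \<and>
     (\<forall>s\<in>{0..T}. \<omega> s s = 0) \<and>
     (\<forall>s t u. 0 \<le> s \<and> s \<le> t \<and> t \<le> u \<and> u \<le> T \<longrightarrow> \<omega> s t + \<omega> t u \<le> \<omega> s u)"

text \<open>The tensor square of \<open>real ^ 'k\<close> is the space of square matrices with the Frobenius norm; the
  entry \<open>Z $ i $ j\<close> is the coefficient of the tensor product of the \<open>i\<close>-th and the \<open>j\<close>-th basis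
  vectors, in this order.\<close>

definition tensor :: "real ^ 'k \<Rightarrow> real ^ 'k \<Rightarrow> real ^ 'k ^ 'k" where
  "tensor v w = (\<chi> i j. v $ i * w $ j)"

text \<open>A bilinear \<open>B\<close> evaluated on the tensor \<open>Z\<close>, written as the combination of the tensor products
  of basis vectors with coefficients \<open>Z $ i $ j\<close>. By bilinearity any other way of writing \<open>Z\<close> as
  a sum of elementary tensors gives the same value.\<close>

definition eval_tensor ::
    "(real ^ 'k \<Rightarrow> real ^ 'k \<Rightarrow> real) \<Rightarrow> real ^ 'k ^ 'k \<Rightarrow> real" where
  "eval_tensor B Z = (\<Sum>i\<in>UNIV. \<Sum>j\<in>UNIV. Z $ i $ j * B (axis i 1) (axis j 1))"

definition weak_geometric_rough_path ::
    "real \<Rightarrow> real \<Rightarrow> (real \<Rightarrow> real \<Rightarrow> real) \<Rightarrow>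
      (real \<Rightarrow> real ^ 'k) \<Rightarrow> (real \<Rightarrow> real \<Rightarrow> real ^ 'k ^ 'k) \<Rightarrow> bool" where
  "weak_geometric_rough_path T p \<omega> x X \<longleftrightarrow>
     continuous_on {0..T} x \<and>
     continuous_on (simplex_interval T) (\<lambda>(s, t). X s t) \<and>
     (\<forall>s t u. 0 \<le> s \<and> s \<le> t \<and> t \<le> u \<and> u \<le> T \<longrightarrow>
        X s u = X s t + X t u + tensor (x t - x s) (x u - x t)) \<and>
     (\<forall>(s, t)\<in>simplex_interval T.
        norm (x t - x s) \<le> \<omega> s t powr (1 / p) \<and>
        norm (X s t) \<le> \<omega> s t powr (2 / p) \<and>
        (1 / 2) *\<^sub>R (X s t + transpose (X s t)) = (1 / 2) *\<^sub>R tensor (x t - x s) (x t - x s))"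

section \<open>Controlled rough paths and rough differential equations\<close>

text \<open>Continuity of \<open>y'\<close>, as a path in the bundle of linear maps from \<open>W\<close> to the tangent spaces, is
  continuity in the local trivialisations that come from the charts.\<close>

definition controlled_rough_path ::
    "('m::{t2_space,second_countable_topology}, 'e::{real_inner,heine_borel}) chart set
      \<Rightarrow> real \<Rightarrow> (real \<Rightarrow> real \<Rightarrow> real) \<Rightarrow> (real \<Rightarrow> real ^ 'k) \<Rightarrow> real set
      \<Rightarrow> (real \<Rightarrow> 'm) \<Rightarrow> (real \<Rightarrow> real ^ 'k \<Rightarrow> ('m, 'e) tangent) \<Rightarrow> bool" where
  "controlled_rough_path A p \<omega> x I y y' \<longleftrightarrow>
     continuous_on I y \<and>
     (\<forall>s\<in>I. y' s \<in> tangent_linear_maps A (y s)) \<and>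
     (\<forall>c\<in>charts A. \<forall>w. continuous_on {s \<in> I. y s \<in> fst c} (\<lambda>s. y' s w c)) \<and>
     (\<forall>c\<in>charts A. \<forall>a b. {a..b} \<subseteq> I \<and> y ` {a..b} \<subseteq> fst c \<longrightarrow>
        (\<exists>C. \<forall>s t. a \<le> s \<and> s \<le> t \<and> t \<le> b \<longrightarrow>
           norm (snd c (y t) - snd c (y s) - y' s (x t - x s) c) \<le> C * \<omega> s t powr (2 / p) \<and>
           onorm (\<lambda>w. y' t w c - y' s w c) \<le> C * \<omega> s t powr (1 / p)))"

definition solves_RDE ::
    "('m::{t2_space,second_countable_topology}, 'e::{real_inner,heine_borel}) chart set
      \<Rightarrow> (real ^ 'k \<Rightarrow> 'm \<Rightarrow> ('m, 'e) tangent)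
      \<Rightarrow> real \<Rightarrow> (real \<Rightarrow> real \<Rightarrow> real) \<Rightarrow> (real \<Rightarrow> real ^ 'k) \<Rightarrow> (real \<Rightarrow> real \<Rightarrow> real ^ 'k ^ 'k)
      \<Rightarrow> real set \<Rightarrow> (real \<Rightarrow> 'm) \<Rightarrow> (real \<Rightarrow> real ^ 'k \<Rightarrow> ('m, 'e) tangent) \<Rightarrow> bool" where
  "solves_RDE A F p \<omega> x X I y y' \<longleftrightarrow>
     (\<forall>s\<in>I. \<forall>w. y' s w = F w (y s)) \<and>
     (\<forall>f. smooth_fun A f \<longrightarrow>
        (\<forall>a b. {a..b} \<subseteq> I \<longrightarrow>
           (\<exists>C. \<exists>\<delta>>0. \<forall>s t. a \<le> s \<and> s \<le> t \<and> t \<le> b \<and> t - s \<le> \<delta> \<longrightarrow>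
              \<bar>f (y t) - f (y s) - field_deriv A (F (x t - x s)) f (y s)
                - eval_tensor (\<lambda>w w'. field_deriv A (F w) (field_deriv A (F w') f) (y s)) (X s t)\<bar>
              \<le> C * \<omega> s t powr (3 / p))))"

definition initial_interval :: "real \<Rightarrow> real set \<Rightarrow> bool" where
  "initial_interval T I \<longleftrightarrow> (\<exists>T0. 0 < T0 \<and> T0 \<le> T \<and> (I = {0..T0} \<or> I = {0..<T0}))"

text \<open>The alternative between global existence and leaving every compact set.\<close>

definition global_or_explodes ::
    "real \<Rightarrow> real set \<Rightarrow> (real \<Rightarrow> 'm::topological_space) \<Rightarrow> bool" where
  "global_or_explodes T I y \<longleftrightarrow>
     I = {0..T} \<or>
     (\<exists>\<tau>. 0 < \<tau> \<and> \<tau> \<le> T \<and> I = {0..<\<tau>} \<and> \<not> compact (closure (y ` {0..<\<tau>})))"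

definition RDE_solution_from ::
    "('m::{t2_space,second_countable_topology}, 'e::{real_inner,heine_borel}) chart set
      \<Rightarrow> (real ^ 'k \<Rightarrow> 'm \<Rightarrow> ('m, 'e) tangent)
      \<Rightarrow> real \<Rightarrow> (real \<Rightarrow> real \<Rightarrow> real) \<Rightarrow> (real \<Rightarrow> real ^ 'k) \<Rightarrow> (real \<Rightarrow> real \<Rightarrow> real ^ 'k ^ 'k)
      \<Rightarrow> 'm \<Rightarrow> real set \<Rightarrow> (real \<Rightarrow> 'm) \<Rightarrow> (real \<Rightarrow> real ^ 'k \<Rightarrow> ('m, 'e) tangent) \<Rightarrow> bool" where
  "RDE_solution_from A F p \<omega> x X y0 I y y' \<longleftrightarrow>
     controlled_rough_path A p \<omega> x I y y' \<and> solves_RDE A F p \<omega> x X I y y' \<and> y 0 = y0"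

end

theory Submission
  imports Defs
begin

text \<open>In a chart, a solution is a path that follows the second order Euler scheme \<open>\<mu> s t\<close> up to an error
  of order \<open>\<omega> s t powr (3 / p)\<close>: one direction tests the equation with the coordinates cut off outside
  a ball, the other is Taylor's formula, whose second order term is matched by the symmetric part of the
  area. The scheme is an almost flow, that is, \<open>\<mu> t u \<circ> \<mu> s t\<close> differs from \<open>\<mu> s u\<close> by a map whose size and
  Lipschitz constant are \<open>O(\<omega> s u powr (3 / p))\<close>, and \<open>3 / p > 1\<close>.

  Along every finite partition the iterated scheme satisfies the error bound with one constant (Davie).
  The paths that satisfy it at a given pair of times form a closed set in the product of compact balls
  over all times, so by Tychonoff's theorem a path exists that satisfies it at all pairs. For
  uniqueness, the error of the difference of two solutions is bounded by the difference itself, which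
  therefore vanishes on short intervals. The time of existence is locally uniform in the initial point
  and hence uniform on compact sets, so the maximal solution leaves every compact set unless it is
  global.\<close>

text \<open>Multiplied by a cutoff, the coordinate fields become smooth with bounded support on all
  of \<open>'e\<close>: one set of constants serves the whole space, and the scheme cannot leave its
  domain. A path that stays in the inner ball does not see the cutoff. The bound
  \<open>p < 3\<close> enters through \<open>3 / p > 1\<close>: halving the control multiplies the
  sum of two errors of order \<open>3 / p\<close> by \<open>q = 2 powr (1 - 3 / p) < 1\<close>, and
  this gain closes the recursions of both existence and uniqueness. To preserve it, the Lipschitz
  constants of the scheme have to be \<open>1 + O(\<kappa>)\<close>. Uniqueness compares the scheme
  at perturbed points, hence the estimates for mixed differences of the fields and for the
  dependence of Taylor remainders on their base points. Tychonoff's theorem asks no regularity of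
  the path; its continuity is read off the error bound afterwards. Since \<open>solves_RDE\<close>
  bounds the error only for \<open>t - s \<le> \<delta>\<close>, gluing two solutions concerns pairs
  close to the junction, which fit into one chart, whereas the bounds of a controlled path hold for
  all pairs and must be assembled over the whole interval.\<close>

section \<open>Orthonormal bases\<close>

text \<open>Distinct orthonormal vectors are at distance \<open>sqrt 2\<close>, so no two of them
  lie in one ball of radius \<open>1/2\<close>; a finite cover of the unit ball by such balls then
  counts them. Finite dimension enters here, through compactness of the closed unit ball.\<close>

lemma orthonormal_card_bound:
  "\<exists>n::nat. \<forall>B::'e::{real_inner,heine_borel} set.
     finite B \<and> (\<forall>b\<in>B. \<forall>b'\<in>B. b \<bullet> b' = (if b = b' then 1 else 0)) \<longrightarrow> card B \<le> n"
proof -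
  have "compact (cball (0::'e) 1)" by simp
  then obtain K :: "'e set" where K: "finite K" "cball 0 1 \<subseteq> (\<Union>x\<in>K. ball x (1/2))"
    using compact_imp_seq_compact seq_compact_imp_totally_bounded
    by (metis half_gt_zero zero_less_one)
  have "card B \<le> card K"
    if B: "finite B" "\<forall>b\<in>B. \<forall>b'\<in>B. b \<bullet> b' = (if b = b' then 1 else 0)" for B :: "'e set"
  proof -
    have "\<exists>x\<in>K. b \<in> ball x (1/2)" if "b \<in> B" for b
    proof -
      have "norm b = 1" using B(2) that by (simp add: norm_eq_sqrt_inner)
      then show ?thesis using K(2) by (auto simp: subset_iff)
    qed
    then obtain k where k: "\<And>b. b \<in> B \<Longrightarrow> k b \<in> K \<and> b \<in> ball (k b) (1/2)" by metis
    have "inj_on k B"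
    proof (rule inj_onI, rule ccontr)
      fix b b' assume b: "b \<in> B" "b' \<in> B" "k b = k b'" "b \<noteq> b'"
      have "dist b b' < 1"
        using k[OF b(1)] k[OF b(2)] b(3) dist_triangle_half_r[of "k b" b 1 b'] by auto
      then have "norm (b - b') < 1" by (simp add: dist_norm)
      then have "(norm (b - b'))\<^sup>2 < 1\<^sup>2" by (intro power_strict_mono) auto
      moreover have "(norm (b - b'))\<^sup>2 = 2"
        using B(2) b by (simp add: power2_norm_eq_inner inner_diff inner_commute)
      ultimately show False by simp
    qed
    moreover have "k ` B \<subseteq> K" using k by auto
    ultimately show ?thesis using K(1) card_inj_on_le by blast
  qed
  then show ?thesis by blast
qed

text \<open>Take an orthonormal set of largest cardinality: a nonzero remainder of some vector would
  be orthogonal to it and, normalised, enlarge it.\<close>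

lemma ex_orthonormal_basis:
  "\<exists>B::'e::{real_inner,heine_borel} set.
     finite B \<and> (\<forall>b\<in>B. norm b = 1) \<and> (\<forall>v. (\<Sum>b\<in>B. (v \<bullet> b) *\<^sub>R b) = v)"
proof -
  define orth where "orth B \<longleftrightarrow> finite B \<and> (\<forall>b\<in>B. \<forall>b'\<in>B. b \<bullet> b' = (if b = b' then 1 else 0))"
    for B :: "'e set"
  obtain n where n: "\<And>B. orth B \<Longrightarrow> card B \<le> n"
    using orthonormal_card_bound unfolding orth_def by metis
  have "orth {}" by (simp add: orth_def)
  then obtain B where B: "orth B" "\<And>B'. orth B' \<Longrightarrow> card B' \<le> card B"
    using ex_has_greatest_nat[of orth "{}" card "Suc n"] n by (auto simp: less_Suc_eq_le)
  have fin: "finite B" using B(1) by (simp add: orth_def)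
  have "(\<Sum>b\<in>B. (v \<bullet> b) *\<^sub>R b) = v" for v
  proof (rule ccontr)
    assume ne: "(\<Sum>b\<in>B. (v \<bullet> b) *\<^sub>R b) \<noteq> v"
    define r where "r = v - (\<Sum>b\<in>B. (v \<bullet> b) *\<^sub>R b)"
    have r0: "r \<noteq> 0" using ne by (simp add: r_def)
    have perp: "r \<bullet> b = 0" if "b \<in> B" for b
    proof -
      have "(\<Sum>b'\<in>B. (v \<bullet> b') *\<^sub>R b') \<bullet> b = (\<Sum>b'\<in>B. (v \<bullet> b') * (if b' = b then 1 else 0))"
        unfolding inner_sum_left
        using B(1) that by (intro sum.cong) (auto simp: orth_def)
      also have "\<dots> = v \<bullet> b" using fin that by (simp add: if_distrib cong: if_cong)
      finally show ?thesis by (simp add: r_def inner_diff_left)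
    qed
    define e where "e = r /\<^sub>R norm r"
    have "e \<bullet> e = 1" using r0 by (simp add: e_def dot_square_norm power2_eq_square)
    moreover have "e \<bullet> b = 0" "b \<bullet> e = 0" if "b \<in> B" for b
      using perp[OF that] by (simp_all add: e_def inner_commute)
    moreover from this have "e \<notin> B" using \<open>e \<bullet> e = 1\<close> by force
    ultimately have "orth (insert e B)"
      using B(1) unfolding orth_def by (auto simp: inner_commute)
    from B(2)[OF this] show False using \<open>e \<notin> B\<close> fin by simp
  qed
  moreover have "\<forall>b\<in>B. norm b = 1" using B(1) by (auto simp: orth_def norm_eq_sqrt_inner)
  ultimately show ?thesis using fin by blast
qed

text \<open>A fixed orthonormal basis that also exists in dimension zero, where it is empty.\<close>

definition onb :: "'e::{real_inner,heine_borel} set" where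
  "onb = (SOME B. finite B \<and> (\<forall>b\<in>B. norm b = 1) \<and> (\<forall>v. (\<Sum>b\<in>B. (v \<bullet> b) *\<^sub>R b) = v))"

lemma finite_onb [simp]: "finite onb"
  and norm_onb: "b \<in> onb \<Longrightarrow> norm b = 1"
  and onb_expansion: "(\<Sum>b\<in>onb. (v \<bullet> b) *\<^sub>R b) = v"
  using someI_ex[OF ex_orthonormal_basis, folded onb_def] by auto

lemma linear_onb_expansion:
  assumes "linear f"
  shows "f v = (\<Sum>b\<in>onb. (v \<bullet> b) *\<^sub>R f b)"
proof -
  have "f v = f (\<Sum>b\<in>onb. (v \<bullet> b) *\<^sub>R b)" by (simp add: onb_expansion)
  also have "\<dots> = (\<Sum>b\<in>onb. (v \<bullet> b) *\<^sub>R f b)"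
    using assms by (simp add: linear_sum linear_scale)
  finally show ?thesis .
qed

lemma abs_inner_onb_le: "b \<in> onb \<Longrightarrow> \<bar>v \<bullet> b\<bar> \<le> norm v"
  using Cauchy_Schwarz_ineq2[of v b] by (simp add: norm_onb)

lemma norm_le_sum_onb: "norm v \<le> (\<Sum>b\<in>onb. \<bar>v \<bullet> b\<bar>)"
proof -
  have "norm v = norm (\<Sum>b\<in>onb. (v \<bullet> b) *\<^sub>R b)" by (simp add: onb_expansion)
  also have "\<dots> \<le> (\<Sum>b\<in>onb. \<bar>v \<bullet> b\<bar>)"
    by (rule sum_norm_le) (simp add: norm_onb)
  finally show ?thesis .
qed

text \<open>Turns constants \<open>L b\<close> found for each single basis direction into a bound
  uniform in the direction \<open>v\<close>. The factor \<open>N\<close> carries whatever else the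
  estimate depends on, such as the distance of two base points.\<close>

lemma norm_linear_le_onb:
  assumes "linear f" and "\<And>b. b \<in> onb \<Longrightarrow> norm (f b) \<le> L b * N"
  shows "norm (f v) \<le> (\<Sum>b\<in>onb. L b) * norm v * N"
proof -
  have "norm (f v) \<le> (\<Sum>b\<in>onb. norm v * (L b * N))"
    unfolding linear_onb_expansion[OF assms(1), of v]
    by (intro sum_norm_le) (auto intro!: mult_mono assms(2) abs_inner_onb_le)
  also have "\<dots> = (\<Sum>b\<in>onb. L b) * norm v * N"
    by (simp add: sum_distrib_left sum_distrib_right ac_simps)
  finally show ?thesis .
qed

section \<open>Calculus of smooth maps\<close>

abbreviation fd :: "('a::real_normed_vector \<Rightarrow> 'b::real_normed_vector) \<Rightarrow> 'a \<Rightarrow> 'a \<Rightarrow> 'b" where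
  "fd f u \<equiv> frechet_derivative f (at u)"

lemma fd_eqI: "(f has_derivative f') (at u) \<Longrightarrow> fd f u = f'"
  by (metis frechet_derivative_at)

lemma linear_fd: "f differentiable at u \<Longrightarrow> linear (fd f u)"
  by (simp add: frechet_derivative_works has_derivative_linear)

lemma C_diff_on_subset: "C_diff_on k S f \<Longrightarrow> S' \<subseteq> S \<Longrightarrow> C_diff_on k S' f"
  by (induction k arbitrary: f) (auto intro: continuous_on_subset)

lemma C_diff_on_cong:
  assumes "open S" "\<And>u. u \<in> S \<Longrightarrow> f u = g u" "C_diff_on k S f"
  shows "C_diff_on k S g"
  using assms(2,3)
proof (induction k arbitrary: f g)
  case 0
  then show ?case using continuous_on_cong[of S S f g] by simp
next
  case (Suc k)
  have diff: "f differentiable at u" if "u \<in> S" for u using Suc.prems that by simp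
  have eq: "fd f u = fd g u" if "u \<in> S" for u
    using frechet_derivative_transform_within_open[OF diff assms(1)] Suc.prems(1) that by blast
  have "g differentiable at u" if "u \<in> S" for u
    using diff[OF that] assms(1) that Suc.prems(1) unfolding differentiable_def
    by (meson has_derivative_transform_within_open)
  moreover have "C_diff_on k S (\<lambda>u. fd g u v)" for v
    using Suc.IH[of "\<lambda>u. fd f u v" "\<lambda>u. fd g u v"] eq Suc.prems(2) by simp
  ultimately show ?case by simp
qed

lemma C_diff_on_local:
  assumes "\<And>u. u \<in> S \<Longrightarrow> \<exists>S'. open S' \<and> u \<in> S' \<and> C_diff_on k S' f"
  shows "C_diff_on k S f"
  using assms
proof (induction k arbitrary: f)
  case 0
  then have "isCont f u" if "u \<in> S" for u
    using that by (metis C_diff_on.simps(1) continuous_on_eq_continuous_at)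
  then show ?case by (simp add: continuous_at_imp_continuous_on)
next
  case (Suc k)
  have "f differentiable at u" if "u \<in> S" for u
    using Suc.prems[OF that] by auto
  moreover have "C_diff_on k S (\<lambda>u. fd f u v)" for v
    by (rule Suc.IH) (use Suc.prems in fastforce)
  ultimately show ?case by simp
qed

lemma C_diff_on_Suc_imp: "C_diff_on (Suc k) S f \<Longrightarrow> C_diff_on k S f"
proof (induction k arbitrary: f)
  case 0
  then show ?case
    by (simp add: continuous_at_imp_continuous_on differentiable_imp_continuous_within)
next
  case (Suc k)
  have "C_diff_on k S (\<lambda>u. fd f u v)" for v
    by (rule Suc.IH) (use Suc.prems in auto)
  then show ?case using Suc.prems by auto
qed

text \<open>Lets an explicit formula stand in for \<open>frechet_derivative\<close>; a closure
  property then becomes an induction on the order, driven by the matching differentiation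
  rule.\<close>

lemma C_diff_on_SucI:
  assumes "open S" and "\<And>u. u \<in> S \<Longrightarrow> (f has_derivative f' u) (at u)"
    and "\<And>v. C_diff_on k S (\<lambda>u. f' u v)"
  shows "C_diff_on (Suc k) S f"
proof -
  have "f differentiable at u" if "u \<in> S" for u
    using assms(2)[OF that] differentiable_def by blast
  moreover have "C_diff_on k S (\<lambda>u. fd f u v)" for v
    by (rule C_diff_on_cong[OF assms(1) _ assms(3)[of v]]) (simp add: fd_eqI[OF assms(2)])
  ultimately show ?thesis by simp
qed

lemma C_diff_on_has_derivative:
  "C_diff_on (Suc k) S f \<Longrightarrow> u \<in> S \<Longrightarrow> (f has_derivative fd f u) (at u)"
  by (simp add: frechet_derivative_works)

section \<open>Closure of the differentiability classes under algebraic operations and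
  composition\<close>

lemma C_diff_on_const: "C_diff_on k S (\<lambda>u. c)"
  by (induction k arbitrary: c) auto

lemma C_diff_on_bounded_linear:
  assumes "bounded_linear f"
  shows "C_diff_on k S f"
proof (cases k)
  case 0
  then show ?thesis using assms linear_continuous_on by auto
next
  case (Suc n)
  have "(f has_derivative f) (at u)" for u
    using assms by (rule bounded_linear_imp_has_derivative)
  then have "f differentiable at u" "fd f u = f" for u
    by (auto simp: differentiable_def dest: fd_eqI)
  then show ?thesis by (simp add: Suc C_diff_on_const)
qed

lemma C_diff_on_comp_bounded_linear:
  assumes "bounded_linear f" "open S" "C_diff_on k S g"
  shows "C_diff_on k S (\<lambda>u. f (g u))"
  using assms(3)
proof (induction k arbitrary: g)
  case 0
  then show ?case
    using assms(1) by (auto intro: bounded_linear.continuous_on)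
next
  case (Suc k)
  show ?case
  proof (rule C_diff_on_SucI[OF assms(2)])
    show "((\<lambda>u. f (g u)) has_derivative (\<lambda>v. f (fd g u v))) (at u)" if "u \<in> S" for u
      using C_diff_on_has_derivative[OF Suc.prems that]
      by (rule bounded_linear.has_derivative[OF assms(1)])
  qed (use Suc in simp)
qed

lemma C_diff_on_add:
  assumes "open S" "C_diff_on k S f" "C_diff_on k S g"
  shows "C_diff_on k S (\<lambda>u. f u + g u)"
  using assms(2,3)
proof (induction k arbitrary: f g)
  case 0
  then show ?case by (auto intro: continuous_intros)
next
  case (Suc k)
  show ?case
  proof (rule C_diff_on_SucI[OF assms(1)])
    show "((\<lambda>u. f u + g u) has_derivative (\<lambda>v. fd f u v + fd g u v)) (at u)" if "u \<in> S" for u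
      using C_diff_on_has_derivative[OF Suc.prems(1) that] C_diff_on_has_derivative[OF Suc.prems(2) that]
      by (rule has_derivative_add)
  qed (use Suc in simp)
qed

lemma C_diff_on_sum:
  assumes "open S" "\<And>i. i \<in> I \<Longrightarrow> C_diff_on k S (f i)"
  shows "C_diff_on k S (\<lambda>u. \<Sum>i\<in>I. f i u)"
  using assms(2)
  by (induction I rule: infinite_finite_induct) (auto simp: C_diff_on_const C_diff_on_add[OF assms(1)])

lemma C_diff_on_bounded_bilinear:
  assumes "bounded_bilinear B" "open S" "C_diff_on k S f" "C_diff_on k S g"
  shows "C_diff_on k S (\<lambda>u. B (f u) (g u))"
  using assms(3,4)
proof (induction k arbitrary: f g)
  case 0
  then show ?case
    using assms(1) by (auto intro: bounded_bilinear.continuous_on)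
next
  case (Suc k)
  show ?case
  proof (rule C_diff_on_SucI[OF assms(2)])
    show "((\<lambda>u. B (f u) (g u)) has_derivative (\<lambda>v. B (f u) (fd g u v) + B (fd f u v) (g u))) (at u)"
      if "u \<in> S" for u
      using bounded_bilinear.FDERIV[OF assms(1)] C_diff_on_has_derivative[OF Suc.prems(1) that]
        C_diff_on_has_derivative[OF Suc.prems(2) that] by blast
    show "C_diff_on k S (\<lambda>u. B (f u) (fd g u v) + B (fd f u v) (g u))" for v
      using Suc.prems C_diff_on_Suc_imp[OF Suc.prems(1)] C_diff_on_Suc_imp[OF Suc.prems(2)]
      by (intro C_diff_on_add[OF assms(2)] Suc.IH) simp_all
  qed
qed

lemmas C_diff_on_scaleR = C_diff_on_bounded_bilinear[OF bounded_bilinear_scaleR]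
  and C_diff_on_mult = C_diff_on_bounded_bilinear[OF bounded_bilinear_mult]
  and C_diff_on_inner = C_diff_on_bounded_bilinear[OF bounded_bilinear_inner]

text \<open>By the chain rule the derivative is \<open>fd g (f u)\<close> in a direction that itself
  varies with \<open>u\<close>, whereas \<open>C_diff_on\<close> speaks of fixed directions.
  Expanding that direction in \<open>onb\<close> leaves a finite sum of products in which
  \<open>g\<close> is differentiated in fixed directions only, and the induction hypothesis applies
  to \<open>\<lambda>u. fd g u b\<close>.\<close>

lemma C_diff_on_compose:
  fixes f :: "'a::real_normed_vector \<Rightarrow> 'e::{real_inner,heine_borel}"
  assumes "open S" "open S'" "f ` S \<subseteq> S'" "C_diff_on k S f" "C_diff_on k S' g"
  shows "C_diff_on k S (\<lambda>u. g (f u))"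
  using assms(4,5)
proof (induction k arbitrary: g)
  case 0
  then show ?case using assms(3) by (auto intro: continuous_on_compose2)
next
  case (Suc k)
  show ?case
  proof (rule C_diff_on_SucI[OF assms(1)])
    fix u assume u: "u \<in> S"
    have g: "(g has_derivative fd g (f u)) (at (f u))"
      using C_diff_on_has_derivative[OF Suc.prems(2)] assms(3) u by blast
    have "((\<lambda>u. g (f u)) has_derivative (\<lambda>v. fd g (f u) (fd f u v))) (at u)"
      using has_derivative_compose[OF C_diff_on_has_derivative[OF Suc.prems(1) u] g] .
    moreover have "fd g (f u) (fd f u v) = (\<Sum>b\<in>onb. (fd f u v \<bullet> b) *\<^sub>R fd g (f u) b)" for v
      using g by (intro linear_onb_expansion) (auto intro: has_derivative_linear)
    ultimately show "((\<lambda>u. g (f u)) has_derivative (\<lambda>v. \<Sum>b\<in>onb. (fd f u v \<bullet> b) *\<^sub>R fd g (f u) b)) (at u)"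
      by simp
  next
    fix v
    have "C_diff_on k S (\<lambda>u. fd g (f u) b)" for b
      using Suc.IH[of "\<lambda>u. fd g u b"] C_diff_on_Suc_imp[OF Suc.prems(1)] Suc.prems(2) by simp
    then show "C_diff_on k S (\<lambda>u. \<Sum>b\<in>onb. (fd f u v \<bullet> b) *\<^sub>R fd g (f u) b)"
      using Suc.prems(1) assms(1)
      by (intro C_diff_on_sum C_diff_on_scaleR C_diff_on_inner C_diff_on_const) auto
  qed
qed

text \<open>The derivative is a polynomial in \<open>inverse\<close>, so the induction needs only
  closure under products.\<close>

lemma C_diff_on_inverse: "C_diff_on k {t::real. t \<noteq> 0} inverse"
proof (induction k)
  case 0
  then show ?case by (auto intro!: continuous_intros)
next
  case (Suc k)
  have op: "open {t::real. t \<noteq> 0}" by (rule open_Collect_neq) auto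
  show ?case
  proof (rule C_diff_on_SucI[OF op])
    show "(inverse has_derivative (\<lambda>v. - (inverse t * v * inverse t))) (at t)"
      if "t \<in> {t. t \<noteq> 0}" for t :: real
      using that by (auto intro!: has_derivative_inverse')
    show "C_diff_on k {t. t \<noteq> 0} (\<lambda>t. - (inverse t * v * inverse t))" for v :: real
      by (intro C_diff_on_comp_bounded_linear[of uminus] C_diff_on_mult Suc op C_diff_on_const
          bounded_linear_minus bounded_linear_ident)
  qed
qed

section \<open>Smooth maps\<close>

lemma smooth_on_imp_continuous_on: "smooth_on S f \<Longrightarrow> continuous_on S f"
  unfolding smooth_on_def by (metis C_diff_on.simps(1))

lemma smooth_on_differentiable: "smooth_on S f \<Longrightarrow> u \<in> S \<Longrightarrow> f differentiable at u"
  unfolding smooth_on_def by (metis C_diff_on.simps(2))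

lemma smooth_on_has_derivative: "smooth_on S f \<Longrightarrow> u \<in> S \<Longrightarrow> (f has_derivative fd f u) (at u)"
  using smooth_on_differentiable frechet_derivative_works by blast

lemma smooth_on_fd: "smooth_on S f \<Longrightarrow> smooth_on S (\<lambda>u. fd f u v)"
  unfolding smooth_on_def by (metis C_diff_on.simps(2))

lemma smooth_on_subset: "smooth_on S f \<Longrightarrow> S' \<subseteq> S \<Longrightarrow> smooth_on S' f"
  unfolding smooth_on_def using C_diff_on_subset by blast

lemma smooth_on_cong: "open S \<Longrightarrow> smooth_on S f \<Longrightarrow> (\<And>u. u \<in> S \<Longrightarrow> f u = g u) \<Longrightarrow> smooth_on S g"
  unfolding smooth_on_def using C_diff_on_cong by blast

lemma smooth_on_local:
  assumes "\<And>u. u \<in> S \<Longrightarrow> \<exists>S'. open S' \<and> u \<in> S' \<and> smooth_on S' f"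
  shows "smooth_on S f"
  using assms unfolding smooth_on_def by (meson C_diff_on_local)

lemma smooth_on_const: "smooth_on S (\<lambda>u. c)"
  and smooth_on_bounded_linear: "bounded_linear f \<Longrightarrow> smooth_on S f"
  and smooth_on_comp_bounded_linear:
    "bounded_linear l \<Longrightarrow> open S \<Longrightarrow> smooth_on S g \<Longrightarrow> smooth_on S (\<lambda>u. l (g u))"
  and smooth_on_add:
    "open S \<Longrightarrow> smooth_on S g \<Longrightarrow> smooth_on S g' \<Longrightarrow> smooth_on S (\<lambda>u. g u + g' u)"
  and smooth_on_sum:
    "open S \<Longrightarrow> (\<And>i. i \<in> I \<Longrightarrow> smooth_on S (G i)) \<Longrightarrow> smooth_on S (\<lambda>u. \<Sum>i\<in>I. G i u)"
  and smooth_on_scaleR: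
    "open S \<Longrightarrow> smooth_on S a \<Longrightarrow> smooth_on S g \<Longrightarrow> smooth_on S (\<lambda>u. a u *\<^sub>R g u)"
  and smooth_on_inner:
    "open S \<Longrightarrow> smooth_on S h \<Longrightarrow> smooth_on S h' \<Longrightarrow> smooth_on S (\<lambda>u. h u \<bullet> h' u)"
  unfolding smooth_on_def
  by (simp_all add: C_diff_on_const C_diff_on_bounded_linear C_diff_on_comp_bounded_linear
      C_diff_on_add C_diff_on_sum C_diff_on_scaleR C_diff_on_inner)

lemma smooth_on_compose:
  fixes f :: "'a::real_normed_vector \<Rightarrow> 'e::{real_inner,heine_borel}"
  assumes "open S" "open S'" "f ` S \<subseteq> S'" "smooth_on S f" "smooth_on S' g"
  shows "smooth_on S (\<lambda>u. g (f u))"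
  using assms C_diff_on_compose unfolding smooth_on_def by blast

lemma smooth_on_fd_field:
  fixes V :: "'e::{real_inner,heine_borel} \<Rightarrow> 'e"
  assumes "open S" "smooth_on S g" "smooth_on S V"
  shows "smooth_on S (\<lambda>u. fd g u (V u))"
proof (rule smooth_on_cong[OF assms(1)])
  show "smooth_on S (\<lambda>u. \<Sum>b\<in>onb. (V u \<bullet> b) *\<^sub>R fd g u b)"
    using assms
    by (intro smooth_on_sum smooth_on_scaleR smooth_on_inner smooth_on_const smooth_on_fd[OF assms(2)])
  show "(\<Sum>b\<in>onb. (V u \<bullet> b) *\<^sub>R fd g u b) = fd g u (V u)" if "u \<in> S" for u
    by (rule linear_onb_expansion[OF linear_fd[OF smooth_on_differentiable[OF assms(2) that]], symmetric])
qed

section \<open>Cutoff functions\<close>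

text \<open>\<open>n = 0\<close> is the flat function \<open>exp (- 1 / t)\<close>. The powers of
  \<open>1 / t\<close> are carried along because the derivatives of the flat function lie in the
  span of this family.\<close>

definition flat_exp :: "nat \<Rightarrow> real \<Rightarrow> real" where
  "flat_exp n t = (if 0 < t then inverse t ^ n * exp (- inverse t) else 0)"

text \<open>Keep only the term of degree \<open>n + 2\<close> in the series of
  \<open>exp (1 / t)\<close>. The quadratic bound is what makes the difference quotient at
  \<open>0\<close> vanish.\<close>

lemma flat_exp_le:
  assumes "0 < t" shows "flat_exp n t \<le> fact (n + 2) * t\<^sup>2"
proof -
  define s where "s = inverse t"
  define N :: real where "N = fact (n + 2)"
  have s: "0 < s" using assms by (simp add: s_def)
  have N: "0 < N" by (simp add: N_def)
  have "s ^ (n + 2) / N \<le> (\<Sum>i\<le>n + 2. s ^ i /\<^sub>R fact i)"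
    using s by (intro order_trans[OF _ member_le_sum[of "n + 2"]]) (auto simp: divide_inverse_commute N_def)
  also have "\<dots> \<le> exp s" 
    unfolding exp_def using s summable_exp_generic[of s]
    by (intro sum_le_suminf) auto
  finally have "s ^ n * exp (- s) \<le> N / s\<^sup>2"
    using s N by (simp add: field_simps exp_minus power_add power2_eq_square)
  then have "flat_exp n t \<le> N * t\<^sup>2"
    using assms by (simp add: flat_exp_def s_def field_simps)
  then show ?thesis by (simp only: N_def)
qed

lemma has_derivative_flat_exp:
  "(flat_exp n has_real_derivative (flat_exp (n + 2) t - real n * flat_exp (n + 1) t)) (at t)"
proof (cases t "0::real" rule: linorder_cases)
  case less
  have "(flat_exp n has_real_derivative 0) (at t)"
    by (rule has_field_derivative_transform_within_open[where S="{..<0}" and f="\<lambda>_. 0"])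
      (use less in \<open>auto simp: flat_exp_def\<close>)
  then show ?thesis using less by (simp add: flat_exp_def)
next
  case greater
  have "((\<lambda>t. inverse t ^ n * exp (- inverse t)) has_real_derivative
      (flat_exp (n + 2) t - real n * flat_exp (n + 1) t)) (at t)"
    using greater
    by (cases n; cases "n - 1")
      (auto intro!: derivative_eq_intros simp: flat_exp_def field_simps power2_eq_square,
        metis Suc_pred neq0_conv power_Suc)
  then show ?thesis
    by (rule has_field_derivative_transform_within_open[where S="{0<..}"])
      (use greater in \<open>auto simp: flat_exp_def\<close>)
next
  case equal
  have "((\<lambda>h. flat_exp n h / h) \<longlongrightarrow> 0) (at 0)"
  proof (rule Lim_null_comparison)
    show "\<forall>\<^sub>F h in at 0. norm (flat_exp n h / h) \<le> fact (n + 2) * \<bar>h\<bar>"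
    proof (rule always_eventually, rule allI)
      fix h :: real
      have "0 \<le> flat_exp n h" by (simp add: flat_exp_def)
      show "norm (flat_exp n h / h) \<le> fact (n + 2) * \<bar>h\<bar>"
      proof (cases "0 < h")
        case True
        then show ?thesis using flat_exp_le[OF True, of n] \<open>0 \<le> flat_exp n h\<close>
          by (simp add: field_simps power2_eq_square)
      next
        case False
        moreover have "0 \<le> fact (n + 2) * \<bar>h\<bar>" by (rule mult_nonneg_nonneg) auto
        ultimately show ?thesis by (simp add: flat_exp_def)
      qed
    qed
    show "((\<lambda>h::real. fact (n + 2) * \<bar>h\<bar>) \<longlongrightarrow> 0) (at 0)"
      by (auto intro!: tendsto_eq_intros)
  qed
  then show ?thesis
    using equal by (simp add: has_field_derivative_iff flat_exp_def)
qed

lemma C_diff_on_flat_exp: "C_diff_on k UNIV (flat_exp n)"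
proof (induction k arbitrary: n)
  case 0
  then show ?case
    using has_derivative_flat_exp by (auto intro!: DERIV_isCont continuous_at_imp_continuous_on)
next
  case (Suc k)
  show ?case
  proof (rule C_diff_on_SucI)
    show "(flat_exp n has_derivative (*) (flat_exp (n + 2) t - real n * flat_exp (n + 1) t)) (at t)" for t
      using has_derivative_flat_exp by (simp add: has_field_derivative_def)
    have "C_diff_on k UNIV (\<lambda>t. (flat_exp (n + 2) t + (- real n) * flat_exp (n + 1) t) * v)" for v
      by (intro C_diff_on_mult C_diff_on_add C_diff_on_const Suc open_UNIV)
    then show "C_diff_on k UNIV (\<lambda>t. (flat_exp (n + 2) t - real n * flat_exp (n + 1) t) * v)" for v
      by simp
  qed simp
qed

text \<open>The quotient \<open>a / (a + b)\<close>, where \<open>a\<close> is positive exactly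
  inside radius \<open>2 * r\<close> and \<open>b\<close> exactly outside radius \<open>r\<close>,
  so that they never vanish together. The squared distance is used since it is smooth at the
  centre.\<close>

lemma ex_cutoff:
  fixes u0 :: "'e::{real_inner,heine_borel}"
  assumes "0 < r"
  obtains cut :: "'e \<Rightarrow> real" where "smooth_on UNIV cut"
    and "\<And>u. u \<in> cball u0 r \<Longrightarrow> cut u = 1" and "\<And>u. u \<notin> ball u0 (2 * r) \<Longrightarrow> cut u = 0"
proof -
  define q where "q u = (u - u0) \<bullet> (u - u0)" for u :: 'e
  define a where "a u = flat_exp 0 (4 * r\<^sup>2 - q u)" for u
  define b where "b u = flat_exp 0 (q u - r\<^sup>2)" for u
  have q_eq: "q u = (dist u0 u)\<^sup>2" for u
    unfolding q_def dist_commute[of u0] by (simp add: dist_norm power2_norm_eq_inner)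
  have lin: "smooth_on UNIV (\<lambda>u::'e. u + (- u0))"
    by (intro smooth_on_add smooth_on_const smooth_on_bounded_linear bounded_linear_ident) simp
  have q: "smooth_on UNIV q"
    unfolding q_def using smooth_on_inner[OF _ lin lin] by simp
  have E: "smooth_on UNIV (flat_exp 0)" by (simp add: smooth_on_def C_diff_on_flat_exp)
  have "smooth_on UNIV (\<lambda>u. 4 * r\<^sup>2 + - q u)"
    by (intro smooth_on_add smooth_on_const q smooth_on_comp_bounded_linear[of uminus]
        bounded_linear_minus bounded_linear_ident open_UNIV)
  moreover have "smooth_on UNIV (\<lambda>u. q u + - r\<^sup>2)"
    by (intro smooth_on_add smooth_on_const q open_UNIV)
  ultimately have ab: "smooth_on UNIV a" "smooth_on UNIV b"
    unfolding a_def b_def using smooth_on_compose[OF _ _ _ _ E] by auto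
  have nz: "a u + b u \<noteq> 0" for u
  proof -
    have "0 < 4 * r\<^sup>2 - q u \<or> 0 < q u - r\<^sup>2" using assms by (smt (verit) zero_less_power)
    then show ?thesis
      by (auto simp: a_def b_def flat_exp_def add_pos_nonneg add_nonneg_pos add_pos_pos
          order_less_imp_not_eq2)
  qed
  have inv: "smooth_on {t::real. t \<noteq> 0} inverse" by (simp add: smooth_on_def C_diff_on_inverse)
  have "smooth_on UNIV (\<lambda>u. inverse (a u + b u))"
    by (rule smooth_on_compose[OF _ _ _ _ inv])
      (use nz in \<open>auto intro!: smooth_on_add ab open_Collect_neq\<close>)
  from smooth_on_scaleR[OF _ ab(1) this]
  have "smooth_on UNIV (\<lambda>u. a u * inverse (a u + b u))" by simp
  moreover have "a u * inverse (a u + b u) = 1" if "u \<in> cball u0 r" for u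
  proof -
    have "q u = (dist u0 u)\<^sup>2" by (simp add: q_eq)
    also have "\<dots> \<le> r\<^sup>2" using that by (intro power_mono) auto
    finally have "b u = 0" by (simp add: b_def flat_exp_def)
    then show ?thesis using nz[of u] by simp
  qed
  moreover have "a u * inverse (a u + b u) = 0" if "u \<notin> ball u0 (2 * r)" for u
  proof -
    have "(2 * r)\<^sup>2 \<le> (dist u0 u)\<^sup>2" using that assms by (intro power_mono) auto
    also have "\<dots> = q u" by (simp add: q_eq)
    finally show ?thesis by (simp add: a_def flat_exp_def power2_eq_square)
  qed
  ultimately show ?thesis by (rule that)
qed

section \<open>Smooth maps with bounded support\<close>

text \<open>In finite dimension vanishing outside a ball gives compact support, so every derivative
  is bounded and the estimates below hold with constants valid on the whole space.\<close>

definition csmooth :: "('a::real_normed_vector \<Rightarrow> 'b::real_normed_vector) \<Rightarrow> bool" where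
  "csmooth g \<longleftrightarrow> smooth_on UNIV g \<and> (\<exists>R. \<forall>u. R < norm u \<longrightarrow> g u = 0)"

lemma csmooth_imp_smooth: "csmooth g \<Longrightarrow> smooth_on UNIV g"
  by (simp add: csmooth_def)

lemma csmooth_has_derivative: "csmooth g \<Longrightarrow> (g has_derivative fd g u) (at u)"
  by (meson UNIV_I csmooth_imp_smooth smooth_on_has_derivative)

lemma csmooth_linear_fd: "csmooth g \<Longrightarrow> linear (fd g u)"
  using csmooth_has_derivative has_derivative_linear by blast

lemma csmooth_fd_eq_0:
  assumes "\<And>u. R < norm u \<Longrightarrow> g u = 0" "R < norm u"
  shows "fd g u v = 0"
proof -
  have "open {u. R < norm u}" by (intro open_Collect_less continuous_intros)
  then have "(g has_derivative (\<lambda>v. 0)) (at u)"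
    using assms has_derivative_transform_within_open[OF has_derivative_const[of 0], of "{u. R < norm u}" u g]
    by auto
  then show ?thesis by (simp add: fd_eqI)
qed

lemma csmooth_fd: "csmooth g \<Longrightarrow> csmooth (\<lambda>u. fd g u v)"
  unfolding csmooth_def using smooth_on_fd csmooth_fd_eq_0 by metis

lemma csmooth_fd_field:
  fixes V :: "'e::{real_inner,heine_borel} \<Rightarrow> 'e"
  assumes "csmooth g" "csmooth V"
  shows "csmooth (\<lambda>u. fd g u (V u))"
  using assms smooth_on_fd_field[OF open_UNIV] csmooth_fd_eq_0 unfolding csmooth_def by metis

lemma csmooth_bounded:
  fixes g :: "'e::{real_inner,heine_borel} \<Rightarrow> 'b::real_normed_vector"
  assumes "csmooth g"
  obtains L where "0 \<le> L" "\<And>u. norm (g u) \<le> L"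
proof -
  obtain R where R: "\<And>u. R < norm u \<Longrightarrow> g u = 0" using assms by (auto simp: csmooth_def)
  have "continuous_on (cball 0 R) g"
    using assms smooth_on_imp_continuous_on continuous_on_subset unfolding csmooth_def by blast
  then have "bounded (g ` cball 0 R)"
    by (intro compact_imp_bounded compact_continuous_image) auto
  then obtain L where L: "0 < L" "\<And>u. u \<in> cball 0 R \<Longrightarrow> norm (g u) \<le> L"
    by (auto simp: bounded_pos)
  have "norm (g u) \<le> L" for u
    using L R by (cases "R < norm u") auto
  with L(1) show ?thesis using that less_imp_le by blast
qed

text \<open>The mean value inequality on the unit interval; the remainder estimates that follow
  apply it to suitable curves.\<close>

lemma curve_bound:
  fixes \<psi> :: "real \<Rightarrow> 'b::real_normed_vector"
  assumes "\<And>\<tau>. \<tau> \<in> {0..1} \<Longrightarrow> (\<psi> has_vector_derivative \<psi>' \<tau>) (at \<tau>)"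
    and "\<And>\<tau>. \<tau> \<in> {0..1} \<Longrightarrow> norm (\<psi>' \<tau>) \<le> B"
  shows "norm (\<psi> 1 - \<psi> 0) \<le> B"
proof -
  have "norm (\<psi> 1 - \<psi> 0) \<le> B * norm (1 - 0 :: real)"
  proof (rule differentiable_bound[of "{0..1}" _ "\<lambda>\<tau> h. h *\<^sub>R \<psi>' \<tau>"])
    show "(\<psi> has_derivative (\<lambda>h. h *\<^sub>R \<psi>' \<tau>)) (at \<tau> within {0..1})" if "\<tau> \<in> {0..1}" for \<tau>
      using assms(1)[OF that] by (simp add: has_vector_derivative_def has_derivative_at_withinI)
    show "onorm (\<lambda>h. h *\<^sub>R \<psi>' \<tau>) \<le> B" if "\<tau> \<in> {0..1}" for \<tau>
      using assms(2)[OF that] by (intro onorm_le) (simp add: mult.commute[of B] mult_left_mono)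
  qed auto
  then show ?thesis by simp
qed

lemma csmooth_segment:
  assumes "csmooth g"
  shows "((\<lambda>\<tau>. g (u + \<tau> *\<^sub>R h)) has_vector_derivative fd g (u + \<tau> *\<^sub>R h) h) (at \<tau>)"
proof -
  have "((\<lambda>\<tau>. u + \<tau> *\<^sub>R h) has_derivative (\<lambda>s. s *\<^sub>R h)) (at \<tau>)"
    by (auto intro!: derivative_eq_intros)
  from has_derivative_compose[OF this csmooth_has_derivative[OF assms]]
  show ?thesis
    using csmooth_linear_fd[OF assms] by (simp add: has_vector_derivative_def linear_scale)
qed

lemma csmooth_fd_bound:
  fixes g :: "'e::{real_inner,heine_borel} \<Rightarrow> 'b::real_normed_vector"
  assumes "csmooth g"
  obtains L where "0 \<le> L" "\<And>u v. norm (fd g u v) \<le> L * norm v"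
proof -
  have "\<exists>L. 0 \<le> L \<and> (\<forall>u. norm (fd g u b) \<le> L)" for b
    using csmooth_bounded[OF csmooth_fd[OF assms]] by metis
  then obtain L where L: "\<And>b. 0 \<le> L b" "\<And>b u. norm (fd g u b) \<le> L b" by metis
  have "norm (fd g u v) \<le> (\<Sum>b\<in>onb. L b) * norm v" for u v
    using norm_linear_le_onb[OF csmooth_linear_fd[OF assms], of u, where L=L and N=1 and v=v] L by simp
  then show ?thesis using that[of "\<Sum>b\<in>onb. L b"] L(1) by (simp add: sum_nonneg)
qed

lemma csmooth_lipschitz:
  fixes g :: "'e::{real_inner,heine_borel} \<Rightarrow> 'b::real_normed_vector"
  assumes "csmooth g"
  obtains L where "0 \<le> L" "\<And>u v. norm (g u - g v) \<le> L * norm (u - v)"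
proof -
  obtain L where L: "0 \<le> L" "\<And>u v. norm (fd g u v) \<le> L * norm v"
    using csmooth_fd_bound[OF assms] by metis
  have "norm (g u - g v) \<le> L * norm (u - v)" for u v
    using curve_bound[OF csmooth_segment[OF assms, of v "u - v"], of "L * norm (u - v)"] L(2) by simp
  then show ?thesis using that L by blast
qed

lemma csmooth_fd_lipschitz:
  fixes g :: "'e::{real_inner,heine_borel} \<Rightarrow> 'b::real_normed_vector"
  assumes "csmooth g"
  obtains L where "0 \<le> L" "\<And>u u' v. norm (fd g u v - fd g u' v) \<le> L * norm v * norm (u - u')"
proof -
  have "\<exists>L. 0 \<le> L \<and> (\<forall>u u'. norm (fd g u b - fd g u' b) \<le> L * norm (u - u'))" for b
    using csmooth_lipschitz[OF csmooth_fd[OF assms]] by metis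
  then obtain L where L: "\<And>b. 0 \<le> L b" "\<And>b u u'. norm (fd g u b - fd g u' b) \<le> L b * norm (u - u')"
    by metis
  have "norm (fd g u v - fd g u' v) \<le> (\<Sum>b\<in>onb. L b) * norm v * norm (u - u')" for u u' v
    using norm_linear_le_onb[where f="\<lambda>v. fd g u v - fd g u' v" and L=L and N="norm (u - u')" and v=v]
      linear_compose_sub[OF csmooth_linear_fd[OF assms] csmooth_linear_fd[OF assms]] L by simp
  then show ?thesis using that[of "\<Sum>b\<in>onb. L b"] L(1) by (simp add: sum_nonneg)
qed

text \<open>Move from \<open>b\<close> to \<open>a\<close> along a segment, with the difference
  across \<open>r\<close> as the curve: its velocity is a difference of derivatives at points
  \<open>r\<close> apart, so both displacements appear as factors.\<close>

lemma csmooth_four_point: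
  fixes g :: "'e::{real_inner,heine_borel} \<Rightarrow> 'b::real_normed_vector"
  assumes "csmooth g"
  obtains L where "0 \<le> L"
    "\<And>a b r. norm (g (a + r) - g a - (g (b + r) - g b)) \<le> L * norm (a - b) * norm r"
proof -
  obtain L where L: "0 \<le> L" "\<And>u u' v. norm (fd g u v - fd g u' v) \<le> L * norm v * norm (u - u')"
    using csmooth_fd_lipschitz[OF assms] by metis
  have "norm (g (a + r) - g a - (g (b + r) - g b)) \<le> L * norm (a - b) * norm r" for a b r
  proof -
    have "((\<lambda>\<tau>. g ((b + r) + \<tau> *\<^sub>R (a - b)) - g (b + \<tau> *\<^sub>R (a - b))) has_vector_derivative
        fd g ((b + r) + \<tau> *\<^sub>R (a - b)) (a - b) - fd g (b + \<tau> *\<^sub>R (a - b)) (a - b)) (at \<tau>)" for \<tau>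
      by (intro has_vector_derivative_diff csmooth_segment assms)
    from curve_bound[OF this, of "L * norm (a - b) * norm r"]
    show ?thesis using L(2)[of "b + r + \<tau> *\<^sub>R (a - b)" "a - b" "b + \<tau> *\<^sub>R (a - b)" for \<tau>]
      by (simp add: algebra_simps)
  qed
  then show ?thesis using that L by blast
qed

lemma csmooth_fd_four_point:
  fixes g :: "'e::{real_inner,heine_borel} \<Rightarrow> 'b::real_normed_vector"
  assumes "csmooth g"
  obtains L where "0 \<le> L"
    "\<And>a b r v. norm (fd g (a + r) v - fd g a v - (fd g (b + r) v - fd g b v))
       \<le> L * norm v * (norm (a - b) * norm r)"
proof -
  have "\<exists>L. 0 \<le> L \<and> (\<forall>a b r. norm (fd g (a + r) c - fd g a c - (fd g (b + r) c - fd g b c))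
      \<le> L * norm (a - b) * norm r)" for c
    using csmooth_four_point[OF csmooth_fd[OF assms]] by metis
  then obtain L where L: "\<And>c. 0 \<le> L c"
    "\<And>c a b r. norm (fd g (a + r) c - fd g a c - (fd g (b + r) c - fd g b c))
      \<le> L c * norm (a - b) * norm r" by metis
  have "norm (fd g (a + r) v - fd g a v - (fd g (b + r) v - fd g b v))
     \<le> (\<Sum>b\<in>onb. L b) * norm v * (norm (a - b) * norm r)" for a b r v
    using L(2) by (intro norm_linear_le_onb linear_compose_sub csmooth_linear_fd[OF assms])
      (simp add: mult.assoc)
  then show ?thesis using that[of "\<Sum>b\<in>onb. L b"] L(1) by (simp add: sum_nonneg)
qed

text \<open>The remainder varies along the segment from \<open>h'\<close> to \<open>h\<close> with
  velocity \<open>fd g\<close> at the displaced point minus \<open>fd g u\<close>, and the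
  displacement stays below \<open>norm h + norm h'\<close> by convexity.\<close>

lemma csmooth_taylor1_lipschitz:
  fixes g :: "'e::{real_inner,heine_borel} \<Rightarrow> 'b::real_normed_vector"
  assumes "csmooth g"
  obtains L where "0 \<le> L"
    "\<And>u h h'. norm (g (u + h) - g u - fd g u h - (g (u + h') - g u - fd g u h'))
       \<le> L * (norm h + norm h') * norm (h - h')"
proof -
  obtain L where L: "0 \<le> L" "\<And>u u' v. norm (fd g u v - fd g u' v) \<le> L * norm v * norm (u - u')"
    using csmooth_fd_lipschitz[OF assms] by metis
  have "norm (g (u + h) - g u - fd g u h - (g (u + h') - g u - fd g u h'))
       \<le> L * (norm h + norm h') * norm (h - h')" for u h h'
  proof -
    let ?k = "h - h'"
    have der: "((\<lambda>\<tau>. g ((u + h') + \<tau> *\<^sub>R ?k) - \<tau> *\<^sub>R fd g u ?k) has_vector_derivative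
        fd g ((u + h') + \<tau> *\<^sub>R ?k) ?k - 1 *\<^sub>R fd g u ?k) (at \<tau>)" for \<tau>
      by (intro has_vector_derivative_diff csmooth_segment assms)
        (auto intro!: derivative_eq_intros simp: has_vector_derivative_def)
    have "norm (fd g ((u + h') + \<tau> *\<^sub>R ?k) ?k - 1 *\<^sub>R fd g u ?k) \<le> L * (norm h + norm h') * norm ?k"
      if "\<tau> \<in> {0..1}" for \<tau>
    proof -
      have "h' + \<tau> *\<^sub>R ?k = (1 - \<tau>) *\<^sub>R h' + \<tau> *\<^sub>R h" by (simp add: algebra_simps)
      then have "norm (h' + \<tau> *\<^sub>R ?k) \<le> (1 - \<tau>) * norm h' + \<tau> * norm h"
        using that by (metis (no_types, opaque_lifting) abs_of_nonneg atLeastAtMost_iff diff_ge_0_iff_ge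
            norm_scaleR norm_triangle_ineq)
      also have "\<dots> \<le> 1 * norm h' + 1 * norm h"
        using that by (intro add_mono mult_right_mono) auto
      finally have "L * norm ?k * norm (h' + \<tau> *\<^sub>R ?k) \<le> L * norm ?k * (norm h + norm h')"
        using L(1) by (intro mult_left_mono) auto
      then show ?thesis
        using L(2)[of "u + h' + \<tau> *\<^sub>R ?k" ?k u] by (simp add: algebra_simps)
    qed
    from curve_bound[OF der this]
    show ?thesis
      using linear_diff[OF csmooth_linear_fd[OF assms, of u], of h h'] by (simp add: algebra_simps)
  qed
  then show ?thesis using that L by blast
qed

lemma csmooth_taylor1:
  fixes g :: "'e::{real_inner,heine_borel} \<Rightarrow> 'b::real_normed_vector"
  assumes "csmooth g"
  obtains L where "0 \<le> L" "\<And>u h. norm (g (u + h) - g u - fd g u h) \<le> L * (norm h)\<^sup>2"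
proof -
  obtain L where L: "0 \<le> L"
    "\<And>u h h'. norm (g (u + h) - g u - fd g u h - (g (u + h') - g u - fd g u h'))
       \<le> L * (norm h + norm h') * norm (h - h')"
    using csmooth_taylor1_lipschitz[OF assms] by blast
  have "norm (g (u + h) - g u - fd g u h) \<le> L * (norm h)\<^sup>2" for u h
    using L(2)[of u h 0] linear_0[OF csmooth_linear_fd[OF assms]]
    by (simp add: power2_eq_square mult.assoc)
  then show ?thesis using that L by blast
qed

text \<open>Here the curve runs along \<open>h\<close> from both base points at once; its velocity
  is a mixed difference of \<open>fd g\<close>, with displacements \<open>u - u'\<close> and at most
  \<open>h\<close>.\<close>

lemma csmooth_taylor1_four_point:
  fixes g :: "'e::{real_inner,heine_borel} \<Rightarrow> 'b::real_normed_vector"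
  assumes "csmooth g"
  obtains L where "0 \<le> L"
    "\<And>u u' h. norm (g (u + h) - g u - fd g u h - (g (u' + h) - g u' - fd g u' h))
       \<le> L * (norm h)\<^sup>2 * norm (u - u')"
proof -
  obtain L where L: "0 \<le> L"
    "\<And>a b r v. norm (fd g (a + r) v - fd g a v - (fd g (b + r) v - fd g b v))
       \<le> L * norm v * (norm (a - b) * norm r)"
    using csmooth_fd_four_point[OF assms] by blast
  have "norm (g (u + h) - g u - fd g u h - (g (u' + h) - g u' - fd g u' h))
       \<le> L * (norm h)\<^sup>2 * norm (u - u')" for u u' h
  proof -
    have der: "((\<lambda>\<tau>. g (u + \<tau> *\<^sub>R h) - g (u' + \<tau> *\<^sub>R h) - \<tau> *\<^sub>R (fd g u h - fd g u' h))
        has_vector_derivative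
        fd g (u + \<tau> *\<^sub>R h) h - fd g (u' + \<tau> *\<^sub>R h) h - 1 *\<^sub>R (fd g u h - fd g u' h)) (at \<tau>)" for \<tau>
      by (intro has_vector_derivative_diff csmooth_segment assms)
        (auto intro!: derivative_eq_intros simp: has_vector_derivative_def)
    have "norm (fd g (u + \<tau> *\<^sub>R h) h - fd g (u' + \<tau> *\<^sub>R h) h - 1 *\<^sub>R (fd g u h - fd g u' h))
        \<le> L * (norm h)\<^sup>2 * norm (u - u')" if "\<tau> \<in> {0..1}" for \<tau>
    proof -
      have "norm (\<tau> *\<^sub>R h) \<le> norm h" using that by (simp add: mult_left_le_one_le)
      then have "L * norm h * (norm (u - u') * norm (\<tau> *\<^sub>R h)) \<le> L * norm h * (norm (u - u') * norm h)"
        using L(1) by (intro mult_left_mono) auto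
      then show ?thesis using L(2)[of u "\<tau> *\<^sub>R h" h u'] by (simp add: algebra_simps power2_eq_square)
    qed
    from curve_bound[OF der this] show ?thesis by (simp add: algebra_simps)
  qed
  then show ?thesis using that L by blast
qed

subsection \<open>Second derivatives\<close>

lemma csmooth_linear_fd_fd:
  assumes "csmooth g"
  shows "linear (\<lambda>v. fd (\<lambda>u. fd g u v) u h)"
proof
  note D = csmooth_has_derivative[OF csmooth_fd[OF assms]]
  fix v w and c :: real
  show "fd (\<lambda>u. fd g u (v + w)) u h = fd (\<lambda>u. fd g u v) u h + fd (\<lambda>u. fd g u w) u h"
    using fd_eqI[OF has_derivative_add[OF D D]] by (simp add: linear_add[OF csmooth_linear_fd[OF assms]])
  show "fd (\<lambda>u. fd g u (c *\<^sub>R v)) u h = c *\<^sub>R fd (\<lambda>u. fd g u v) u h"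
    using fd_eqI[OF has_derivative_scaleR_right[OF D, of c]]
    by (simp add: linear_scale[OF csmooth_linear_fd[OF assms]])
qed

lemma csmooth_fd_taylor1:
  fixes g :: "'e::{real_inner,heine_borel} \<Rightarrow> 'b::real_normed_vector"
  assumes "csmooth g"
  obtains L where "0 \<le> L"
    "\<And>u h v. norm (fd g (u + h) v - fd g u v - fd (\<lambda>u. fd g u v) u h) \<le> L * norm v * (norm h)\<^sup>2"
proof -
  have "\<exists>L. 0 \<le> L \<and> (\<forall>u h. norm (fd g (u + h) c - fd g u c - fd (\<lambda>u. fd g u c) u h) \<le> L * (norm h)\<^sup>2)"
    for c
    using csmooth_taylor1[OF csmooth_fd[OF assms]] by metis
  then obtain L where L: "\<And>c. 0 \<le> L c"
    "\<And>c u h. norm (fd g (u + h) c - fd g u c - fd (\<lambda>u. fd g u c) u h) \<le> L c * (norm h)\<^sup>2" by metis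
  have "norm (fd g (u + h) v - fd g u v - fd (\<lambda>u. fd g u v) u h) \<le> (\<Sum>b\<in>onb. L b) * norm v * (norm h)\<^sup>2"
    for u h v
    using L(2) by (intro norm_linear_le_onb linear_compose_sub csmooth_linear_fd csmooth_linear_fd_fd assms)
  then show ?thesis using that[of "\<Sum>b\<in>onb. L b"] L(1) by (simp add: sum_nonneg)
qed

lemma csmooth_fd_fd_bound:
  fixes g :: "'e::{real_inner,heine_borel} \<Rightarrow> 'b::real_normed_vector"
  assumes "csmooth g"
  obtains L where "0 \<le> L" "\<And>u v w. norm (fd (\<lambda>u. fd g u v) u w) \<le> L * norm v * norm w"
proof -
  have "\<exists>L. 0 \<le> L \<and> (\<forall>u w. norm (fd (\<lambda>u. fd g u c) u w) \<le> L * norm w)" for c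
    using csmooth_fd_bound[OF csmooth_fd[OF assms]] by metis
  then obtain L where L: "\<And>c. 0 \<le> L c" "\<And>c u w. norm (fd (\<lambda>u. fd g u c) u w) \<le> L c * norm w" by metis
  have "norm (fd (\<lambda>u. fd g u v) u w) \<le> (\<Sum>b\<in>onb. L b) * norm v * norm w" for u v w
    using L(2) by (intro norm_linear_le_onb csmooth_linear_fd_fd assms)
  then show ?thesis using that[of "\<Sum>b\<in>onb. L b"] L(1) by (simp add: sum_nonneg)
qed

text \<open>Both second derivatives agree with the second difference quotient, which is symmetric.\<close>

lemma csmooth_fd_fd_commute:
  fixes g :: "'e::{real_inner,heine_borel} \<Rightarrow> 'b::real_normed_vector"
  assumes "csmooth g"
  shows "fd (\<lambda>u. fd g u v) u w = fd (\<lambda>u. fd g u w) u v"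
proof -
  define S where "S v w = fd (\<lambda>u. fd g u v) u w" for v w
  obtain L1 where L1: "0 \<le> L1"
    "\<And>u u' h. norm (g (u + h) - g u - fd g u h - (g (u' + h) - g u' - fd g u' h))
       \<le> L1 * (norm h)\<^sup>2 * norm (u - u')"
    using csmooth_taylor1_four_point[OF assms] by blast
  obtain L2 where L2: "0 \<le> L2"
    "\<And>u h v. norm (fd g (u + h) v - fd g u v - fd (\<lambda>u. fd g u v) u h) \<le> L2 * norm v * (norm h)\<^sup>2"
    using csmooth_fd_taylor1[OF assms] by blast
  define M where "M v w = L1 * (norm v)\<^sup>2 * norm w + L2 * norm v * (norm w)\<^sup>2" for v w :: 'e
  have *: "norm (g (u + w + v) - g (u + w) - (g (u + v) - g u) - S v w) \<le> M v w" for v w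
    unfolding M_def
    using norm_triangle_le[OF add_mono[OF L1(2)[of "u + w" v u] L2(2)[of u w v]]]
    by (simp add: S_def algebra_simps)
  have bound: "norm (S v w - S w v) \<le> M v w + M w v" for v w
  proof -
    let ?Q = "g (u + w + v) - g (u + w) - (g (u + v) - g u)"
    have "norm (?Q - S v w) \<le> M v w" "norm (?Q - S w v) \<le> M w v"
      using *[of w v] *[of v w] by (simp_all add: algebra_simps)
    then show ?thesis using norm_triangle_ineq4[of "?Q - S w v" "?Q - S v w"] by simp
  qed
  \<comment> \<open>Under joint scaling of \<open>v\<close> and \<open>w\<close> by
    \<open>\<epsilon>\<close> the left side is homogeneous of degree two and \<open>M\<close> of
    degree three, so a factor \<open>\<epsilon>\<close> survives in the bound and can be sent to
    zero.\<close>
  have scale: "norm (S v w - S w v) \<le> \<epsilon> * (M v w + M w v)" if "0 < \<epsilon>" for \<epsilon>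
  proof -
    have S: "S (\<epsilon> *\<^sub>R v) (\<epsilon> *\<^sub>R w) = \<epsilon>\<^sup>2 *\<^sub>R S v w" for v w
      unfolding S_def power2_eq_square
      by (simp add: linear_scale[OF csmooth_linear_fd[OF csmooth_fd[OF assms]]]
          linear_scale[OF csmooth_linear_fd_fd[OF assms]])
    have M: "M (\<epsilon> *\<^sub>R v) (\<epsilon> *\<^sub>R w) = \<epsilon>\<^sup>2 * (\<epsilon> * M v w)" for v w
      using that by (simp add: M_def algebra_simps power2_eq_square)
    have "\<epsilon>\<^sup>2 * norm (S v w - S w v) \<le> \<epsilon>\<^sup>2 * (\<epsilon> * (M v w + M w v))"
      using bound[of "\<epsilon> *\<^sub>R v" "\<epsilon> *\<^sub>R w"]
      unfolding S M scaleR_diff_right[symmetric] norm_scaleR by (simp add: distrib_left)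
    then show ?thesis using that by simp
  qed
  have "norm (S v w - S w v) \<le> 0"
  proof (rule field_le_epsilon)
    fix e :: real assume e: "0 < e"
    have nn: "0 \<le> M v w + M w v" using L1(1) L2(1) by (simp add: M_def)
    have "e / (M v w + M w v + 1) * (M v w + M w v) \<le> e"
      using e nn by (simp add: field_simps)
    then show "norm (S v w - S w v) \<le> 0 + e"
      using scale[of "e / (M v w + M w v + 1)"] e nn by simp
  qed
  then show ?thesis by (simp add: S_def)
qed

text \<open>Subtracting the first and second order terms with weights \<open>\<tau>\<close> and
  \<open>\<tau>^2 / 2\<close> leaves a curve whose velocity is the first order remainder of
  \<open>\<lambda>u. fd g u h\<close>, which is already of third order in \<open>h\<close>.\<close>

lemma csmooth_taylor2:
  fixes g :: "'e::{real_inner,heine_borel} \<Rightarrow> 'b::real_normed_vector"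
  assumes "csmooth g"
  obtains L where "0 \<le> L"
    "\<And>u h. norm (g (u + h) - g u - fd g u h - (1/2) *\<^sub>R fd (\<lambda>u. fd g u h) u h) \<le> L * norm h ^ 3"
proof -
  obtain L where L: "0 \<le> L"
    "\<And>u h v. norm (fd g (u + h) v - fd g u v - fd (\<lambda>u. fd g u v) u h) \<le> L * norm v * (norm h)\<^sup>2"
    using csmooth_fd_taylor1[OF assms] by blast
  have "norm (g (u + h) - g u - fd g u h - (1/2) *\<^sub>R fd (\<lambda>u. fd g u h) u h) \<le> L * norm h ^ 3" for u h
  proof -
    let ?H = "fd (\<lambda>u. fd g u h) u"
    have der: "((\<lambda>\<tau>. g (u + \<tau> *\<^sub>R h) - \<tau> *\<^sub>R fd g u h - (\<tau>\<^sup>2 / 2) *\<^sub>R ?H h) has_vector_derivative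
        fd g (u + \<tau> *\<^sub>R h) h - 1 *\<^sub>R fd g u h - \<tau> *\<^sub>R ?H h) (at \<tau>)" for \<tau>
      by (intro has_vector_derivative_diff csmooth_segment assms)
        (auto intro!: derivative_eq_intros simp: has_vector_derivative_def)
    have "norm (fd g (u + \<tau> *\<^sub>R h) h - 1 *\<^sub>R fd g u h - \<tau> *\<^sub>R ?H h) \<le> L * norm h ^ 3"
      if "\<tau> \<in> {0..1}" for \<tau>
    proof -
      have "norm (\<tau> *\<^sub>R h) \<le> norm h" using that by (simp add: mult_left_le_one_le)
      then have "L * norm h * (norm (\<tau> *\<^sub>R h))\<^sup>2 \<le> L * norm h * (norm h)\<^sup>2"
        using L(1) by (intro mult_left_mono power_mono) auto
      then show ?thesis
        using L(2)[of u "\<tau> *\<^sub>R h" h] linear_scale[OF csmooth_linear_fd[OF csmooth_fd[OF assms]], of h u \<tau> h]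
        by (simp add: power3_eq_cube power2_eq_square mult.assoc)
    qed
    from curve_bound[OF der this] show ?thesis by (simp add: algebra_simps)
  qed
  then show ?thesis using that L by blast
qed

section \<open>Controls\<close>

text \<open>The iterates of \<open>K \<mapsto> \<rho> * K + c\<close> converge to the fixed point
  \<open>c / (1 - \<rho>)\<close>, whatever finite constant they start from. The a priori constant
  \<open>M\<close> is needed as a start, but leaves no trace in the result.\<close>

lemma contraction_bound:
  fixes r w :: "'i \<Rightarrow> real"
  assumes "0 \<le> \<rho>" "\<rho> < 1" "0 \<le> c" "0 \<le> M"
    and start: "\<And>i. i \<in> S \<Longrightarrow> r i \<le> M * w i"
    and step: "\<And>K i. 0 \<le> K \<Longrightarrow> (\<And>j. j \<in> S \<Longrightarrow> r j \<le> K * w j) \<Longrightarrow> i \<in> S \<Longrightarrow> r i \<le> (\<rho> * K + c) * w i"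
    and "i \<in> S"
  shows "r i \<le> c / (1 - \<rho>) * w i"
proof -
  define K where "K n = c / (1 - \<rho>) + \<rho> ^ n * (M - c / (1 - \<rho>))" for n
  have K_Suc: "K (Suc n) = \<rho> * K n + c" for n
  proof -
    have "\<rho> * (c / (1 - \<rho>)) + c = c / (1 - \<rho>)" using assms(2) by (simp add: field_simps)
    then show ?thesis by (simp add: K_def algebra_simps)
  qed
  have "0 \<le> K n \<and> (\<forall>j\<in>S. r j \<le> K n * w j)" for n
  proof (induction n)
    case 0
    then show ?case using start assms(4) by (simp add: K_def)
  next
    case (Suc n)
    then show ?case using step[of "K n"] assms(1,3) by (simp add: K_Suc)
  qed
  then have "r i \<le> K n * w i" for n using \<open>i \<in> S\<close> by blast
  moreover have "(\<lambda>n. \<rho> ^ n) \<longlonglongrightarrow> 0" by (rule LIMSEQ_realpow_zero[OF assms(1,2)])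
  then have "(\<lambda>n. K n * w i) \<longlonglongrightarrow> (c / (1 - \<rho>) + 0 * (M - c / (1 - \<rho>))) * w i"
    unfolding K_def by (intro tendsto_add tendsto_mult tendsto_const)
  ultimately show ?thesis using LIMSEQ_le_const[of "\<lambda>n. K n * w i" _ "r i"] by simp
qed

locale rough_control =
  fixes T p :: real and \<omega> :: "real \<Rightarrow> real \<Rightarrow> real"
  assumes control: "control T \<omega>" and p_ge: "1 \<le> p" and p_less: "p < 3"
begin

lemma control_nonneg: "0 \<le> s \<Longrightarrow> s \<le> t \<Longrightarrow> t \<le> T \<Longrightarrow> 0 \<le> \<omega> s t"
  using control by (auto simp: control_def simplex_interval_def)

lemma control_refl: "0 \<le> s \<Longrightarrow> s \<le> T \<Longrightarrow> \<omega> s s = 0"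
  using control by (auto simp: control_def)

lemma control_superadd:
  "0 \<le> s \<Longrightarrow> s \<le> t \<Longrightarrow> t \<le> u \<Longrightarrow> u \<le> T \<Longrightarrow> \<omega> s t + \<omega> t u \<le> \<omega> s u"
  using control by (auto simp: control_def)

lemma control_mono:
  assumes "0 \<le> s" "s \<le> s'" "s' \<le> t'" "t' \<le> t" "t \<le> T"
  shows "\<omega> s' t' \<le> \<omega> s t"
  using control_superadd[of s s' t'] control_superadd[of s t' t]
    control_nonneg[of s s'] control_nonneg[of t' t] assms by linarith

lemma control_continuous: "continuous_on (simplex_interval T) (\<lambda>(s, t). \<omega> s t)"
  using control by (simp add: control_def)

lemma compact_simplex_interval: "compact (simplex_interval T)"
proof -
  have "simplex_interval T = ({0..T} \<times> {0..T}) \<inter> {z. fst z \<le> snd z}"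
    by (auto simp: simplex_interval_def)
  moreover have "closed {z::real \<times> real. fst z \<le> snd z}"
    by (intro closed_Collect_le continuous_intros)
  ultimately show ?thesis by (simp add: compact_Int_closed compact_Times)
qed

lemma control_small:
  assumes "0 < \<epsilon>"
  obtains \<delta> where "0 < \<delta>"
    "\<And>s t. 0 \<le> s \<Longrightarrow> s \<le> t \<Longrightarrow> t \<le> T \<Longrightarrow> t - s \<le> \<delta> \<Longrightarrow> \<omega> s t \<le> \<epsilon>"
proof -
  have "uniformly_continuous_on (simplex_interval T) (\<lambda>(s, t). \<omega> s t)"
    using compact_uniformly_continuous control_continuous compact_simplex_interval by blast
  then obtain d where d: "0 < d" "\<And>z z'. z \<in> simplex_interval T \<Longrightarrow> z' \<in> simplex_interval T \<Longrightarrow>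
      dist z' z < d \<Longrightarrow> dist ((\<lambda>(s, t). \<omega> s t) z') ((\<lambda>(s, t). \<omega> s t) z) < \<epsilon>"
    using assms unfolding uniformly_continuous_on_def by metis
  have "\<omega> s t \<le> \<epsilon>" if "0 \<le> s" "s \<le> t" "t \<le> T" "t - s \<le> d / 2" for s t
  proof -
    have "dist (s, t) (s, s) < d" using that d(1) by (simp add: dist_Pair_Pair dist_real_def)
    then have "dist (\<omega> s t) (\<omega> s s) < \<epsilon>"
      using d(2)[of "(s, s)" "(s, t)"] that by (simp add: simplex_interval_def)
    then show ?thesis using control_refl[of s] that by (simp add: dist_real_def)
  qed
  then show ?thesis using that[of "d / 2"] d(1) by auto
qed

text \<open>The intermediate value theorem makes the left part exactly half; superadditivity leaves
  at most half for the right part.\<close>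

lemma control_halving:
  assumes "0 \<le> s" "s \<le> u" "u \<le> T"
  obtains t where "s \<le> t" "t \<le> u" "\<omega> s t \<le> \<omega> s u / 2" "\<omega> t u \<le> \<omega> s u / 2"
proof -
  have "continuous_on {s..u} (\<lambda>t. case (s, t) of (s, t) \<Rightarrow> \<omega> s t)"
    using assms by (intro continuous_on_compose2[OF control_continuous] continuous_intros)
      (auto simp: simplex_interval_def)
  then have "continuous_on {s..u} (\<lambda>t. \<omega> s t)" by simp
  moreover have "\<omega> s s \<le> \<omega> s u / 2" "\<omega> s u / 2 \<le> \<omega> s u"
    using control_refl[of s] control_nonneg[of s u] assms by auto
  ultimately obtain t where t: "s \<le> t" "t \<le> u" "\<omega> s t = \<omega> s u / 2"
    using IVT'[of "\<lambda>t. \<omega> s t" s "\<omega> s u / 2" u] assms by auto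
  moreover have "\<omega> t u \<le> \<omega> s u / 2" using control_superadd[of s t u] t assms by linarith
  ultimately show ?thesis using that by simp
qed

text \<open>Orders \<open>1 / p\<close>, \<open>2 / p\<close> and \<open>3 / p\<close> of the
  control become the first three powers of \<open>\<kappa>\<close>, so that estimates are handled as
  polynomials.\<close>

definition \<kappa> :: "real \<Rightarrow> real \<Rightarrow> real" where "\<kappa> s t = \<omega> s t powr (1 / p)"

lemma \<kappa>_nonneg [simp]: "0 \<le> \<kappa> s t"
  by (simp add: \<kappa>_def)

lemma \<kappa>_refl: "0 \<le> s \<Longrightarrow> s \<le> T \<Longrightarrow> \<kappa> s s = 0"
  by (simp add: \<kappa>_def control_refl)

lemma \<kappa>_power: "\<omega> s t powr (2 / p) = (\<kappa> s t)\<^sup>2" "\<omega> s t powr (3 / p) = \<kappa> s t ^ 3"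
proof -
  have "\<kappa> s t ^ n = \<omega> s t powr (n / p)" if "0 < n" for n
  proof (cases "\<omega> s t = 0")
    case True
    then show ?thesis using that by (simp add: \<kappa>_def)
  next
    case False
    then show ?thesis by (simp add: \<kappa>_def powr_power)
  qed
  from this[of 2] this[of 3]
  show "\<omega> s t powr (2 / p) = (\<kappa> s t)\<^sup>2" "\<omega> s t powr (3 / p) = \<kappa> s t ^ 3" by simp_all
qed

lemma \<kappa>_mono:
  assumes "0 \<le> s" "s \<le> s'" "s' \<le> t'" "t' \<le> t" "t \<le> T"
  shows "\<kappa> s' t' \<le> \<kappa> s t"
  unfolding \<kappa>_def using assms p_ge control_mono control_nonneg by (intro powr_mono2) auto

lemma \<kappa>_le_1: "0 \<le> s \<Longrightarrow> s \<le> t \<Longrightarrow> t \<le> T \<Longrightarrow> \<omega> s t \<le> 1 \<Longrightarrow> \<kappa> s t \<le> 1"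
  unfolding \<kappa>_def using p_ge control_nonneg powr_mono2[of "1 / p" "\<omega> s t" 1] by simp

lemma \<kappa>_small:
  assumes "0 < \<epsilon>"
  obtains \<delta> where "0 < \<delta>"
    "\<And>s t. 0 \<le> s \<Longrightarrow> s \<le> t \<Longrightarrow> t \<le> T \<Longrightarrow> t - s \<le> \<delta> \<Longrightarrow> \<omega> s t \<le> 1 \<and> \<kappa> s t \<le> \<epsilon>"
proof -
  have "0 < min 1 (\<epsilon> powr p)" using assms by simp
  from control_small[OF this] obtain \<delta> where \<delta>: "0 < \<delta>"
    "\<And>s t. 0 \<le> s \<Longrightarrow> s \<le> t \<Longrightarrow> t \<le> T \<Longrightarrow> t - s \<le> \<delta> \<Longrightarrow> \<omega> s t \<le> min 1 (\<epsilon> powr p)" by metis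
  have "\<kappa> s t \<le> \<epsilon>" if "0 \<le> s" "s \<le> t" "t \<le> T" "t - s \<le> \<delta>" for s t
  proof -
    have "\<kappa> s t \<le> (\<epsilon> powr p) powr (1 / p)"
      unfolding \<kappa>_def using \<delta>(2)[OF that] control_nonneg[OF that(1-3)] p_ge
      by (intro powr_mono2) auto
    then show ?thesis using assms p_ge by (simp add: powr_powr)
  qed
  then show ?thesis using that \<delta> by fastforce
qed

text \<open>The factor by which the sum of two error bounds of order \<open>3 / p\<close> shrinks when the control is
  halved.\<close>

definition q :: real where "q = 2 powr (1 - 3 / p)"

lemma q_pos: "0 < q" and q_less_1: "q < 1"
proof -
  have "2 powr (1 - 3 / p) < 2 powr 0" using p_ge p_less by (intro powr_less_mono) auto
  then show "q < 1" by (simp add: q_def)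
qed (simp add: q_def)

lemma \<kappa>_half:
  assumes "0 \<le> s" "s \<le> t" "t \<le> T" "\<omega> s t \<le> \<omega> s' t' / 2"
  shows "\<kappa> s t ^ 3 \<le> q / 2 * \<kappa> s' t' ^ 3"
proof -
  have "\<omega> s t powr (3 / p) \<le> (\<omega> s' t' / 2) powr (3 / p)"
    using assms control_nonneg p_ge by (intro powr_mono2) auto
  also have "\<dots> = q / 2 * \<omega> s' t' powr (3 / p)"
    using assms(4) control_nonneg[OF assms(1-3)]
    by (simp add: powr_divide q_def powr_diff)
  finally show ?thesis by (simp add: \<kappa>_power)
qed

end

section \<open>Almost flows\<close>

text \<open>What the existence and uniqueness arguments use of the Euler scheme. Lipschitz
  continuity is imposed on the displacement \<open>\<mu> s t a - a\<close>, which makes the constant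
  of \<open>\<mu> s t\<close> itself \<open>1 + C * \<kappa> s t\<close>, close to one. The mixed
  difference and the Lipschitz form of the almost flow property serve uniqueness. The restriction
  \<open>\<omega> \<le> 1\<close> gives \<open>\<kappa> \<le> 1\<close>, so that higher powers are
  dominated by lower ones.\<close>

locale almost_flow = rough_control T p \<omega> for T p :: real and \<omega> :: "real \<Rightarrow> real \<Rightarrow> real" +
  fixes \<mu> :: "real \<Rightarrow> real \<Rightarrow> 'e::{real_normed_vector,heine_borel} \<Rightarrow> 'e" and C :: real
  assumes C_nonneg: "0 \<le> C"
    and flow_near: "\<And>s t a. 0 \<le> s \<Longrightarrow> s \<le> t \<Longrightarrow> t \<le> T \<Longrightarrow> \<omega> s t \<le> 1 \<Longrightarrow>
      norm (\<mu> s t a - a) \<le> C * \<kappa> s t"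
    and flow_lipschitz: "\<And>s t a b. 0 \<le> s \<Longrightarrow> s \<le> t \<Longrightarrow> t \<le> T \<Longrightarrow> \<omega> s t \<le> 1 \<Longrightarrow>
      norm (\<mu> s t a - a - (\<mu> s t b - b)) \<le> C * \<kappa> s t * norm (a - b)"
    and flow_four_point: "\<And>s t a b r. 0 \<le> s \<Longrightarrow> s \<le> t \<Longrightarrow> t \<le> T \<Longrightarrow> \<omega> s t \<le> 1 \<Longrightarrow>
      norm (\<mu> s t (a + r) - \<mu> s t a - (\<mu> s t (b + r) - \<mu> s t b)) \<le> C * \<kappa> s t * norm (a - b) * norm r"
    and flow_almost: "\<And>s t u a. 0 \<le> s \<Longrightarrow> s \<le> t \<Longrightarrow> t \<le> u \<Longrightarrow> u \<le> T \<Longrightarrow> \<omega> s u \<le> 1 \<Longrightarrow>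
      norm (\<mu> t u (\<mu> s t a) - \<mu> s u a) \<le> C * \<kappa> s u ^ 3"
    and flow_almost_lipschitz: "\<And>s t u a b. 0 \<le> s \<Longrightarrow> s \<le> t \<Longrightarrow> t \<le> u \<Longrightarrow> u \<le> T \<Longrightarrow> \<omega> s u \<le> 1 \<Longrightarrow>
      norm (\<mu> t u (\<mu> s t a) - \<mu> s u a - (\<mu> t u (\<mu> s t b) - \<mu> s u b)) \<le> C * \<kappa> s u ^ 3 * norm (a - b)"
begin

lemma flow_refl: "0 \<le> s \<Longrightarrow> s \<le> T \<Longrightarrow> \<mu> s s a = a"
  using flow_near[of s s a] by (simp add: control_refl \<kappa>_refl)

lemma flow_lipschitz':
  assumes "0 \<le> s" "s \<le> t" "t \<le> T" "\<omega> s t \<le> 1"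
  shows "norm (\<mu> s t a - \<mu> s t b) \<le> (1 + C * \<kappa> s t) * norm (a - b)"
proof -
  have "\<mu> s t a - \<mu> s t b = (a - b) + (\<mu> s t a - a - (\<mu> s t b - b))" by simp
  also have "norm \<dots> \<le> norm (a - b) + C * \<kappa> s t * norm (a - b)"
    by (rule norm_triangle_le) (use flow_lipschitz[OF assms, of a b] in simp)
  finally show ?thesis by (simp add: algebra_simps)
qed

lemma continuous_flow:
  assumes "0 \<le> s" "s \<le> t" "t \<le> T" "\<omega> s t \<le> 1"
  shows "continuous_on UNIV (\<mu> s t)"
proof (rule lipschitz_on_continuous_on)
  show "(1 + C * \<kappa> s t)-lipschitz_on UNIV (\<mu> s t)"
    using flow_lipschitz'[OF assms] C_nonneg by (auto intro!: lipschitz_onI simp: dist_norm)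
qed

definition follows :: "(real \<Rightarrow> 'e) \<Rightarrow> real \<Rightarrow> real \<Rightarrow> real \<Rightarrow> bool" where
  "follows y a b K \<longleftrightarrow> (\<forall>s t. a \<le> s \<and> s \<le> t \<and> t \<le> b \<longrightarrow> norm (y t - \<mu> s t (y s)) \<le> K * \<kappa> s t ^ 3)"

subsection \<open>Existence\<close>

text \<open>The last condition bounds the Lipschitz constant of the scheme by \<open>2 - q\<close>.
  The two halves of an interval then contribute the factor
  \<open>q / 2 + (2 - q) * q / 2 \<le> (1 + q) / 2 < 1\<close> to the recursions.\<close>

definition small :: "real \<Rightarrow> real \<Rightarrow> bool" where
  "small a b \<longleftrightarrow> 0 \<le> a \<and> a \<le> b \<and> b \<le> T \<and> \<omega> a b \<le> 1 \<and> C * \<kappa> a b \<le> 1 - q"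

lemma smallD:
  assumes "small a b" "a \<le> s" "s \<le> t" "t \<le> b"
  shows "0 \<le> s" "t \<le> T" "\<omega> s t \<le> 1" "C * \<kappa> s t \<le> 1 - q"
proof -
  show "0 \<le> s" "t \<le> T" using assms by (auto simp: small_def)
  show "\<omega> s t \<le> 1" using assms control_mono[of a s t b] by (auto simp: small_def)
  have "C * \<kappa> s t \<le> C * \<kappa> a b"
    using assms C_nonneg \<kappa>_mono[of a s t b] by (intro mult_left_mono) (auto simp: small_def)
  then show "C * \<kappa> s t \<le> 1 - q" using assms by (auto simp: small_def)
qed

text \<open>Chosen to reproduce itself in
  \<open>K * q + (1 - q) * K * (q / 2) + 2 * C \<le> K\<close>: with
  \<open>(1 - q) * K = 4 * C\<close> this follows from \<open>q \<le> 1\<close>.\<close>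

definition K_flow :: real where "K_flow = 4 * C / (1 - q)"

lemma K_flow_nonneg: "0 \<le> K_flow"
  using C_nonneg q_less_1 by (simp add: K_flow_def)

text \<open>Davie's argument: split at the pair of consecutive points of the partition at which the control
  passes half of its value.\<close>

lemma discrete_follows:
  assumes sm: "small a b" and P: "finite P" "P \<subseteq> {a..b}"
    and f: "\<And>s t. s \<in> P \<Longrightarrow> t \<in> P \<Longrightarrow> s < t \<Longrightarrow> P \<inter> {s<..<t} = {} \<Longrightarrow> f t = \<mu> s t (f s)"
    and "s \<in> P" "t \<in> P" "s \<le> t"
  shows "norm (f t - \<mu> s t (f s)) \<le> K_flow * \<kappa> s t ^ 3"
  using assms(5-7)
\<comment> \<open>The counted set is open on the left, so that both \<open>{s<..l}\<close> and
  \<open>{m<..t}\<close> lose a point, namely \<open>t\<close> and \<open>m\<close>.\<close>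
proof (induction "card (P \<inter> {s<..t})" arbitrary: s t rule: less_induct)
  case less
  have st: "a \<le> s" "t \<le> b" using less.prems P by auto
  note sD = smallD[OF sm st(1) less.prems(3) st(2)]
  show ?case
  proof (cases "s = t")
    case True
    then show ?thesis using sD by (simp add: flow_refl \<kappa>_refl)
  next
    case False
    define l where "l = Max {r \<in> P. s \<le> r \<and> r < t \<and> \<omega> s r \<le> \<omega> s t / 2}"
    have "s \<in> {r \<in> P. s \<le> r \<and> r < t \<and> \<omega> s r \<le> \<omega> s t / 2}"
      using False less.prems control_refl[of s] control_nonneg[of s t] sD by auto
    then have "l \<in> {r \<in> P. s \<le> r \<and> r < t \<and> \<omega> s r \<le> \<omega> s t / 2}"
      unfolding l_def using P(1) by (intro Max_in) auto
    then have l: "l \<in> P" "s \<le> l" "l < t" "\<omega> s l \<le> \<omega> s t / 2" by auto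
    have l_max: "r \<le> l" if "r \<in> P" "s \<le> r" "r < t" "\<omega> s r \<le> \<omega> s t / 2" for r
      unfolding l_def using that P(1) by (intro Max_ge) auto
    define m where "m = Min {r \<in> P. l < r}"
    have "m \<in> {r \<in> P. l < r}"
      unfolding m_def using P(1) less.prems l(3) by (intro Min_in) auto
    then have m: "m \<in> P" "l < m" by auto
    have m_min: "m \<le> r" if "r \<in> P" "l < r" for r
      unfolding m_def using that P(1) by (intro Min_le) auto
    have mt: "m \<le> t" using m_min less.prems l(3) by blast
    \<comment> \<open>If \<open>m < t\<close>, maximality of \<open>l\<close> gives
      \<open>\<omega> s m\<close> more than half, and superadditivity leaves less than half for
      \<open>\<omega> m t\<close>.\<close>
    have m_half: "\<omega> m t \<le> \<omega> s t / 2"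
    proof (cases "m = t")
      case True
      then show ?thesis using control_refl[of t] control_nonneg[of s t] sD less.prems by auto
    next
      case False
      then have "\<omega> s t / 2 < \<omega> s m" using l_max[of m] m mt l by force
      then show ?thesis using control_superadd[of s m t] m mt l sD by linarith
    qed
    have "t \<in> P \<inter> {s<..t}" "t \<notin> P \<inter> {s<..l}" using less.prems l False by auto
    moreover have "P \<inter> {s<..l} \<subseteq> P \<inter> {s<..t}" using l by auto
    ultimately have "P \<inter> {s<..l} \<subset> P \<inter> {s<..t}" by blast
    then have "card (P \<inter> {s<..l}) < card (P \<inter> {s<..t})" using P(1) by (simp add: psubset_card_mono)
    from less.hyps[OF this less.prems(1) l(1,2)]
    have 1: "norm (f l - \<mu> s l (f s)) \<le> K_flow * \<kappa> s l ^ 3" .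
    have "m \<in> P \<inter> {s<..t}" "m \<notin> P \<inter> {m<..t}" using m mt l by auto
    moreover have "P \<inter> {m<..t} \<subseteq> P \<inter> {s<..t}" using m l by auto
    ultimately have "P \<inter> {m<..t} \<subset> P \<inter> {s<..t}" by blast
    then have "card (P \<inter> {m<..t}) < card (P \<inter> {s<..t})" using P(1) by (simp add: psubset_card_mono)
    from less.hyps[OF this m(1) less.prems(2) mt]
    have 2: "norm (f t - \<mu> m t (f m)) \<le> K_flow * \<kappa> m t ^ 3" .
    have "P \<inter> {l<..<m} = {}" using m_min by force
    with f l(1) m have fm: "f m = \<mu> l m (f l)" by blast
    define \<Omega> where "\<Omega> = \<kappa> s t ^ 3"
    have \<Omega>0: "0 \<le> \<Omega>" by (simp add: \<Omega>_def)
    have e1: "norm (f t - \<mu> m t (f m)) \<le> K_flow * (q / 2 * \<Omega>)"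
    proof -
      have "\<kappa> m t ^ 3 \<le> q / 2 * \<Omega>"
        unfolding \<Omega>_def using m_half sD m mt l by (intro \<kappa>_half) auto
      then show ?thesis using 2 K_flow_nonneg mult_left_mono order_trans by blast
    qed
    \<comment> \<open>From \<open>l\<close> to \<open>m\<close> the discrete path makes a single
      exact step of the scheme, which costs one almost flow error whatever share of the control lies
      between the two points.\<close>
    have e2: "norm (\<mu> m t (f m) - \<mu> l t (f l)) \<le> C * \<Omega>"
    proof -
      have "norm (\<mu> m t (f m) - \<mu> l t (f l)) \<le> C * \<kappa> l t ^ 3"
        unfolding fm using sD m mt l smallD[OF sm, of l t] st by (intro flow_almost) auto
      also have "\<dots> \<le> C * \<Omega>"
        unfolding \<Omega>_def using C_nonneg sD m mt l by (intro mult_left_mono power_mono \<kappa>_mono) auto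
      finally show ?thesis .
    qed
    have e3: "norm (\<mu> l t (f l) - \<mu> l t (\<mu> s l (f s))) \<le> (1 + (1 - q)) * (K_flow * (q / 2 * \<Omega>))"
    proof -
      have "norm (\<mu> l t (f l) - \<mu> l t (\<mu> s l (f s))) \<le> (1 + C * \<kappa> l t) * norm (f l - \<mu> s l (f s))"
        using sD m mt l smallD[OF sm, of l t] st by (intro flow_lipschitz') auto
      also have "\<dots> \<le> (1 + (1 - q)) * (K_flow * \<kappa> s l ^ 3)"
        using smallD(4)[OF sm, of l t] st l 1 q_less_1 C_nonneg by (intro mult_mono add_mono) auto
      also have "\<dots> \<le> (1 + (1 - q)) * (K_flow * (q / 2 * \<Omega>))"
        unfolding \<Omega>_def using l sD q_less_1 K_flow_nonneg by (intro mult_left_mono \<kappa>_half) auto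
      finally show ?thesis .
    qed
    have e4: "norm (\<mu> l t (\<mu> s l (f s)) - \<mu> s t (f s)) \<le> C * \<Omega>"
      unfolding \<Omega>_def using sD l by (intro flow_almost) auto
    \<comment> \<open>Telescoping through \<open>\<mu> m t (f m)\<close>,
      \<open>\<mu> l t (f l)\<close> and \<open>\<mu> l t (\<mu> s l (f s))\<close>.\<close>
    have "norm (f t - \<mu> s t (f s)) \<le> K_flow * (q / 2 * \<Omega>) + C * \<Omega>
        + (1 + (1 - q)) * (K_flow * (q / 2 * \<Omega>)) + C * \<Omega>"
      using norm_triangle_mono[OF norm_triangle_mono[OF norm_triangle_mono[OF e1 e2] e3] e4] by simp
    also have "\<dots> = (K_flow * q + (1 - q) * K_flow * (q / 2) + 2 * C) * \<Omega>"
      by (simp add: field_simps)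
    also have "\<dots> \<le> K_flow * \<Omega>"
    proof (rule mult_right_mono[OF _ \<Omega>0])
      have "(1 - q) * K_flow = 4 * C" using q_less_1 by (simp add: K_flow_def)
      moreover from this have "K_flow * q = K_flow - 4 * C" by (simp add: algebra_simps)
      moreover have "4 * C * (q / 2) \<le> 4 * C * (1 / 2)"
        using q_less_1 C_nonneg by (intro mult_left_mono) auto
      ultimately show "K_flow * q + (1 - q) * K_flow * (q / 2) + 2 * C \<le> K_flow" by simp
    qed
    finally show ?thesis by (simp add: \<Omega>_def)
  qed
qed

text \<open>The points are added in increasing order, so a new value is one step of the scheme from
  the largest earlier point and changes no earlier value.\<close>

lemma ex_discrete_flow:
  assumes "finite P" "P \<subseteq> {a..}"
  shows "\<exists>f. f a = e \<and> (\<forall>s t. s \<in> insert a P \<longrightarrow> t \<in> insert a P \<longrightarrow> s < t \<longrightarrow>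
    insert a P \<inter> {s<..<t} = {} \<longrightarrow> f t = \<mu> s t (f s))"
  using assms
proof (induction P rule: finite_linorder_max_induct)
  case empty
  then show ?case by (intro exI[of _ "\<lambda>_. e"]) auto
next
  case (insert b A)
  then have "A \<subseteq> {a..}" by blast
  from insert.IH[OF this] obtain f where f: "f a = e" "\<forall>s t. s \<in> insert a A \<longrightarrow> t \<in> insert a A \<longrightarrow>
    s < t \<longrightarrow> insert a A \<inter> {s<..<t} = {} \<longrightarrow> f t = \<mu> s t (f s)" by (elim exE conjE)
  show ?case
  proof (cases "b = a")
    case True
    have "A = {}" using insert.hyps(2) \<open>A \<subseteq> {a..}\<close> True by force
    then show ?thesis using True f by (intro exI[of _ f]) auto
  next
    case False
    then have ab: "a < b" using insert.prems by auto
    define m where "m = Max (insert a A)"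
    have m: "m \<in> insert a A" "\<And>r. r \<in> insert a A \<Longrightarrow> r \<le> m" "m < b"
      using insert.hyps ab Max_in[of "insert a A"] by (auto simp: m_def)
    define g where "g = f(b := \<mu> m b (f m))"
    have "g t = \<mu> s t (g s)"
      if st: "s \<in> insert a (insert b A)" "t \<in> insert a (insert b A)" "s < t"
        "insert a (insert b A) \<inter> {s<..<t} = {}" for s t
    proof (cases "t = b")
      case True
      then have "s \<in> insert a A" using st by auto
      moreover have "\<not> s < m" using st(4) m(1,3) True by auto
      ultimately have "s = m" using m(2) by force
      then show ?thesis using True m(3) by (simp add: g_def)
    next
      case False
      then have t: "t \<in> insert a A" using st by auto
      then have "t < b" using insert.hyps ab by auto
      then have s: "s \<in> insert a A" "s \<noteq> b" using st by auto
      have "insert a A \<inter> {s<..<t} = {}" using st(4) by auto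
      with f(2)[rule_format, OF s(1) t st(3)] show ?thesis using False s(2) by (simp add: g_def)
    qed
    moreover have "g a = e" using ab f(1) by (simp add: g_def)
    ultimately show ?thesis by blast
  qed
qed

lemma ex_follows:
  assumes sm: "small a b"
  obtains y where "y a = e" "follows y a b K_flow"
proof -
  \<comment> \<open>All iterates stay within \<open>C + K_flow\<close> of the start, since
    \<open>\<kappa> \<le> 1\<close> on a small interval; one fixed product of compact balls
    therefore contains every discrete path.\<close>
  define R where "R = C + K_flow"
  define B :: "(real \<Rightarrow> 'e) set" where "B = Pi\<^sub>E UNIV (\<lambda>_. cball e R)"
  \<comment> \<open>The initial condition is part of every nontrivial constraint, and pairs outside
    \<open>{a..b}\<close> impose nothing, so the family can be indexed by all pairs of
    reals.\<close>
  define Z where "Z = (\<lambda>(s, t). if a \<le> s \<and> s \<le> t \<and> t \<le> b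
      then {f. f a = e \<and> norm (f t - \<mu> s t (f s)) \<le> K_flow * \<kappa> s t ^ 3} else UNIV)"
  have 1: "compact B"
    unfolding B_def compactin_euclidean_iff[symmetric] euclidean_product_topology[symmetric]
      compactin_PiE by simp
  have 2: "closed (Z i)" for i
  proof -
    obtain s t where i: "i = (s, t)" by fastforce
    show ?thesis
    proof (cases "a \<le> s \<and> s \<le> t \<and> t \<le> b")
      case True
      then have "continuous_on UNIV (\<mu> s t)"
        using smallD[OF sm, of s t] by (intro continuous_flow) auto
      then have "continuous_on UNIV (\<lambda>f. \<mu> s t (f s))"
        by (rule continuous_on_compose2) auto
      then have "closed {f. f a = e \<and> norm (f t - \<mu> s t (f s)) \<le> K_flow * \<kappa> s t ^ 3}"
        by (intro closed_Collect_conj closed_Collect_le closed_Collect_eq continuous_intros) auto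
      then show ?thesis using True by (simp add: i Z_def)
    qed (auto simp: i Z_def)
  qed
  have 3: "B \<inter> (\<Inter>i\<in>I. Z i) \<noteq> {}" if "finite I" for I
  proof -
    \<comment> \<open>Finitely many constraints see only finitely many times; these serve as the
      partition, with \<open>a\<close> added as its start.\<close>
    define P where "P = (fst ` I \<union> snd ` I) \<inter> {a..b}"
    have P: "finite P" "P \<subseteq> {a..}" "insert a P \<subseteq> {a..b}"
      using that sm by (auto simp: P_def small_def)
    obtain f where f: "f a = e" "\<forall>s t. s \<in> insert a P \<longrightarrow> t \<in> insert a P \<longrightarrow> s < t \<longrightarrow>
        insert a P \<inter> {s<..<t} = {} \<longrightarrow> f t = \<mu> s t (f s)"
      using ex_discrete_flow[OF P(1,2), of e] by auto
    have fol: "norm (f t - \<mu> s t (f s)) \<le> K_flow * \<kappa> s t ^ 3"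
      if "s \<in> insert a P" "t \<in> insert a P" "s \<le> t" for s t
      using discrete_follows[OF sm _ P(3), of f s t] P(1) f(2) that by simp
    have near: "norm (f t - e) \<le> R" if "t \<in> insert a P" for t
    proof -
      have t: "a \<le> t" "t \<le> b" using that P(3) by auto
      note D = smallD[OF sm order_refl t]
      have \<kappa>1: "\<kappa> a t \<le> 1" using D t by (intro \<kappa>_le_1) auto
      have "norm (f t - \<mu> a t e) \<le> K_flow * \<kappa> a t ^ 3" using fol[of a t] that t f(1) by simp
      also have "\<dots> \<le> K_flow * 1" using K_flow_nonneg \<kappa>1 by (intro mult_left_mono power_le_one) auto
      finally have 1: "norm (f t - \<mu> a t e) \<le> K_flow" by simp
      have "norm (\<mu> a t e - e) \<le> C * \<kappa> a t" using D t by (intro flow_near) auto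
      also have "\<dots> \<le> C * 1" using C_nonneg \<kappa>1 by (intro mult_left_mono) auto
      finally show ?thesis using norm_triangle_mono[OF 1, of "\<mu> a t e - e" C] by (simp add: R_def)
    qed
    \<comment> \<open>Times off the partition enter no constraint in \<open>I\<close> and get the
      default \<open>e\<close>, the centre of the ball.\<close>
    define g where "g t = (if t \<in> insert a P then f t else e)" for t
    have "g \<in> B"
      using near C_nonneg K_flow_nonneg
      by (auto simp: B_def g_def R_def dist_norm norm_minus_commute f(1))
    moreover have "g \<in> Z i" if "i \<in> I" for i
    proof -
      obtain s t where i: "i = (s, t)" by fastforce
      have "s \<in> P" "t \<in> P" if "a \<le> s \<and> s \<le> t \<and> t \<le> b"
        using \<open>i \<in> I\<close> that by (force simp: P_def i)+
      then show ?thesis using fol[of s t] f(1) by (auto simp: i Z_def g_def)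
    qed
    ultimately show ?thesis by blast
  qed
  have "B \<inter> (\<Inter>i\<in>UNIV. Z i) \<noteq> {}"
    by (rule compact_imp_fip_image[OF 1 2 3])
  then obtain y where "y \<in> (\<Inter>i\<in>UNIV. Z i)" by blast
  then have y: "y \<in> Z (s, t)" for s t by simp
  have "y a = e" using y[of a a] sm by (simp add: Z_def small_def)
  moreover have "follows y a b K_flow"
    unfolding follows_def
  proof (intro allI impI, elim conjE)
    fix s t assume "a \<le> s" "s \<le> t" "t \<le> b"
    then show "norm (y t - \<mu> s t (y s)) \<le> K_flow * \<kappa> s t ^ 3" using y[of s t] by (simp add: Z_def)
  qed
  ultimately show ?thesis by (rule that)
qed

lemma follows_near:
  assumes "follows y a b K" "0 \<le> K" "0 \<le> a" "b \<le> T" "\<omega> a b \<le> 1" "a \<le> s" "s \<le> t" "t \<le> b"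
  shows "norm (y t - y s) \<le> (C + K) * \<kappa> s t"
proof -
  have \<omega>1: "\<omega> s t \<le> 1" using control_mono[of a s t b] assms by auto
  then have \<kappa>1: "\<kappa> s t \<le> 1" using assms by (intro \<kappa>_le_1) auto
  have "\<kappa> s t ^ 3 \<le> \<kappa> s t" using power_decreasing[of 1 3 "\<kappa> s t"] \<kappa>1 by simp
  then have "norm (y t - \<mu> s t (y s)) \<le> K * \<kappa> s t"
    using assms by (meson follows_def mult_left_mono order_trans)
  moreover have "norm (\<mu> s t (y s) - y s) \<le> C * \<kappa> s t" using assms \<omega>1 by (intro flow_near) auto
  ultimately show ?thesis
    using norm_triangle_mono[of "y t - \<mu> s t (y s)" "K * \<kappa> s t" "\<mu> s t (y s) - y s" "C * \<kappa> s t"]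
    by (simp add: algebra_simps)
qed

text \<open>The path from the compactness argument has no regularity by construction; the error
  bound and \<open>flow_near\<close> bound its increments by \<open>(C + K) * \<kappa> s t\<close>,
  and \<open>\<kappa>\<close> is uniformly small for close times.\<close>

lemma follows_continuous:
  assumes "follows y a b K" "0 \<le> K" "0 \<le> a" "b \<le> T" "\<omega> a b \<le> 1"
  shows "continuous_on {a..b} y"
  unfolding continuous_on_iff
proof (intro ballI allI impI)
  fix t \<epsilon> :: real assume t: "t \<in> {a..b}" and \<epsilon>: "0 < \<epsilon>"
  have CK: "0 \<le> C + K" using C_nonneg assms(2) by simp
  have "0 < \<epsilon> / (2 * (C + K + 1))" using CK \<epsilon> by simp
  from \<kappa>_small[OF this] obtain \<delta> where \<delta>: "0 < \<delta>"
    "\<And>s t. 0 \<le> s \<Longrightarrow> s \<le> t \<Longrightarrow> t \<le> T \<Longrightarrow> t - s \<le> \<delta> \<Longrightarrow> \<omega> s t \<le> 1 \<and> \<kappa> s t \<le> \<epsilon> / (2 * (C + K + 1))"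
    by metis
  have *: "norm (y u - y s) < \<epsilon>" if "a \<le> s" "s \<le> u" "u \<le> b" "u - s \<le> \<delta>" for s u
  proof -
    have "norm (y u - y s) \<le> (C + K) * \<kappa> s u" using follows_near[OF assms] that by blast
    also have "\<dots> \<le> (C + K) * (\<epsilon> / (2 * (C + K + 1)))"
      using \<delta>(2)[of s u] that assms CK by (intro mult_left_mono) auto
    also have "\<dots> < \<epsilon>"
    proof -
      have "c < 2 * (c + 1)" if "0 \<le> c" for c :: real using that by simp
      from this[OF CK] have "C + K < 2 * (C + K + 1)" .
      from mult_strict_right_mono[OF this \<epsilon>] show ?thesis
        using CK by (simp add: divide_less_eq mult.commute)
    qed
    finally show ?thesis .
  qed
  show "\<exists>d>0. \<forall>s\<in>{a..b}. dist s t < d \<longrightarrow> dist (y s) (y t) < \<epsilon>"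
  proof (intro exI[of _ \<delta>] conjI ballI impI \<delta>(1))
    fix s assume "s \<in> {a..b}" "dist s t < \<delta>"
    then show "dist (y s) (y t) < \<epsilon>"
      using *[of s t] *[of t s] t by (cases "s \<le> t") (auto simp: dist_norm norm_minus_commute)
  qed
qed

subsection \<open>Concatenation and uniqueness\<close>

text \<open>A pair straddling \<open>b\<close> is compared through \<open>\<mu> b t (y b)\<close>
  and \<open>\<mu> b t (\<mu> s b (y s))\<close>; the three errors have constants \<open>K\<close>,
  \<open>(1 + C) * K\<close> and \<open>C\<close>.\<close>

lemma follows_concat:
  assumes y: "follows y a b K" "follows y b c K" "0 \<le> K"
    and "0 \<le> a" "a \<le> b" "b \<le> c" "c \<le> T" "\<omega> a c \<le> 1"
  shows "follows y a c (K + (1 + C) * K + C)"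
  unfolding follows_def
proof (intro allI impI, elim conjE)
  fix s t assume st: "a \<le> s" "s \<le> t" "t \<le> c"
  let ?K = "K + (1 + C) * K + C"
  have K: "K \<le> ?K" using y(3) C_nonneg by simp
  show "norm (y t - \<mu> s t (y s)) \<le> ?K * \<kappa> s t ^ 3"
  proof (cases "t \<le> b \<or> b \<le> s")
    case True
    then have "norm (y t - \<mu> s t (y s)) \<le> K * \<kappa> s t ^ 3" using y st unfolding follows_def by blast
    also have "\<dots> \<le> ?K * \<kappa> s t ^ 3" using K by (intro mult_right_mono) auto
    finally show ?thesis .
  next
    case False
    then have b: "s \<le> b" "b \<le> t" by auto
    have *: "0 \<le> s" "t \<le> T" "\<omega> s t \<le> 1" "\<omega> b t \<le> 1" "\<omega> s b \<le> 1"
      using assms st b control_mono[of a s t c] control_mono[of a b t c] control_mono[of a s b c] by auto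
    have mono: "\<kappa> b t \<le> \<kappa> s t" "\<kappa> s b \<le> \<kappa> s t" using * b by (auto intro!: \<kappa>_mono)
    have \<kappa>1: "\<kappa> b t \<le> 1" using * b by (intro \<kappa>_le_1) auto
    have "norm (y t - \<mu> b t (y b)) \<le> K * \<kappa> b t ^ 3" using y(2) b st unfolding follows_def by blast
    also have "\<dots> \<le> K * \<kappa> s t ^ 3" using y(3) mono by (intro mult_left_mono power_mono) auto
    finally have 1: "norm (y t - \<mu> b t (y b)) \<le> K * \<kappa> s t ^ 3" .
    have "norm (\<mu> b t (y b) - \<mu> b t (\<mu> s b (y s))) \<le> (1 + C * \<kappa> b t) * norm (y b - \<mu> s b (y s))"
      using * b by (intro flow_lipschitz') auto
    also have "\<dots> \<le> (1 + C * 1) * (K * \<kappa> s b ^ 3)"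
      using y(1) b st \<kappa>1 C_nonneg unfolding follows_def by (intro mult_mono add_mono) auto
    also have "\<dots> \<le> (1 + C * 1) * (K * \<kappa> s t ^ 3)"
      using y(3) C_nonneg mono by (intro mult_left_mono power_mono) auto
    finally have 2: "norm (\<mu> b t (y b) - \<mu> b t (\<mu> s b (y s))) \<le> (1 + C * 1) * (K * \<kappa> s t ^ 3)" .
    have 3: "norm (\<mu> b t (\<mu> s b (y s)) - \<mu> s t (y s)) \<le> C * \<kappa> s t ^ 3"
      using * b by (intro flow_almost) auto
    show ?thesis
      using norm_triangle_mono[OF norm_triangle_mono[OF 1 2] 3] by (simp add: algebra_simps)
  qed
qed

text \<open>The difference of two solutions satisfies an expansion whose error is bounded by the supremum of
  the difference itself.\<close>

lemma follows_unique_small: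
  assumes sm: "small a b" and y: "follows y a b K" and z: "follows z a b K" and K: "0 \<le> K"
    and start: "y a = z a"
    and sm2: "2 * (C * (1 + C) * K + C) / (1 - q) * \<kappa> a b ^ 3 \<le> 1 / 2"
    and t: "t \<in> {a..b}"
  shows "y t = z t"
proof -
  define C2 where "C2 = C * (1 + C) * K + C"
  have C2: "0 \<le> C2" using C_nonneg K by (simp add: C2_def)
  have sm': "0 \<le> a" "a \<le> b" "b \<le> T" "\<omega> a b \<le> 1" using sm by (auto simp: small_def)
  \<comment> \<open>The error of the difference against the scheme. The triangle inequality bounds
    it with the constant \<open>2 * K\<close>; the aim is a constant proportional to the bound
    \<open>D\<close> on \<open>y - z\<close>.\<close>
  define R where "R s t = norm (y t - z t - (\<mu> s t (y s) - \<mu> s t (z s)))" for s t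
  have R_bound: "R s t \<le> (C2 * D) / (1 - (1 + q) / 2) * \<kappa> s t ^ 3"
    if D: "0 \<le> D" "\<And>t. t \<in> {a..b} \<Longrightarrow> norm (y t - z t) \<le> D" and st: "a \<le> s" "s \<le> t" "t \<le> b" for D s t
  proof -
    have "(\<lambda>(s, t). R s t) i \<le> (C2 * D) / (1 - (1 + q) / 2) * (\<lambda>(s, t). \<kappa> s t ^ 3) i"
      if i: "i \<in> {(s, t). a \<le> s \<and> s \<le> t \<and> t \<le> b}" for i
    proof (rule contraction_bound[where M = "2 * K" and S = "{(s, t). a \<le> s \<and> s \<le> t \<and> t \<le> b}"])
      fix i assume "i \<in> {(s, t). a \<le> s \<and> s \<le> t \<and> t \<le> b}"
      then obtain s t where i: "i = (s, t)" "a \<le> s" "s \<le> t" "t \<le> b" by auto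
      have 1: "norm (y t - \<mu> s t (y s)) \<le> K * \<kappa> s t ^ 3" "norm (z t - \<mu> s t (z s)) \<le> K * \<kappa> s t ^ 3"
        using y z i unfolding follows_def by blast+
      have "R s t = norm ((y t - \<mu> s t (y s)) - (z t - \<mu> s t (z s)))" by (simp add: R_def algebra_simps)
      also have "\<dots> \<le> K * \<kappa> s t ^ 3 + K * \<kappa> s t ^ 3"
        using norm_triangle_ineq4 add_mono[OF 1] by (rule order_trans)
      finally show "(\<lambda>(s, t). R s t) i \<le> 2 * K * (\<lambda>(s, t). \<kappa> s t ^ 3) i" by (simp add: i)
    next
      fix K' i assume K': "0 \<le> K'"
        "\<And>j. j \<in> {(s, t). a \<le> s \<and> s \<le> t \<and> t \<le> b} \<Longrightarrow> (\<lambda>(s, t). R s t) j \<le> K' * (\<lambda>(s, t). \<kappa> s t ^ 3) j"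
        and "i \<in> {(s, t). a \<le> s \<and> s \<le> t \<and> t \<le> b}"
      then obtain s u where i: "i = (s, u)" "a \<le> s" "s \<le> u" "u \<le> b" by auto
      have R: "R s t \<le> K' * \<kappa> s t ^ 3" if "a \<le> s" "s \<le> t" "t \<le> b" for s t
        using K'(2)[of "(s, t)"] that by simp
      have bd: "0 \<le> s" "u \<le> T" "s \<le> u" using i sm' by auto
      obtain t where t: "s \<le> t" "t \<le> u" "\<omega> s t \<le> \<omega> s u / 2" "\<omega> t u \<le> \<omega> s u / 2"
        using control_halving[OF bd(1,3,2)] by metis
      have sD: "\<omega> s u \<le> 1" "\<omega> s t \<le> 1" "\<omega> t u \<le> 1" "C * \<kappa> t u \<le> 1 - q"
        using smallD(3,4)[OF sm] i t by auto
      have \<kappa>1: "\<kappa> s u \<le> 1" "\<kappa> s t \<le> 1" using bd sD t by (auto intro!: \<kappa>_le_1)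
      define \<Omega> where "\<Omega> = \<kappa> s u ^ 3"
      have half: "\<kappa> s t ^ 3 \<le> q / 2 * \<Omega>" "\<kappa> t u ^ 3 \<le> q / 2 * \<Omega>"
        unfolding \<Omega>_def using bd t \<kappa>_half[of s t s u] \<kappa>_half[of t u s u] by auto
      \<comment> \<open>\<open>A\<close> and \<open>B\<close> are the values of the scheme at the
        intermediate time, \<open>r\<close> and \<open>r'\<close> the deviations of the two
        solutions from them; \<open>R s t\<close> is the norm of \<open>r - r'\<close>.\<close>
      define A B r r' where "A = \<mu> s t (y s)" and "B = \<mu> s t (z s)" and "r = y t - A" and "r' = z t - B"
      have rt: "R s t = norm (r - r')" by (simp add: R_def r_def r'_def A_def B_def algebra_simps)
      have rK: "norm r \<le> K * \<kappa> s t ^ 3" using y i t unfolding follows_def r_def A_def by auto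
      have D_s: "norm (y s - z s) \<le> D" using D(2) i by auto
      have AB: "norm (A - B) \<le> (1 + C) * D"
      proof -
        have "norm (A - B) \<le> (1 + C * \<kappa> s t) * norm (y s - z s)"
          unfolding A_def B_def using bd t sD by (intro flow_lipschitz') auto
        also have "\<dots> \<le> (1 + C * 1) * D"
          using C_nonneg \<kappa>1 D_s by (intro mult_mono add_mono mult_left_mono) auto
        finally show ?thesis by simp
      qed
      have e1: "norm (y u - z u - (\<mu> t u (y t) - \<mu> t u (z t))) \<le> K' * (q / 2 * \<Omega>)"
      proof -
        have "R t u \<le> K' * \<kappa> t u ^ 3" using R i t by auto
        also have "\<dots> \<le> K' * (q / 2 * \<Omega>)" using half K' by (intro mult_left_mono) auto
        finally show ?thesis by (simp add: R_def)
      qed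
      \<comment> \<open>The same deviation \<open>r\<close> is used at both base points: the mixed
        difference gains the factor \<open>norm (A - B)\<close>, which is proportional to
        \<open>D\<close>, while \<open>K\<close> enters only through \<open>norm r\<close>.\<close>
      have e2: "norm (\<mu> t u (A + r) - \<mu> t u A - (\<mu> t u (B + r) - \<mu> t u B)) \<le> C * (1 + C) * K * D * \<Omega>"
      proof -
        have "norm (\<mu> t u (A + r) - \<mu> t u A - (\<mu> t u (B + r) - \<mu> t u B)) \<le> C * \<kappa> t u * norm (A - B) * norm r"
          using bd t sD by (intro flow_four_point) auto
        also have "\<dots> \<le> C * 1 * ((1 + C) * D) * (K * \<Omega>)"
        proof -
          have "\<kappa> t u \<le> 1" using bd t sD by (intro \<kappa>_le_1) auto
          moreover have "norm r \<le> K * \<Omega>"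
          proof -
            have "\<kappa> s t ^ 3 \<le> \<Omega>" unfolding \<Omega>_def using bd t by (intro power_mono \<kappa>_mono) auto
            then show ?thesis using rK K mult_left_mono order_trans by blast
          qed
          ultimately show ?thesis using AB C_nonneg D(1) by (intro mult_mono) auto
        qed
        finally show ?thesis by (simp add: algebra_simps)
      qed
      have e3: "norm (\<mu> t u (B + r) - \<mu> t u (B + r')) \<le> (1 + (1 - q)) * (K' * (q / 2 * \<Omega>))"
      proof -
        have "norm (\<mu> t u (B + r) - \<mu> t u (B + r')) \<le> (1 + C * \<kappa> t u) * norm (B + r - (B + r'))"
          using bd t sD by (intro flow_lipschitz') auto
        also have "\<dots> \<le> (1 + (1 - q)) * (K' * \<kappa> s t ^ 3)"
          using R[of s t] i t sD q_less_1 by (intro mult_mono add_mono) (auto simp: rt)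
        also have "\<dots> \<le> (1 + (1 - q)) * (K' * (q / 2 * \<Omega>))"
          using half K' q_less_1 by (intro mult_left_mono) auto
        finally show ?thesis .
      qed
      have e4: "norm (\<mu> t u A - \<mu> s u (y s) - (\<mu> t u B - \<mu> s u (z s))) \<le> C * D * \<Omega>"
      proof -
        have "norm (\<mu> t u A - \<mu> s u (y s) - (\<mu> t u B - \<mu> s u (z s))) \<le> C * \<Omega> * norm (y s - z s)"
          unfolding A_def B_def \<Omega>_def using bd t sD by (intro flow_almost_lipschitz) auto
        also have "\<dots> \<le> C * \<Omega> * D" using D_s C_nonneg by (intro mult_left_mono) (auto simp: \<Omega>_def)
        finally show ?thesis by (simp add: algebra_simps)
      qed
      \<comment> \<open>Between \<open>y t = A + r\<close> and \<open>z t = B + r'\<close> the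
        auxiliary point \<open>B + r\<close> is inserted, so that first the base point and then the
        deviation changes.\<close>
      have "R s u = norm ((y u - z u - (\<mu> t u (y t) - \<mu> t u (z t)))
          + (\<mu> t u (A + r) - \<mu> t u A - (\<mu> t u (B + r) - \<mu> t u B))
          + (\<mu> t u (B + r) - \<mu> t u (B + r')) + (\<mu> t u A - \<mu> s u (y s) - (\<mu> t u B - \<mu> s u (z s))))"
        by (simp add: R_def r_def r'_def algebra_simps)
      also have "\<dots> \<le> K' * (q / 2 * \<Omega>) + C * (1 + C) * K * D * \<Omega>
          + (1 + (1 - q)) * (K' * (q / 2 * \<Omega>)) + C * D * \<Omega>"
        using norm_triangle_mono[OF norm_triangle_mono[OF norm_triangle_mono[OF e1 e2] e3] e4] .
      also have "\<dots> = (q * K' + (1 - q) * q / 2 * K' + C2 * D) * \<Omega>"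
        by (simp add: C2_def field_simps)
      also have "\<dots> \<le> ((1 + q) / 2 * K' + C2 * D) * \<Omega>"
      proof (rule mult_right_mono)
        have "(1 - q) * q \<le> (1 - q) * 1" using q_less_1 by (intro mult_left_mono) auto
        then have "(q + (1 - q) * q / 2) * K' \<le> (1 + q) / 2 * K'"
          using K'(1) by (intro mult_right_mono) auto
        then show "q * K' + (1 - q) * q / 2 * K' + C2 * D \<le> (1 + q) / 2 * K' + C2 * D"
          by (simp add: algebra_simps)
      qed (simp add: \<Omega>_def)
      finally show "(\<lambda>(s, t). R s t) i \<le> ((1 + q) / 2 * K' + C2 * D) * (\<lambda>(s, t). \<kappa> s t ^ 3) i"
        by (simp add: i \<Omega>_def)
    qed (use q_pos q_less_1 C2 D K i in auto)
    from this[of "(s, t)"] st show ?thesis by simp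
  qed
  \<comment> \<open>Equal initial values make \<open>R a t\<close> the norm of the difference at
    \<open>t\<close> itself, so the estimate of \<open>R\<close> improves any bound \<open>D\<close>
    by the factor \<open>1 / 2\<close> that \<open>sm2\<close> provides.\<close>
  have halve: "norm (y t - z t) \<le> (1 / 2) * D"
    if D: "0 \<le> D" "\<And>t. t \<in> {a..b} \<Longrightarrow> norm (y t - z t) \<le> D" and t: "t \<in> {a..b}" for D t
  proof -
    have "norm (y t - z t) = R a t" using start by (simp add: R_def)
    also have "\<dots> \<le> (C2 * D) / (1 - (1 + q) / 2) * \<kappa> a t ^ 3" using R_bound[OF D] t by auto
    also have "\<dots> \<le> (C2 * D) / (1 - (1 + q) / 2) * \<kappa> a b ^ 3"
      using C2 D q_less_1 t sm' by (intro mult_left_mono power_mono \<kappa>_mono) auto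
    also have "\<dots> = (2 * C2 / (1 - q) * \<kappa> a b ^ 3) * D"
      using q_less_1 by (simp add: field_simps)
    also have "\<dots> \<le> (1 / 2) * D"
      using sm2 D by (intro mult_right_mono) (auto simp: C2_def)
    finally show ?thesis .
  qed
  have \<kappa>1: "\<kappa> a t \<le> 1" if "t \<in> {a..b}" for t
    using that sm' control_mono[of a a t b] by (intro \<kappa>_le_1) auto
  have near: "norm (v t - v a) \<le> C + K" if "follows v a b K" "t \<in> {a..b}" for v t
  proof -
    have "norm (v t - v a) \<le> (C + K) * \<kappa> a t" using follows_near[OF that(1) K] sm' that by auto
    also have "\<dots> \<le> (C + K) * 1" using \<kappa>1[OF that(2)] C_nonneg K by (intro mult_left_mono) auto
    finally show ?thesis by simp
  qed
  \<comment> \<open>With improvement factor \<open>1 / 2\<close> and no additive term the bootstrap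
    ends at zero; its start \<open>2 * (C + K)\<close> holds since both paths stay near their common
    initial value.\<close>
  have "norm (y t - z t) \<le> 0 / (1 - 1 / 2) * 1"
  proof (rule contraction_bound[where S = "{a..b}" and M = "2 * (C + K)" and r = "\<lambda>t. norm (y t - z t)"
        and w = "\<lambda>_. 1"])
    fix t assume t: "t \<in> {a..b}"
    have "norm ((y t - y a) - (z t - z a)) \<le> (C + K) + (C + K)"
      using norm_triangle_ineq4 add_mono[OF near[OF y t] near[OF z t]] by (rule order_trans)
    then show "norm (y t - z t) \<le> 2 * (C + K) * 1" by (simp add: start)
  qed (use halve C_nonneg K t in auto)
  then show ?thesis by simp
qed

lemma small_right:
  assumes "0 \<le> a" "a < b" "b \<le> T" "0 < \<epsilon>"
  obtains c where "a < c" "c \<le> b" "small a c" "\<kappa> a c \<le> \<epsilon>"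
proof -
  have "0 < min \<epsilon> ((1 - q) / (C + 1))" using assms C_nonneg q_less_1 by simp
  from \<kappa>_small[OF this] obtain \<delta> where \<delta>: "0 < \<delta>" "\<And>s t. 0 \<le> s \<Longrightarrow> s \<le> t \<Longrightarrow> t \<le> T \<Longrightarrow> t - s \<le> \<delta> \<Longrightarrow>
    \<omega> s t \<le> 1 \<and> \<kappa> s t \<le> min \<epsilon> ((1 - q) / (C + 1))" by metis
  define c where "c = min b (a + \<delta>)"
  have c: "a < c" "c \<le> b" "c - a \<le> \<delta>" using \<delta> assms by (auto simp: c_def)
  then have *: "\<omega> a c \<le> 1" "\<kappa> a c \<le> \<epsilon>" "\<kappa> a c \<le> (1 - q) / (C + 1)" using \<delta>(2)[of a c] assms by auto
  have "C * \<kappa> a c \<le> (C + 1) * \<kappa> a c" by (intro mult_right_mono) auto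
  also have "\<dots> \<le> 1 - q" using *(3) C_nonneg by (simp add: field_simps)
  finally show ?thesis using that[of c] c * assms by (auto simp: small_def)
qed

lemma follows_unique_local:
  assumes "follows y a b K" "follows z a b K'" "y a = z a" "0 \<le> a" "a < b" "b \<le> T"
  obtains c where "a < c" "c \<le> b" "\<And>t. t \<in> {a..c} \<Longrightarrow> y t = z t"
proof -
  define K0 where "K0 = max 0 (max K K')"
  define M where "M = 2 * (C * (1 + C) * K0 + C) / (1 - q)"
  have K0: "0 \<le> K0" by (simp add: K0_def)
  have M: "0 \<le> M" using C_nonneg K0 q_less_1 by (simp add: M_def)
  have "0 < 1 / (2 * (M + 1))" using M by simp
  then obtain c where c: "a < c" "c \<le> b" "small a c" "\<kappa> a c \<le> 1 / (2 * (M + 1))"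
    using small_right[of a b] assms by metis
  have mono: "follows v a c K0" if "follows v a b L" "L \<le> K0" for v L
    unfolding follows_def
  proof (intro allI impI, elim conjE)
    fix s t assume "a \<le> s" "s \<le> t" "t \<le> c"
    then have "norm (v t - \<mu> s t (v s)) \<le> L * \<kappa> s t ^ 3"
      using that(1) c(2) unfolding follows_def by auto
    also have "\<dots> \<le> K0 * \<kappa> s t ^ 3" using that(2) by (intro mult_right_mono) auto
    finally show "norm (v t - \<mu> s t (v s)) \<le> K0 * \<kappa> s t ^ 3" .
  qed
  have \<kappa>1: "\<kappa> a c \<le> 1" using c(3) by (auto simp: small_def intro!: \<kappa>_le_1)
  have "M * \<kappa> a c ^ 3 \<le> M * \<kappa> a c"
    using M power_decreasing[of 1 3 "\<kappa> a c"] \<kappa>1 by (intro mult_left_mono) auto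
  also have "\<dots> \<le> M * (1 / (2 * (M + 1)))" using M c(4) by (intro mult_left_mono)
  also have "\<dots> \<le> 1 / 2" using M by (simp add: field_simps)
  finally have "y t = z t" if "t \<in> {a..c}" for t
    using follows_unique_small[OF c(3) mono[OF assms(1)] mono[OF assms(2)] K0 assms(3) _ that]
    by (simp add: M_def K0_def)
  then show ?thesis using that c by blast
qed

end

section \<open>The Euler scheme of a rough differential equation\<close>

text \<open>One constant for all estimates of a field that enter the almost flow property. The last
  two vary the first order remainder in its increment and in its base point separately, since two
  steps of the scheme from different points differ in both.\<close>

definition tame :: "real \<Rightarrow> ('e::{real_inner,heine_borel} \<Rightarrow> 'b::real_normed_vector) \<Rightarrow> bool" where
  "tame L g \<longleftrightarrow> 0 \<le> L \<and> (\<forall>u. norm (g u) \<le> L) \<and>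
     (\<forall>u v. norm (g u - g v) \<le> L * norm (u - v)) \<and>
     (\<forall>a b r. norm (g (a + r) - g a - (g (b + r) - g b)) \<le> L * norm (a - b) * norm r) \<and>
     (\<forall>u h. norm (g (u + h) - g u - fd g u h) \<le> L * (norm h)\<^sup>2) \<and>
     (\<forall>u h h'. norm (g (u + h) - g u - fd g u h - (g (u + h') - g u - fd g u h'))
       \<le> L * (norm h + norm h') * norm (h - h')) \<and>
     (\<forall>u u' h. norm (g (u + h) - g u - fd g u h - (g (u' + h) - g u' - fd g u' h))
       \<le> L * (norm h)\<^sup>2 * norm (u - u'))"

lemma tameD:
  assumes "tame L g"
  shows "0 \<le> L" "norm (g u) \<le> L" "norm (g u - g v) \<le> L * norm (u - v)"
    "norm (g (a + r) - g a - (g (b + r) - g b)) \<le> L * norm (a - b) * norm r"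
    "norm (g (u + h) - g u - fd g u h) \<le> L * (norm h)\<^sup>2"
    "norm (g (u + h) - g u - fd g u h - (g (u + h') - g u - fd g u h'))
       \<le> L * (norm h + norm h') * norm (h - h')"
    "norm (g (u + h) - g u - fd g u h - (g (u' + h) - g u' - fd g u' h))
       \<le> L * (norm h)\<^sup>2 * norm (u - u')"
  using assms unfolding tame_def by blast+

lemma tame_mono:
  assumes "tame L g" "L \<le> L'"
  shows "tame L' g"
proof -
  have *: "L * c \<le> L' * c" if "0 \<le> c" for c using assms(2) that by (rule mult_right_mono)
  show ?thesis
    unfolding tame_def mult.assoc
    using tameD[OF assms(1)] assms(2) * unfolding mult.assoc
    by (meson order_trans norm_ge_zero zero_le_power2 mult_nonneg_nonneg add_nonneg_nonneg)
qed

lemma csmooth_tame: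
  assumes "csmooth g"
  shows "\<exists>L. tame L g"
proof -
  obtain L1 where L1: "0 \<le> L1" "\<And>u. norm (g u) \<le> L1"
    using csmooth_bounded[OF assms] by blast
  obtain L2 where L2: "0 \<le> L2" "\<And>u v. norm (g u - g v) \<le> L2 * norm (u - v)"
    using csmooth_lipschitz[OF assms] by blast
  obtain L3 where L3: "0 \<le> L3"
    "\<And>a b r. norm (g (a + r) - g a - (g (b + r) - g b)) \<le> L3 * norm (a - b) * norm r"
    using csmooth_four_point[OF assms] by blast
  obtain L4 where L4: "0 \<le> L4" "\<And>u h. norm (g (u + h) - g u - fd g u h) \<le> L4 * (norm h)\<^sup>2"
    using csmooth_taylor1[OF assms] by blast
  obtain L5 where L5: "0 \<le> L5"
    "\<And>u h h'. norm (g (u + h) - g u - fd g u h - (g (u + h') - g u - fd g u h'))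
       \<le> L5 * (norm h + norm h') * norm (h - h')"
    using csmooth_taylor1_lipschitz[OF assms] by blast
  obtain L6 where L6: "0 \<le> L6"
    "\<And>u u' h. norm (g (u + h) - g u - fd g u h - (g (u' + h) - g u' - fd g u' h))
       \<le> L6 * (norm h)\<^sup>2 * norm (u - u')"
    using csmooth_taylor1_four_point[OF assms] by blast
  define L where "L = L1 + L2 + L3 + L4 + L5 + L6"
  have le: "L1 \<le> L" "L2 \<le> L" "L3 \<le> L" "L4 \<le> L" "L5 \<le> L" "L6 \<le> L" "0 \<le> L"
    using L1(1) L2(1) L3(1) L4(1) L5(1) L6(1) by (auto simp: L_def)
  have *: "l * c \<le> L * c" if "l \<le> L" "0 \<le> c" for l c using that by (rule mult_right_mono)
  have "tame L g"
    unfolding tame_def mult.assoc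
  proof (intro conjI allI)
    show "norm (g u) \<le> L" for u using L1(2) le(1) order_trans by blast
    show "norm (g u - g v) \<le> L * norm (u - v)" for u v
      using L2(2) *[OF le(2)] order_trans norm_ge_zero by blast
    show "norm (g (a + r) - g a - (g (b + r) - g b)) \<le> L * (norm (a - b) * norm r)" for a b r
      using L3(2)[of a r b] *[OF le(3), of "norm (a - b) * norm r"] by (simp add: mult.assoc)
    show "norm (g (u + h) - g u - fd g u h) \<le> L * (norm h)\<^sup>2" for u h
      using L4(2) *[OF le(4)] order_trans zero_le_power2 by blast
    show "norm (g (u + h) - g u - fd g u h - (g (u + h') - g u - fd g u h'))
       \<le> L * ((norm h + norm h') * norm (h - h'))" for u h h'
      using L5(2)[of u h h'] *[OF le(5), of "(norm h + norm h') * norm (h - h')"] by (simp add: mult.assoc)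
    show "norm (g (u + h) - g u - fd g u h - (g (u' + h) - g u' - fd g u' h))
       \<le> L * ((norm h)\<^sup>2 * norm (u - u'))" for u u' h
      using L6(2)[of u h u'] *[OF le(6), of "(norm h)\<^sup>2 * norm (u - u')"] by (simp add: mult.assoc)
  qed (rule le(7))
  then show ?thesis by blast
qed

lemma csmooth_tame_family:
  fixes G :: "'i::finite \<Rightarrow> 'e::{real_inner,heine_borel} \<Rightarrow> 'b::real_normed_vector"
  assumes "\<And>i. csmooth (G i)"
  shows "\<exists>L. \<forall>i. tame L (G i)"
proof -
  obtain l where l: "\<And>i. tame (l i) (G i)" using csmooth_tame[OF assms] by metis
  have "tame (\<Sum>i\<in>UNIV. l i) (G i)" for i
    using tame_mono[OF l[of i], of "\<Sum>i\<in>UNIV. l i"] member_le_sum[of i UNIV l] tameD(1)[OF l] by auto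
  then show ?thesis by blast
qed

text \<open>The pairing of an increment and an area with first and second order coefficients. One
  step of the scheme, its differences and the almost flow error all have this shape, and it is
  linear in the coefficients.\<close>

definition comb :: "real ^ 'k \<Rightarrow> real ^ 'k ^ 'k \<Rightarrow> ('k \<Rightarrow> 'b::real_normed_vector) \<Rightarrow> ('k \<Rightarrow> 'k \<Rightarrow> 'b) \<Rightarrow> 'b"
  where "comb \<xi> \<Xi> f g = (\<Sum>i\<in>UNIV. (\<xi> $ i) *\<^sub>R f i) + (\<Sum>i\<in>UNIV. \<Sum>j\<in>UNIV. (\<Xi> $ i $ j) *\<^sub>R g i j)"

lemma comb_diff: "comb \<xi> \<Xi> f g - comb \<xi> \<Xi> f' g' = comb \<xi> \<Xi> (\<lambda>i. f i - f' i) (\<lambda>i j. g i j - g' i j)"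
  by (simp add: comb_def scaleR_diff_right sum_subtractf)

lemma norm_sum_UNIV_le:
  fixes f :: "'k::finite \<Rightarrow> 'b::real_normed_vector" and k B :: real
  assumes "\<And>i. \<bar>c i\<bar> \<le> k" "\<And>i. norm (f i) \<le> B" "0 \<le> k"
  shows "norm (\<Sum>i\<in>UNIV. c i *\<^sub>R f i) \<le> CARD('k) * (k * B)"
proof -
  have "norm (c i *\<^sub>R f i) \<le> k * B" for i
    using assms(1)[of i] assms(2)[of i] assms(3) by (auto intro!: mult_mono)
  then show ?thesis using sum_norm_bound[of UNIV "\<lambda>i. c i *\<^sub>R f i" "k * B"] by simp
qed

lemma norm_double_sum_UNIV_le:
  fixes f :: "'k::finite \<Rightarrow> 'k \<Rightarrow> 'b::real_normed_vector" and k B :: real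
  assumes "\<And>i j. \<bar>c i j\<bar> \<le> k" "\<And>i j. norm (f i j) \<le> B" "0 \<le> k"
  shows "norm (\<Sum>i\<in>UNIV. \<Sum>j\<in>UNIV. c i j *\<^sub>R f i j) \<le> (real CARD('k))\<^sup>2 * (k * B)"
proof -
  have "norm (\<Sum>j\<in>UNIV. c i j *\<^sub>R f i j) \<le> CARD('k) * (k * B)" for i
    using assms by (intro norm_sum_UNIV_le) auto
  then have "norm (\<Sum>i\<in>UNIV. \<Sum>j\<in>UNIV. c i j *\<^sub>R f i j) \<le> real CARD('k) * (CARD('k) * (k * B))"
    using sum_norm_bound[of UNIV "\<lambda>i. \<Sum>j\<in>UNIV. c i j *\<^sub>R f i j" "CARD('k) * (k * B)"] by simp
  then show ?thesis by (simp add: power2_eq_square mult.assoc)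
qed

lemma norm_comb_le:
  fixes f :: "'k::finite \<Rightarrow> 'b::real_normed_vector" and k B B' :: real
  assumes "\<And>i. \<bar>\<xi> $ i\<bar> \<le> k" "\<And>i j. \<bar>\<Xi> $ i $ j\<bar> \<le> k\<^sup>2" "0 \<le> k"
    and "\<And>i. norm (f i) \<le> B" "\<And>i j. norm (g i j) \<le> B'"
  shows "norm (comb \<xi> \<Xi> f g) \<le> CARD('k) * (k * B) + (real CARD('k))\<^sup>2 * (k\<^sup>2 * B')"
  unfolding comb_def
  by (intro norm_triangle_le add_mono norm_sum_UNIV_le norm_double_sum_UNIV_le assms) auto

lemma linear_comb:
  assumes "linear l"
  shows "l (comb \<xi> \<Xi> f g) = comb \<xi> \<Xi> (\<lambda>i. l (f i)) (\<lambda>i j. l (g i j))"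
  by (simp add: comb_def linear_add[OF assms] linear_sum[OF assms] linear_scale[OF assms])

locale rough_path = rough_control T p \<omega> for T p :: real and \<omega> :: "real \<Rightarrow> real \<Rightarrow> real" +
  fixes x :: "real \<Rightarrow> real ^ 'k" and X :: "real \<Rightarrow> real \<Rightarrow> real ^ 'k ^ 'k"
  assumes rough_path: "weak_geometric_rough_path T p \<omega> x X"
begin

lemma chen:
  "0 \<le> s \<Longrightarrow> s \<le> t \<Longrightarrow> t \<le> u \<Longrightarrow> u \<le> T \<Longrightarrow>
    X s u $ i $ j = X s t $ i $ j + X t u $ i $ j + (x t - x s) $ i * (x u - x t) $ j"
  using rough_path by (simp add: weak_geometric_rough_path_def tensor_def)

lemma path_bound:
  assumes "0 \<le> s" "s \<le> t" "t \<le> T"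
  shows "\<bar>(x t - x s) $ i\<bar> \<le> \<kappa> s t"
proof -
  have "\<bar>(x t - x s) $ i\<bar> \<le> norm (x t - x s)" by (rule component_le_norm_cart)
  also have "\<dots> \<le> \<kappa> s t"
    using rough_path assms by (auto simp: weak_geometric_rough_path_def simplex_interval_def \<kappa>_def)
  finally show ?thesis .
qed

lemma area_bound:
  assumes "0 \<le> s" "s \<le> t" "t \<le> T"
  shows "\<bar>X s t $ i $ j\<bar> \<le> (\<kappa> s t)\<^sup>2"
proof -
  have "\<bar>X s t $ i $ j\<bar> \<le> norm (X s t $ i)" by (rule component_le_norm_cart)
  also have "\<dots> \<le> norm (X s t)" by (rule Finite_Cartesian_Product.norm_nth_le)
  also have "\<dots> \<le> (\<kappa> s t)\<^sup>2"
    using rough_path assms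
    by (auto simp: weak_geometric_rough_path_def simplex_interval_def \<kappa>_power[symmetric])
  finally show ?thesis .
qed

lemma area_symmetric_part:
  assumes "0 \<le> s" "s \<le> t" "t \<le> T"
  shows "X s t $ i $ j + X s t $ j $ i = (x t - x s) $ i * (x t - x s) $ j"
proof -
  have "(1 / 2) *\<^sub>R (X s t + transpose (X s t)) = (1 / 2) *\<^sub>R tensor (x t - x s) (x t - x s)"
    using rough_path assms by (auto simp: weak_geometric_rough_path_def simplex_interval_def)
  then have "(X s t + transpose (X s t)) $ i $ j = tensor (x t - x s) (x t - x s) $ i $ j" by simp
  then show ?thesis by (simp add: tensor_def transpose_def)
qed

text \<open>The second order coefficient differentiates \<open>V j\<close> along \<open>V i\<close>:
  this is the operator \<open>V i\<close> applied after \<open>V j\<close> to the coordinates, in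
  the order in which \<open>X s t $ i $ j\<close> pairs the indices.\<close>

definition increment :: "('k \<Rightarrow> 'e::{real_inner,heine_borel} \<Rightarrow> 'e) \<Rightarrow> real \<Rightarrow> real \<Rightarrow> 'e \<Rightarrow> 'e" where
  "increment V s t u = comb (x t - x s) (X s t) (\<lambda>i. V i u) (\<lambda>i j. fd (V j) u (V i u))"

definition euler :: "('k \<Rightarrow> 'e::{real_inner,heine_borel} \<Rightarrow> 'e) \<Rightarrow> real \<Rightarrow> real \<Rightarrow> 'e \<Rightarrow> 'e" where
  "euler V s t u = u + increment V s t u"

text \<open>Chen's relation produces the cross term \<open>S\<close> in the step from
  \<open>s\<close> to \<open>u\<close>, and the first order change of the fields along the first
  step produces the same term, so it cancels. What is left pairs the path increment from
  \<open>t\<close> to \<open>u\<close> with coefficients of order \<open>\<kappa>^2\<close> and the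
  area with coefficients of order \<open>\<kappa>\<close>, hence the third order.\<close>

lemma almost_flow_euler:
  fixes V :: "'k \<Rightarrow> 'e::{real_inner,heine_borel} \<Rightarrow> 'e"
  assumes V: "\<And>i. csmooth (V i)"
  obtains C where "almost_flow T p \<omega> (euler V) C"
proof -
  define W where "W i j u = fd (V j) u (V i u)" for i j u
  \<comment> \<open>\<open>Z\<close> arises when the derivative of \<open>V l\<close> meets the area
    part of the first step; it has no counterpart to cancel and stays in the error.\<close>
  define Z where "Z i j l u = fd (V l) u (W i j u)" for i j l u
  have W: "csmooth (W i j)" for i j unfolding W_def by (intro csmooth_fd_field V)
  have Z: "csmooth (Z i j l)" for i j l unfolding Z_def by (intro csmooth_fd_field V W)
  obtain L1 where L1: "\<And>i. tame L1 (V i)" using csmooth_tame_family[of V] V by blast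
  obtain L2 where L2: "\<And>z. tame L2 ((\<lambda>(i, j). W i j) z)"
    using csmooth_tame_family[of "\<lambda>(i, j). W i j"] W by (metis (no_types, lifting) case_prod_beta)
  obtain L3 where L3: "\<And>z. tame L3 ((\<lambda>(i, j, l). Z i j l) z)"
    using csmooth_tame_family[of "\<lambda>(i, j, l). Z i j l"] Z by (metis (no_types, lifting) case_prod_beta)
  define L where "L = L1 + L2 + L3"
  have L0: "0 \<le> L1" "0 \<le> L2" "0 \<le> L3" using tameD(1) L1 L2 L3 by blast+
  have tV: "tame L (V i)" and tW: "tame L (W i j)" and tZ: "tame L (Z i j l)" for i j l
    using tame_mono[OF L1[of i]] tame_mono[OF L2[of "(i, j)", simplified]]
      tame_mono[OF L3[of "(i, j, l)", simplified]] L0 by (auto simp: L_def)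
  have L: "0 \<le> L" using L0 by (simp add: L_def)
  define n where "n = real CARD('k)"
  \<comment> \<open>\<open>N\<close> bounds a step of the scheme relative to
    \<open>\<kappa>\<close>. In \<open>M1\<close>, the change of the Taylor remainder with the base
    point costs one \<open>L * N^2\<close>, that with the increment two, and the area term costs
    \<open>n^2 * L\<close>. In \<open>M2\<close>, the mixed difference and the Lipschitz bound of
    \<open>W\<close> cost \<open>L * N\<close> each.\<close>
  define N where "N = (n + n\<^sup>2) * L"
  define M1 where "M1 = 3 * L * N\<^sup>2 + n\<^sup>2 * L"
  define M2 where "M2 = 2 * L * N"
  define C where "C = N + n * M1 + n\<^sup>2 * M2"
  have n: "0 \<le> n" by (simp add: n_def)
  have N: "0 \<le> N" using n L by (simp add: N_def)
  have M: "0 \<le> M1" "0 \<le> M2" using n N L by (auto simp: M1_def M2_def)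
  have C: "N \<le> C" "n * M1 + n\<^sup>2 * M2 \<le> C" "0 \<le> C" using n N M by (auto simp: C_def)
  have inc: "increment V s t u = comb (x t - x s) (X s t) (\<lambda>i. V i u) (\<lambda>i j. W i j u)" for s t u
    by (simp add: increment_def W_def)
  have comb1: "norm (comb (x t - x s) (X s t) f g) \<le> N * \<kappa> s t * B"
    if st: "0 \<le> s" "s \<le> t" "t \<le> T" "\<omega> s t \<le> 1"
      and fg: "\<And>i. norm (f i) \<le> L * B" "\<And>i j. norm (g i j) \<le> L * B" and B: "0 \<le> B"
    for s t B and f :: "'k \<Rightarrow> 'e" and g
  proof -
    have "norm (comb (x t - x s) (X s t) f g) \<le> n * (\<kappa> s t * (L * B)) + n\<^sup>2 * ((\<kappa> s t)\<^sup>2 * (L * B))"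
      unfolding n_def using st fg by (intro norm_comb_le path_bound area_bound) auto
    also have "\<dots> \<le> n * (\<kappa> s t * (L * B)) + n\<^sup>2 * (\<kappa> s t * (L * B))"
      using n L B \<kappa>_le_1[OF st] power_decreasing[of 1 2 "\<kappa> s t"]
      by (intro add_left_mono mult_left_mono mult_right_mono) auto
    also have "\<dots> = N * \<kappa> s t * B" by (simp add: N_def algebra_simps)
    finally show ?thesis .
  qed
  have inc_bound: "norm (increment V s t a) \<le> N * \<kappa> s t"
    if "0 \<le> s" "s \<le> t" "t \<le> T" "\<omega> s t \<le> 1" for s t a
    unfolding inc using comb1[OF that, of "\<lambda>i. V i a" 1] tameD(2)[OF tV] tameD(2)[OF tW] by simp
  have inc_lip: "norm (increment V s t a - increment V s t b) \<le> N * \<kappa> s t * norm (a - b)"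
    if "0 \<le> s" "s \<le> t" "t \<le> T" "\<omega> s t \<le> 1" for s t a b
    unfolding inc comb_diff using that by (intro comb1 tameD(3)[OF tV] tameD(3)[OF tW]) auto
  \<comment> \<open>\<open>f\<close> is the change of \<open>V j\<close> over the first step minus
    the part that cancels against \<open>S\<close>: its Taylor remainder plus the derivative in the
    direction of the area term.\<close>
  define f where "f s t u a j = V j (a + increment V s t a) - V j a - fd (V j) a (increment V s t a)
    + (\<Sum>i\<in>UNIV. \<Sum>l\<in>UNIV. (X s t $ i $ l) *\<^sub>R Z i l j a)" for s t u :: real and a j
  define g where "g s t a i j = W i j (a + increment V s t a) - W i j a" for s t a i j
  have defect: "euler V t u (euler V s t a) - euler V s u a = comb (x u - x t) (X t u) (f s t u a) (g s t a)"
    if st: "0 \<le> s" "s \<le> t" "t \<le> u" "u \<le> T" for s t u a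
  proof -
    let ?h = "increment V s t a"
    define S where "S = (\<Sum>i\<in>UNIV. \<Sum>j\<in>UNIV. ((x t - x s) $ i * (x u - x t) $ j) *\<^sub>R W i j a)"
    have 1: "increment V s u a = increment V s t a + increment V t u a + S"
      unfolding inc comb_def S_def
      by (simp add: chen[OF st] scaleR_add_left sum.distrib scaleR_diff_left sum_subtractf)
    have 2: "fd (V j) a ?h = (\<Sum>i\<in>UNIV. ((x t - x s) $ i) *\<^sub>R W i j a)
        + (\<Sum>i\<in>UNIV. \<Sum>l\<in>UNIV. (X s t $ i $ l) *\<^sub>R Z i l j a)" for j
      unfolding inc linear_comb[OF csmooth_linear_fd[OF V]] by (simp add: comb_def W_def Z_def)
    have 3: "f s t u a j = (V j (a + ?h) - V j a) - (\<Sum>i\<in>UNIV. ((x t - x s) $ i) *\<^sub>R W i j a)" for j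
      unfolding f_def 2 by simp
    have "(\<Sum>j\<in>UNIV. (x u - x t) $ j *\<^sub>R (\<Sum>i\<in>UNIV. ((x t - x s) $ i) *\<^sub>R W i j a)) = S"
      unfolding S_def scaleR_sum_right
      by (subst sum.swap) (simp add: mult.commute)
    then have "comb (x u - x t) (X t u) (f s t u a) (g s t a)
        = (increment V t u (a + ?h) - increment V t u a) - S"
      unfolding inc comb_diff 3 g_def
      by (simp add: comb_def scaleR_diff_right sum_subtractf inc[symmetric])
    then show ?thesis by (simp add: euler_def 1)
  qed
  have "almost_flow T p \<omega> (euler V) C"
  proof
    fix s t a assume st: "0 \<le> s" "s \<le> t" "t \<le> T" "\<omega> s t \<le> 1"
    have "norm (euler V s t a - a) \<le> N * \<kappa> s t" using inc_bound[OF st] by (simp add: euler_def)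
    also have "\<dots> \<le> C * \<kappa> s t" using C by (intro mult_right_mono) auto
    finally show "norm (euler V s t a - a) \<le> C * \<kappa> s t" .
  next
    fix s t a b assume st: "0 \<le> s" "s \<le> t" "t \<le> T" "\<omega> s t \<le> 1"
    have "norm (euler V s t a - a - (euler V s t b - b)) \<le> N * \<kappa> s t * norm (a - b)"
      using inc_lip[OF st] by (simp add: euler_def)
    also have "\<dots> \<le> C * \<kappa> s t * norm (a - b)" using C by (intro mult_right_mono) auto
    finally show "norm (euler V s t a - a - (euler V s t b - b)) \<le> C * \<kappa> s t * norm (a - b)" .
  next
    fix s t a b r assume st: "0 \<le> s" "s \<le> t" "t \<le> T" "\<omega> s t \<le> 1"
    have "norm ((increment V s t (a + r) - increment V s t a) - (increment V s t (b + r) - increment V s t b))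
        \<le> N * \<kappa> s t * (norm (a - b) * norm r)"
      unfolding inc comb_diff
      using tameD(4)[OF tV] tameD(4)[OF tW] by (intro comb1 st) (simp_all add: mult.assoc)
    also have "\<dots> \<le> C * \<kappa> s t * (norm (a - b) * norm r)" using C by (intro mult_right_mono) auto
    finally show "norm (euler V s t (a + r) - euler V s t a - (euler V s t (b + r) - euler V s t b))
        \<le> C * \<kappa> s t * norm (a - b) * norm r"
      by (simp add: euler_def algebra_simps)
  next
    fix s t u and a b :: 'e assume st: "0 \<le> s" "s \<le> t" "t \<le> u" "u \<le> T" "\<omega> s u \<le> 1"
    let ?k = "\<kappa> s u"
    have st': "\<omega> s t \<le> 1" "s \<le> u" "t \<le> T" "0 \<le> t"
      using control_mono[of s s t u] st by auto
    have k: "\<kappa> s t \<le> ?k" "\<kappa> t u \<le> ?k" "?k \<le> 1" using st by (auto intro!: \<kappa>_mono \<kappa>_le_1)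
    have k2: "(\<kappa> s t)\<^sup>2 \<le> ?k\<^sup>2" "(\<kappa> t u)\<^sup>2 \<le> ?k\<^sup>2" using k by (auto intro!: power_mono)
    have Xb: "\<bar>X s t $ i $ l\<bar> \<le> ?k\<^sup>2" "\<bar>X t u $ i $ l\<bar> \<le> ?k\<^sup>2" "\<bar>(x u - x t) $ i\<bar> \<le> ?k" for i l
      using order_trans[OF area_bound k2(1)] order_trans[OF area_bound k2(2)]
        order_trans[OF path_bound k(2)] st st' by auto
    have h: "norm (increment V s t a) \<le> N * ?k" for a
    proof -
      have "norm (increment V s t a) \<le> N * \<kappa> s t" using inc_bound st st' by blast
      also have "\<dots> \<le> N * ?k" using N k by (intro mult_left_mono)
      finally show ?thesis .
    qed
    have h_lip: "norm (increment V s t a - increment V s t b) \<le> N * ?k * norm (a - b)"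
    proof -
      have "norm (increment V s t a - increment V s t b) \<le> N * \<kappa> s t * norm (a - b)"
        using inc_lip st st' by blast
      also have "\<dots> \<le> N * ?k * norm (a - b)" using N k by (intro mult_right_mono mult_left_mono) auto
      finally show ?thesis .
    qed
    have combine: "norm (comb (x u - x t) (X t u) f' g') \<le> C * ?k ^ 3 * B"
      if "\<And>j. norm (f' j) \<le> M1 * ?k\<^sup>2 * B" "\<And>i j. norm (g' i j) \<le> M2 * ?k * B" "0 \<le> B"
      for f' :: "'k \<Rightarrow> 'e" and g' B
    proof -
      have "norm (comb (x u - x t) (X t u) f' g')
          \<le> n * (?k * (M1 * ?k\<^sup>2 * B)) + n\<^sup>2 * (?k\<^sup>2 * (M2 * ?k * B))"
        unfolding n_def using that Xb by (intro norm_comb_le) auto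
      also have "\<dots> = (n * M1 + n\<^sup>2 * M2) * (?k ^ 3 * B)"
        by (simp add: algebra_simps power2_eq_square power3_eq_cube)
      also have "\<dots> \<le> C * (?k ^ 3 * B)" using C that by (intro mult_right_mono) auto
      finally show ?thesis by (simp add: mult.assoc)
    qed
    let ?h = "increment V s t"
    have hsq: "L * (norm (?h a))\<^sup>2 \<le> L * N\<^sup>2 * ?k\<^sup>2" for a
      using power_mono[OF h[of a], of 2] mult_left_mono[OF _ L] by (simp add: power_mult_distrib mult.assoc)
    have f_bound: "norm (f s t u a j) \<le> M1 * ?k\<^sup>2 * 1" for j
    proof -
      have "norm (f s t u a j) \<le> L * N\<^sup>2 * ?k\<^sup>2 + n\<^sup>2 * (?k\<^sup>2 * L)"
        unfolding f_def n_def
        using order_trans[OF tameD(5)[OF tV] hsq] Xb tameD(2)[OF tZ]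
        by (intro norm_triangle_le add_mono norm_double_sum_UNIV_le) auto
      also have "\<dots> \<le> M1 * ?k\<^sup>2 * 1"
        using L N n by (simp add: M1_def algebra_simps)
      finally show ?thesis .
    qed
    have g_bound: "norm (g s t a i j) \<le> M2 * ?k * 1" for i j
    proof -
      have "norm (g s t a i j) \<le> L * norm (?h a)"
        unfolding g_def using tameD(3)[OF tW, of i j "a + ?h a" a] by simp
      also have "\<dots> \<le> L * (N * ?k)" using h L by (intro mult_left_mono)
      also have "\<dots> \<le> M2 * ?k * 1" using L N by (simp add: M2_def)
      finally show ?thesis .
    qed
    show "norm (euler V t u (euler V s t a) - euler V s u a) \<le> C * ?k ^ 3"
      unfolding defect[OF st(1-4)] using combine[OF f_bound g_bound] by simp
    have f_lip: "norm (f s t u a j - f s t u b j) \<le> M1 * ?k\<^sup>2 * norm (a - b)" for j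
    proof -
      define G where "G a h = V j (a + h) - V j a - fd (V j) a h" for a h
      define S where "S a = (\<Sum>i\<in>UNIV. \<Sum>l\<in>UNIV. (X s t $ i $ l) *\<^sub>R Z i l j a)" for a
      have 1: "norm (G a (?h a) - G b (?h a)) \<le> L * N\<^sup>2 * ?k\<^sup>2 * norm (a - b)"
        using tameD(7)[OF tV, of j a "?h a" b] mult_right_mono[OF hsq[of a], of "norm (a - b)"]
        by (simp add: G_def)
      have 2: "norm (G b (?h a) - G b (?h b)) \<le> L * (2 * N * ?k) * (N * ?k * norm (a - b))"
      proof -
        have "norm (G b (?h a) - G b (?h b)) \<le> L * (norm (?h a) + norm (?h b)) * norm (?h a - ?h b)"
          unfolding G_def by (rule tameD(6)[OF tV])
        also have "\<dots> \<le> L * (2 * N * ?k) * (N * ?k * norm (a - b))"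
          using h[of a] h[of b] h_lip L N by (intro mult_mono mult_left_mono) auto
        finally show ?thesis .
      qed
      have 3: "norm (S a - S b) \<le> n\<^sup>2 * (?k\<^sup>2 * (L * norm (a - b)))"
        unfolding S_def sum_subtractf[symmetric] scaleR_diff_right[symmetric] n_def
        using Xb tameD(3)[OF tZ] by (intro norm_double_sum_UNIV_le) auto
      \<comment> \<open>First the base point changes at fixed increment, then the increment at fixed
        base point.\<close>
      have eq: "f s t u a j - f s t u b j
          = (G a (?h a) - G b (?h a)) + (G b (?h a) - G b (?h b)) + (S a - S b)"
        by (simp add: f_def G_def S_def)
      have "norm (f s t u a j - f s t u b j) \<le> L * N\<^sup>2 * ?k\<^sup>2 * norm (a - b) + L * (2 * N * ?k) * (N * ?k * norm (a - b))
          + n\<^sup>2 * (?k\<^sup>2 * (L * norm (a - b)))"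
        unfolding eq by (rule norm_triangle_mono[OF norm_triangle_mono[OF 1 2] 3])
      also have "\<dots> = M1 * ?k\<^sup>2 * norm (a - b)"
        by (simp add: M1_def algebra_simps power2_eq_square)
      finally show ?thesis .
    qed
    have g_lip: "norm (g s t a i j - g s t b i j) \<le> M2 * ?k * norm (a - b)" for i j
    proof -
      have 1: "norm (W i j (a + ?h a) - W i j a - (W i j (b + ?h a) - W i j b)) \<le> L * norm (a - b) * (N * ?k)"
        using tameD(4)[OF tW, of i j a "?h a" b] mult_left_mono[OF h[of a], of "L * norm (a - b)"] L by auto
      have 2: "norm (W i j (b + ?h a) - W i j (b + ?h b)) \<le> L * (N * ?k * norm (a - b))"
        using tameD(3)[OF tW, of i j "b + ?h a" "b + ?h b"] mult_left_mono[OF h_lip L] by simp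
      show ?thesis
        using norm_triangle_mono[OF 1 2] by (simp add: g_def M2_def algebra_simps)
    qed
    show "norm (euler V t u (euler V s t a) - euler V s u a - (euler V t u (euler V s t b) - euler V s u b))
        \<le> C * ?k ^ 3 * norm (a - b)"
      unfolding defect[OF st(1-4)] comb_diff using combine[OF f_lip g_lip] by simp
  qed (rule C(3))
  then show ?thesis by (rule that)
qed

text \<open>Dropping the area term costs order \<open>\<kappa>^2\<close>, which absorbs the given
  error of order \<open>\<kappa>^3\<close>. Arbitrary points \<open>u\<close> and \<open>v\<close>
  are allowed, so that it feeds both the Taylor expansion of functions and the bounds of a
  controlled path.\<close>

lemma euler_first_order:
  fixes V :: "'k \<Rightarrow> 'e::{real_inner,heine_borel} \<Rightarrow> 'e"
  assumes V: "\<And>i. csmooth (V i)" and K: "0 \<le> K"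
  shows "\<exists>L\<ge>0. \<forall>s t u v. 0 \<le> s \<and> s \<le> t \<and> t \<le> T \<and> \<omega> s t \<le> 1 \<and>
    norm (v - euler V s t u) \<le> K * \<kappa> s t ^ 3 \<longrightarrow>
    norm (v - u - (\<Sum>i\<in>UNIV. (x t - x s) $ i *\<^sub>R V i u)) \<le> L * (\<kappa> s t)\<^sup>2"
proof -
  have "csmooth ((\<lambda>(i, j) u. fd (V j) u (V i u)) z)" for z
    by (auto intro!: csmooth_fd_field V split: prod.split)
  then obtain L where t: "\<And>z. tame L ((\<lambda>(i, j) u. fd (V j) u (V i u)) z)"
    using csmooth_tame_family by blast
  have L: "0 \<le> L" "\<And>i j u. norm (fd (V j) u (V i u)) \<le> L"
    using tameD(1)[OF t] tameD(2)[OF t[of "(i, j)" for i j]] by auto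
  show ?thesis
  proof (intro exI[of _ "(real CARD('k))\<^sup>2 * L + K"] conjI allI impI, goal_cases)
    case 1
    show ?case using L(1) K by simp
  next
    case (2 s t u v)
    then have st: "0 \<le> s" "s \<le> t" "t \<le> T" "\<omega> s t \<le> 1"
      and v: "norm (v - euler V s t u) \<le> K * \<kappa> s t ^ 3"
      by auto
    let ?S = "\<Sum>i\<in>UNIV. \<Sum>j\<in>UNIV. (X s t $ i $ j) *\<^sub>R fd (V j) u (V i u)"
    have "\<kappa> s t ^ 3 \<le> (\<kappa> s t)\<^sup>2" using power_decreasing[of 2 3 "\<kappa> s t"] \<kappa>_le_1[OF st] by simp
    from mult_left_mono[OF this K] v have 1: "norm (v - euler V s t u) \<le> K * (\<kappa> s t)\<^sup>2" by linarith
    have 2: "norm ?S \<le> (real CARD('k))\<^sup>2 * ((\<kappa> s t)\<^sup>2 * L)"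
      using area_bound[OF st(1-3)] L by (intro norm_double_sum_UNIV_le) auto
    show ?case
      using norm_triangle_mono[OF 1 2] by (simp add: euler_def increment_def comb_def algebra_simps)
  qed
qed

end

text \<open>The product rule, with the varying direction \<open>V u\<close> expanded in
  \<open>onb\<close>. The first summand is the symmetric second derivative of \<open>g\<close>, the
  second the derivative of \<open>g\<close> along the second order term of the scheme.\<close>

lemma fd_fd_field:
  fixes V :: "'e::{real_inner,heine_borel} \<Rightarrow> 'e"
  assumes g: "csmooth g" and V: "csmooth V"
  shows "fd (\<lambda>u. fd g u (V u)) u w = fd (\<lambda>u'. fd g u' (V u)) u w + fd g u (fd V u w)"
proof -
  have lin: "fd g u v = (\<Sum>b\<in>onb. (v \<bullet> b) *\<^sub>R fd g u b)" for u v
    by (rule linear_onb_expansion[OF csmooth_linear_fd[OF g]])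
  have "((\<lambda>u. \<Sum>b\<in>onb. (V u \<bullet> b) *\<^sub>R fd g u b) has_derivative
      (\<lambda>w. \<Sum>b\<in>onb. (V u \<bullet> b) *\<^sub>R fd (\<lambda>u. fd g u b) u w + (fd V u w \<bullet> b) *\<^sub>R fd g u b)) (at u)"
    using csmooth_has_derivative[OF csmooth_fd[OF g]] csmooth_has_derivative[OF V]
    by (intro has_derivative_sum has_derivative_scaleR has_derivative_inner_left) auto
  then have "((\<lambda>u. fd g u (V u)) has_derivative
      (\<lambda>w. \<Sum>b\<in>onb. (V u \<bullet> b) *\<^sub>R fd (\<lambda>u. fd g u b) u w + (fd V u w \<bullet> b) *\<^sub>R fd g u b)) (at u)"
    unfolding lin[symmetric] .
  from fd_eqI[OF this] have "fd (\<lambda>u. fd g u (V u)) u w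
      = (\<Sum>b\<in>onb. (V u \<bullet> b) *\<^sub>R fd (\<lambda>u. fd g u b) u w) + (\<Sum>b\<in>onb. (fd V u w \<bullet> b) *\<^sub>R fd g u b)"
    by (simp add: sum.distrib)
  also have "(\<Sum>b\<in>onb. (V u \<bullet> b) *\<^sub>R fd (\<lambda>u. fd g u b) u w) = fd (\<lambda>u'. fd g u' (V u)) u w"
    by (rule linear_onb_expansion[OF csmooth_linear_fd_fd[OF g], symmetric])
  also have "(\<Sum>b\<in>onb. (fd V u w \<bullet> b) *\<^sub>R fd g u b) = fd g u (fd V u w)" by (rule lin[symmetric])
  finally show ?thesis .
qed

context rough_path begin

text \<open>The chain rule: the symmetry of the second derivative lets only the symmetric part of the area enter
  the second order Taylor term.\<close>

lemma euler_expansion: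
  fixes V :: "'k \<Rightarrow> 'e::{real_inner,heine_borel} \<Rightarrow> 'e" and g :: "'e \<Rightarrow> real"
  assumes V: "\<And>i. csmooth (V i)" and g: "csmooth g" and K: "0 \<le> K"
  shows "\<exists>L\<ge>0. \<forall>s t u v. 0 \<le> s \<and> s \<le> t \<and> t \<le> T \<and> \<omega> s t \<le> 1 \<and>
    norm (v - euler V s t u) \<le> K * \<kappa> s t ^ 3 \<longrightarrow>
    \<bar>g v - g u - (\<Sum>i\<in>UNIV. (x t - x s) $ i * fd g u (V i u))
      - (\<Sum>i\<in>UNIV. \<Sum>j\<in>UNIV. X s t $ i $ j * fd (\<lambda>u. fd g u (V j u)) u (V i u))\<bar> \<le> L * \<kappa> s t ^ 3"
proof -
  obtain L0 where "\<And>i. tame L0 (V i)" using csmooth_tame_family[of V] V by blast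
  then have L0: "0 \<le> L0" "\<And>i u. norm (V i u) \<le> L0" using tameD(1,2) by blast+
  obtain L1 where L1: "0 \<le> L1" "\<And>u v. norm (fd g u v) \<le> L1 * norm v"
    using csmooth_fd_bound[OF g] by blast
  obtain L2 where L2: "0 \<le> L2" "\<And>u v w. norm (fd (\<lambda>u. fd g u v) u w) \<le> L2 * norm v * norm w"
    using csmooth_fd_fd_bound[OF g] by blast
  obtain L3 where L3: "0 \<le> L3"
    "\<And>u h. norm (g (u + h) - g u - fd g u h - (1/2) *\<^sub>R fd (\<lambda>u. fd g u h) u h) \<le> L3 * norm h ^ 3"
    using csmooth_taylor2[OF g] by blast
  obtain M where M: "0 \<le> M" "\<forall>s t u v. 0 \<le> s \<and> s \<le> t \<and> t \<le> T \<and> \<omega> s t \<le> 1 \<and>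
    norm (v - euler V s t u) \<le> K * \<kappa> s t ^ 3 \<longrightarrow>
    norm (v - u - (\<Sum>i\<in>UNIV. (x t - x s) $ i *\<^sub>R V i u)) \<le> M * (\<kappa> s t)\<^sup>2"
    using euler_first_order[of V, OF V K] by blast
  define n where "n = real CARD('k)"
  define R where "R = M + n * L0"
  have n: "0 \<le> n" by (simp add: n_def)
  have R: "0 \<le> R" using M(1) n L0(1) by (simp add: R_def)
  define L where "L = L3 * R ^ 3 + L1 * K + L2 * M * R"
  show ?thesis
  proof (intro exI[of _ L] conjI allI impI, goal_cases)
    case 1
    show ?case using L3(1) R L1(1) K L2(1) M(1) by (simp add: L_def)
  next
    case (2 s t u v)
    then have st: "0 \<le> s" "s \<le> t" "t \<le> T" "\<omega> s t \<le> 1"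
      and v: "norm (v - euler V s t u) \<le> K * \<kappa> s t ^ 3"
      by auto
    let ?k = "\<kappa> s t"
    define W where "W i j = fd (V j) u (V i u)" for i j
    define H where "H v w = fd (\<lambda>u. fd g u v) u w" for v w
    define h where "h = v - u"
    define \<eta> where "\<eta> = (\<Sum>i\<in>UNIV. (x t - x s) $ i *\<^sub>R V i u)"
    have k1: "?k \<le> 1" using \<kappa>_le_1[OF st] .
    have H_left: "linear (\<lambda>v. H v w)" for w unfolding H_def by (rule csmooth_linear_fd_fd[OF g])
    have H_right: "linear (H v)" for v
      unfolding H_def using csmooth_linear_fd[OF csmooth_fd[OF g]] .
    have H_comm: "H v w = H w v" for v w unfolding H_def by (rule csmooth_fd_fd_commute[OF g])
    have hM: "norm (h - \<eta>) \<le> M * ?k\<^sup>2" unfolding h_def \<eta>_def using M(2) st v by blast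
    have \<eta>: "norm \<eta> \<le> n * (?k * L0)"
      unfolding \<eta>_def n_def using path_bound[OF st(1-3)] L0 by (intro norm_sum_UNIV_le) auto
    have \<eta>R: "norm \<eta> \<le> R * ?k"
      using \<eta> mult_nonneg_nonneg[OF M(1) \<kappa>_nonneg[of s t]] by (simp add: R_def algebra_simps)
    have hR: "norm h \<le> R * ?k"
    proof -
      have "M * ?k\<^sup>2 \<le> M * ?k"
        using M(1) k1 power_decreasing[of 1 2 ?k] by (intro mult_left_mono) auto
      with hM have "norm (h - \<eta>) \<le> M * ?k" by linarith
      from norm_triangle_mono[OF this \<eta>] show ?thesis by (simp add: R_def algebra_simps)
    qed
    \<comment> \<open>Each product of two increments is
      \<open>X s t $ i $ j + X s t $ j $ i\<close>; the two resulting double sums agree by the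
      symmetry of \<open>H\<close>.\<close>
    have quad: "H \<eta> \<eta> = 2 * (\<Sum>i\<in>UNIV. \<Sum>j\<in>UNIV. X s t $ i $ j * H (V j u) (V i u))" (is "_ = 2 * ?Q")
    proof -
      have "H \<eta> \<eta> = (\<Sum>i\<in>UNIV. (x t - x s) $ i * H (V i u) \<eta>)"
        using linear_sum[OF H_left, of "\<lambda>i. (x t - x s) $ i *\<^sub>R V i u" UNIV \<eta>, folded \<eta>_def]
        by (simp add: linear_scale[OF H_left])
      also have "\<dots> = (\<Sum>i\<in>UNIV. \<Sum>j\<in>UNIV. (x t - x s) $ i * (x t - x s) $ j * H (V i u) (V j u))"
        unfolding \<eta>_def linear_sum[OF H_right] linear_scale[OF H_right]
        by (simp add: sum_distrib_left mult.assoc)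
      also have "\<dots> = (\<Sum>i\<in>UNIV. \<Sum>j\<in>UNIV. X s t $ i $ j * H (V i u) (V j u))
          + (\<Sum>i\<in>UNIV. \<Sum>j\<in>UNIV. X s t $ j $ i * H (V i u) (V j u))"
        by (simp only: area_symmetric_part[OF st(1-3), symmetric] distrib_right sum.distrib)
      also have "(\<Sum>i\<in>UNIV. \<Sum>j\<in>UNIV. X s t $ i $ j * H (V i u) (V j u)) = ?Q"
        by (subst H_comm) simp
      also have "(\<Sum>i\<in>UNIV. \<Sum>j\<in>UNIV. X s t $ j $ i * H (V i u) (V j u)) = ?Q"
        by (rule sum.swap)
      finally show ?thesis by simp
    qed
    have lin: "fd g u (increment V s t u) = (\<Sum>i\<in>UNIV. (x t - x s) $ i * fd g u (V i u))
        + (\<Sum>i\<in>UNIV. \<Sum>j\<in>UNIV. X s t $ i $ j * fd g u (W i j))"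
      unfolding increment_def linear_comb[OF csmooth_linear_fd[OF g]] by (simp add: comb_def W_def)
    have "g v - g u - (\<Sum>i\<in>UNIV. (x t - x s) $ i * fd g u (V i u))
      - (\<Sum>i\<in>UNIV. \<Sum>j\<in>UNIV. X s t $ i $ j * fd (\<lambda>u. fd g u (V j u)) u (V i u))
      = g v - g u - fd g u (increment V s t u) - ?Q"
      unfolding fd_fd_field[OF g V] lin H_def W_def by (simp add: distrib_left sum.distrib)
    \<comment> \<open>Three errors of third order: the Taylor remainder at \<open>h\<close>, the
      distance of \<open>h\<close> from the exact step, and the replacement of \<open>\<eta>\<close>
      by \<open>h\<close> in the quadratic form, through \<open>H h h - H \<eta> \<eta> = H (h -
      \<eta>) h + H \<eta> (h - \<eta>)\<close>.\<close>
    also have "\<dots> = (g (u + h) - g u - fd g u h - (1/2) *\<^sub>R H h h) + fd g u (h - increment V s t u)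
      + (1/2) * (H (h - \<eta>) h + H \<eta> (h - \<eta>))"
    proof -
      have "H (h - \<eta>) h + H \<eta> (h - \<eta>) = H h h - 2 * ?Q"
        unfolding linear_diff[OF H_left] linear_diff[OF H_right] quad[symmetric] by simp
      then show ?thesis
        by (simp add: h_def linear_diff[OF csmooth_linear_fd[OF g]] diff_divide_distrib)
    qed
    also have "\<bar>\<dots>\<bar> \<le> L3 * (R * ?k) ^ 3 + L1 * (K * ?k ^ 3) + L2 * (M * ?k\<^sup>2) * (R * ?k)"
    proof -
      have 1: "norm (g (u + h) - g u - fd g u h - (1/2) *\<^sub>R H h h) \<le> L3 * (R * ?k) ^ 3"
        using L3(2)[of u h] mult_left_mono[OF power_mono[OF hR norm_ge_zero, of 3] L3(1)]
        by (simp add: H_def)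
      have 2: "norm (fd g u (h - increment V s t u)) \<le> L1 * (K * ?k ^ 3)"
      proof -
        have "norm (h - increment V s t u) \<le> K * ?k ^ 3" using v by (simp add: h_def euler_def diff_diff_eq)
        from mult_left_mono[OF this L1(1)] L1(2)[of u "h - increment V s t u"] show ?thesis by linarith
      qed
      have "norm (H (h - \<eta>) h) \<le> L2 * (M * ?k\<^sup>2) * (R * ?k)"
        unfolding H_def using L2(1) hM hR M(1)
        by (intro order_trans[OF L2(2)] mult_mono mult_left_mono) auto
      moreover have "norm (H \<eta> (h - \<eta>)) \<le> L2 * (R * ?k) * (M * ?k\<^sup>2)"
        unfolding H_def using L2(1) hM \<eta>R R
        by (intro order_trans[OF L2(2)] mult_mono mult_left_mono) auto
      ultimately have "norm (H (h - \<eta>) h + H \<eta> (h - \<eta>)) \<le> 2 * (L2 * (M * ?k\<^sup>2) * (R * ?k))"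
        using norm_triangle_ineq[of "H (h - \<eta>) h" "H \<eta> (h - \<eta>)"] by (simp add: ac_simps)
      then have 3: "norm ((1/2) * (H (h - \<eta>) h + H \<eta> (h - \<eta>))) \<le> L2 * (M * ?k\<^sup>2) * (R * ?k)"
        by (simp add: abs_mult)
      show ?thesis using norm_triangle_mono[OF norm_triangle_mono[OF 1 2] 3] by simp
    qed
    also have "\<dots> = L * ?k ^ 3" by (simp add: L_def algebra_simps power2_eq_square power3_eq_cube)
    finally show ?case .
  qed
qed

end

section \<open>Charts\<close>

lemma topological_chartD:
  assumes "topological_chart c"
  shows "open (fst c)" "open (snd c ` fst c)" "m \<in> fst c \<Longrightarrow> chart_inv c (snd c m) = m"
    "continuous_on (fst c) (snd c)" "continuous_on (snd c ` fst c) (chart_inv c)"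
    "u \<in> snd c ` fst c \<Longrightarrow> snd c (chart_inv c u) = u"
    "u \<in> snd c ` fst c \<Longrightarrow> chart_inv c u \<in> fst c"
  using assms by (auto simp: topological_chart_def homeomorphism_def f_inv_into_f inv_into_into)

lemma open_chart_image:
  assumes "topological_chart c" "open S" "S \<subseteq> fst c"
  shows "open (snd c ` S)"
proof -
  have "openin (top_of_set (fst c)) S" using assms by (simp add: topological_chartD open_subset)
  then have "openin (top_of_set (snd c ` fst c)) (snd c ` S)"
    using assms(1) homeomorphism_imp_open_map unfolding topological_chart_def by blast
  then show ?thesis using topological_chartD(2)[OF assms(1)] openin_open_trans by blast
qed

locale smooth_manifold =
  fixes A :: "('m::{t2_space,second_countable_topology}, 'e::{real_inner,heine_borel}) chart set"
  assumes atlas: "smooth_atlas A"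
begin

lemma charts_topological: "c \<in> charts A \<Longrightarrow> topological_chart c"
  by (simp add: charts_def)

lemma atlas_subset_charts: "c \<in> A \<Longrightarrow> c \<in> charts A"
  using atlas by (simp add: charts_def smooth_atlas_def)

lemma ex_atlas_chart: obtains c where "c \<in> A" "m \<in> fst c"
  using atlas unfolding smooth_atlas_def by blast

text \<open>Membership in \<open>charts A\<close> compares a chart only with the atlas, so the
  transition is factored near each point through an atlas chart around it.\<close>

lemma charts_compatible:
  assumes c: "c \<in> charts A" and d: "d \<in> charts A"
  shows "smooth_on (snd c ` (fst c \<inter> fst d)) (snd d \<circ> chart_inv c)"
proof (rule smooth_on_local)
  note tc = topological_chartD[OF charts_topological[OF c]]
  note td = topological_chartD[OF charts_topological[OF d]]
  fix u assume "u \<in> snd c ` (fst c \<inter> fst d)"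
  then obtain m where m: "m \<in> fst c" "m \<in> fst d" "u = snd c m" by auto
  obtain e where e: "e \<in> A" "m \<in> fst e" by (rule ex_atlas_chart)
  note te = topological_chartD[OF charts_topological[OF atlas_subset_charts[OF e(1)]]]
  let ?S = "snd c ` (fst c \<inter> fst d \<inter> fst e)"
  have ope: "open ?S" using tc(1) td(1) te(1) by (intro open_chart_image charts_topological c) auto
  have ope': "open (snd e ` (fst e \<inter> fst d))"
    using td(1) te(1) by (intro open_chart_image charts_topological atlas_subset_charts e) auto
  have 1: "smooth_on (snd c ` (fst c \<inter> fst e)) (snd e \<circ> chart_inv c)"
    and 2: "smooth_on (snd e ` (fst e \<inter> fst d)) (snd d \<circ> chart_inv e)"
    using c d e(1) by (auto simp: charts_def smooth_compatible_def Int_commute)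
  have "smooth_on ?S (\<lambda>u. (snd d \<circ> chart_inv e) ((snd e \<circ> chart_inv c) u))"
  proof (rule smooth_on_compose[OF ope ope' _ smooth_on_subset[OF 1] 2])
    show "(snd e \<circ> chart_inv c) ` ?S \<subseteq> snd e ` (fst e \<inter> fst d)" using tc(3) by auto
  qed auto
  then have "smooth_on ?S (snd d \<circ> chart_inv c)"
    by (rule smooth_on_cong[OF ope]) (auto simp: tc(3) te(3))
  moreover have "u \<in> ?S" using m e by auto
  ultimately show "\<exists>S'. open S' \<and> u \<in> S' \<and> smooth_on S' (snd d \<circ> chart_inv c)" using ope by blast
qed

text \<open>The definition differentiates in a chart picked by \<open>SOME\<close>; the chain rule
  for the transition map and the transformation law of tangent vectors move the value to any chart
  at \<open>m\<close>.\<close>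

lemma tangent_deriv_chart:
  assumes v: "v \<in> tangent_space A m" and c: "c \<in> charts_at A m"
    and f: "(f \<circ> chart_inv c) differentiable at (snd c m)"
  shows "tangent_deriv A m v f = fd (f \<circ> chart_inv c) (snd c m) (v c)"
proof -
  define d where "d = (SOME c. c \<in> charts_at A m)"
  have d: "d \<in> charts_at A m" unfolding d_def using c by (rule someI)
  have cA: "c \<in> charts A" "m \<in> fst c" and dA: "d \<in> charts A" "m \<in> fst d"
    using c d by (auto simp: charts_at_def)
  note tc = topological_chartD[OF charts_topological[OF cA(1)]]
  note td = topological_chartD[OF charts_topological[OF dA(1)]]
  let ?S = "snd d ` (fst d \<inter> fst c)" and ?t = "snd c \<circ> chart_inv d"
  have op: "open ?S" using tc(1) td(1) by (intro open_chart_image charts_topological dA) auto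
  have mS: "snd d m \<in> ?S" using cA dA by auto
  have t: "?t differentiable at (snd d m)"
    using charts_compatible[OF dA(1) cA(1)] mS by (rule smooth_on_differentiable)
  have tm: "?t (snd d m) = snd c m" using dA by (simp add: td(3))
  have comp: "((f \<circ> chart_inv c) \<circ> ?t) differentiable at (snd d m)"
    using differentiable_chain_at[OF t, of "f \<circ> chart_inv c"] f tm by simp
  have "fd (f \<circ> chart_inv d) (snd d m) = fd ((f \<circ> chart_inv c) \<circ> ?t) (snd d m)"
    by (rule frechet_derivative_transform_within_open[symmetric, OF _ op mS])
      (use comp tc(3) td(3) in auto)
  also have "\<dots> = fd (f \<circ> chart_inv c) (snd c m) \<circ> fd ?t (snd d m)"
    by (rule frechet_derivative_compose[OF t, of "f \<circ> chart_inv c", unfolded tm, OF f])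
  finally have eq: "fd (f \<circ> chart_inv d) (snd d m) = fd (f \<circ> chart_inv c) (snd c m) \<circ> fd ?t (snd d m)" .
  have "fd (f \<circ> chart_inv d) (snd d m) (v d) = fd (f \<circ> chart_inv c) (snd c m) (fd ?t (snd d m) (v d))"
    unfolding eq by (rule comp_apply)
  moreover have "v c = fd ?t (snd d m) (v d)" using v c d unfolding tangent_space_def by blast
  ultimately show ?thesis unfolding tangent_deriv_def d_def[symmetric] Let_def by (simp only:)
qed

text \<open>The critical points lie outside \<open>fst c\<close>. The image of \<open>K\<close>
  under \<open>chart_inv c\<close> is compact, hence closed in the Hausdorff space, so such a point
  has a neighbourhood on which the function vanishes.\<close>

lemma smooth_fun_pullback:
  fixes h :: "'e \<Rightarrow> real"
  assumes c: "c \<in> charts A" and h: "smooth_on UNIV h"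
    and K: "compact K" "K \<subseteq> snd c ` fst c" "\<And>u. u \<notin> K \<Longrightarrow> h u = 0"
  shows "smooth_fun A (\<lambda>m. if m \<in> fst c then h (snd c m) else 0)"
  unfolding smooth_fun_def
proof (intro ballI smooth_on_local)
  note tc = topological_chartD[OF charts_topological[OF c]]
  let ?f = "\<lambda>m. if m \<in> fst c then h (snd c m) else 0"
  fix d u assume d: "d \<in> charts A" and "u \<in> snd d ` fst d"
  note td = topological_chartD[OF charts_topological[OF d]]
  from \<open>u \<in> snd d ` fst d\<close> obtain m where m: "m \<in> fst d" "u = snd d m" by auto
  show "\<exists>S'. open S' \<and> u \<in> S' \<and> smooth_on S' (?f \<circ> chart_inv d)"
  proof (cases "m \<in> fst c")
    case True
    let ?S = "snd d ` (fst d \<inter> fst c)"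
    have op: "open ?S" using tc(1) td(1) by (intro open_chart_image charts_topological d) auto
    have "smooth_on ?S (\<lambda>u. h ((snd c \<circ> chart_inv d) u))"
      by (rule smooth_on_compose[OF op open_UNIV _ charts_compatible[OF d c] h]) auto
    then have "smooth_on ?S (?f \<circ> chart_inv d)"
      by (rule smooth_on_cong[OF op]) (auto simp: td(3))
    then show ?thesis using op m True by blast
  next
    case False
    let ?K = "chart_inv c ` K"
    let ?S = "snd d ` (fst d - ?K)"
    have "compact ?K" using tc(5) K by (intro compact_continuous_image continuous_on_subset[OF tc(5)])
    then have "closed ?K" by (rule compact_imp_closed)
    then have op: "open ?S" using td(1) by (intro open_chart_image charts_topological d) auto
    have "?K \<subseteq> fst c" using K(2) tc(7) by blast
    then have "u \<in> ?S" using m False by auto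
    moreover have "smooth_on ?S (?f \<circ> chart_inv d)"
    proof (rule smooth_on_cong[OF op smooth_on_const[of _ 0]])
      fix v assume "v \<in> ?S"
      then obtain m' where m': "m' \<in> fst d" "m' \<notin> ?K" "v = snd d m'" by auto
      have "h (snd c m') = 0" if "m' \<in> fst c"
        using K(3) m'(2) tc(3)[OF that] by (metis image_eqI)
      then show "0 = (?f \<circ> chart_inv d) v" using m' td(3) by simp
    qed
    ultimately show ?thesis using op by blast
  qed
qed

end

section \<open>Rough differential equations in a chart\<close>

locale rde = rough_path T p \<omega> x X + smooth_manifold A
  for T p :: real and \<omega> :: "real \<Rightarrow> real \<Rightarrow> real"
    and x :: "real \<Rightarrow> real ^ 'k" and X :: "real \<Rightarrow> real \<Rightarrow> real ^ 'k ^ 'k"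
    and A :: "('m::{t2_space,second_countable_topology}, 'e::{real_inner,heine_borel}) chart set" +
  fixes F :: "real ^ 'k \<Rightarrow> 'm \<Rightarrow> ('m, 'e) tangent"
  assumes fields: "linear_vector_fields A F"
begin

lemma field_tangent: "F w m \<in> tangent_space A m"
  using fields by (simp add: linear_vector_fields_def smooth_vector_field_def)

lemma field_smooth: "c \<in> charts A \<Longrightarrow> smooth_on (snd c ` fst c) (\<lambda>u. F w (chart_inv c u) c)"
  using fields by (simp add: linear_vector_fields_def smooth_vector_field_def)

lemma field_linear: "linear (\<lambda>w. F w m c)"
  using fields unfolding linear_vector_fields_def by blast

lemma field_expansion: "F w m c = (\<Sum>i\<in>UNIV. w $ i *\<^sub>R F (axis i 1) m c)"
proof -
  have "F w m c = F (\<Sum>i\<in>UNIV. w $ i *\<^sub>R axis i 1) m c"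
    using basis_expansion[of w] by (simp add: scalar_mult_eq_scaleR)
  also have "\<dots> = (\<Sum>i\<in>UNIV. w $ i *\<^sub>R F (axis i 1) m c)"
    by (simp add: linear_sum[OF field_linear] linear_scale[OF field_linear])
  finally show ?thesis .
qed

definition defect :: "('m \<Rightarrow> real) \<Rightarrow> (real \<Rightarrow> 'm) \<Rightarrow> real \<Rightarrow> real \<Rightarrow> real" where
  "defect f y s t = f (y t) - f (y s) - field_deriv A (F (x t - x s)) f (y s)
     - eval_tensor (\<lambda>w w'. field_deriv A (F w) (field_deriv A (F w') f) (y s)) (X s t)"

text \<open>\<open>F\<close> determines the derivative path, so only \<open>y\<close> is recorded.
  Closed intervals are the form in which solutions are restricted, glued and continued.\<close>

definition solution_on :: "real \<Rightarrow> real \<Rightarrow> (real \<Rightarrow> 'm) \<Rightarrow> bool" where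
  "solution_on a b y \<longleftrightarrow> continuous_on {a..b} y \<and> (\<forall>f. smooth_fun A f \<longrightarrow>
     (\<exists>C. \<exists>\<delta>>0. \<forall>s t. a \<le> s \<and> s \<le> t \<and> t \<le> b \<and> t - s \<le> \<delta> \<longrightarrow> \<bar>defect f y s t\<bar> \<le> C * \<kappa> s t ^ 3))"

end

text \<open>Two radii: the cutoff is one on the ball of radius \<open>r\<close>, where solutions are
  followed, and vanishes outside the ball of radius \<open>2 * r\<close>, before the image of the
  chart is left. On the inner ball the cut off fields and functions are the original ones.\<close>

locale rde_chart = rde T p \<omega> x X A F
  for T p :: real and \<omega> :: "real \<Rightarrow> real \<Rightarrow> real"
    and x :: "real \<Rightarrow> real ^ 'k" and X :: "real \<Rightarrow> real \<Rightarrow> real ^ 'k ^ 'k"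
    and A :: "('m::{t2_space,second_countable_topology}, 'e::{real_inner,heine_borel}) chart set"
    and F :: "real ^ 'k \<Rightarrow> 'm \<Rightarrow> ('m, 'e) tangent" +
  fixes c :: "('m, 'e) chart" and u0 :: 'e and r :: real and cut :: "'e \<Rightarrow> real"
  assumes chart: "c \<in> charts A" and r_pos: "0 < r" and in_chart: "cball u0 (2 * r) \<subseteq> snd c ` fst c"
    and cut_smooth: "smooth_on UNIV cut"
    and cut_1: "\<And>u. u \<in> cball u0 r \<Longrightarrow> cut u = 1"
    and cut_0: "\<And>u. u \<notin> ball u0 (2 * r) \<Longrightarrow> cut u = 0"
begin

lemmas c_chart = topological_chartD[OF charts_topological[OF chart]]

definition N :: "'m set" where "N = {m \<in> fst c. snd c m \<in> ball u0 r}"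

lemma open_N: "open N"
proof -
  have "N = snd c -` ball u0 r \<inter> fst c" by (auto simp: N_def)
  then show ?thesis
    using continuous_open_preimage[OF c_chart(4,1) open_ball, of u0 r] by (simp add: Int_commute)
qed

lemma ball_in_chart: "u \<in> ball u0 r \<Longrightarrow> u \<in> snd c ` fst c"
  using in_chart r_pos by (auto simp: subset_iff)

lemma chart_inv_N: "u \<in> ball u0 r \<Longrightarrow> chart_inv c u \<in> N"
  using ball_in_chart by (simp add: N_def c_chart(6,7))

definition extend :: "('m \<Rightarrow> 'b::real_normed_vector) \<Rightarrow> 'e \<Rightarrow> 'b" where
  "extend g u = (if u \<in> snd c ` fst c then cut u *\<^sub>R g (chart_inv c u) else 0)"

lemma extend_eq: "u \<in> ball u0 r \<Longrightarrow> extend g u = g (chart_inv c u)"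
  using ball_in_chart by (simp add: extend_def cut_1)

text \<open>A point outside the image of the chart is more than \<open>2 * r\<close> away from
  \<open>u0\<close>, so the extension is zero near it; smoothness is an issue only inside the
  image.\<close>

lemma csmooth_extend:
  assumes "smooth_on (snd c ` fst c) (\<lambda>u. g (chart_inv c u))"
  shows "csmooth (extend g)"
  unfolding csmooth_def
proof (intro conjI exI[of _ "norm u0 + 2 * r"] allI impI)
  show "smooth_on UNIV (extend g)"
  proof (rule smooth_on_local)
    fix u
    show "\<exists>S'. open S' \<and> u \<in> S' \<and> smooth_on S' (extend g)"
    proof (cases "u \<in> snd c ` fst c")
      case True
      have "smooth_on (snd c ` fst c) (\<lambda>u. cut u *\<^sub>R g (chart_inv c u))"
        by (intro smooth_on_scaleR c_chart assms smooth_on_subset[OF cut_smooth]) auto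
      then have "smooth_on (snd c ` fst c) (extend g)"
        by (rule smooth_on_cong[OF c_chart(2)]) (simp add: extend_def)
      then show ?thesis using True c_chart(2) by blast
    next
      case False
      have op: "open (- cball u0 (2 * r))" by (intro open_Compl closed_cball)
      have "smooth_on (- cball u0 (2 * r)) (extend g)"
        by (rule smooth_on_cong[OF op smooth_on_const[of _ 0]]) (auto simp: extend_def cut_0)
      then show ?thesis using False in_chart op by blast
    qed
  qed
  fix u :: 'e assume "norm u0 + 2 * r < norm u"
  then have "u \<notin> ball u0 (2 * r)"
    using norm_triangle_sub[of u u0] by (auto simp: dist_norm norm_minus_commute)
  then show "extend g u = 0" by (simp add: extend_def cut_0)
qed

definition V :: "'k \<Rightarrow> 'e \<Rightarrow> 'e" where "V i = extend (\<lambda>m. F (axis i 1) m c)"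

lemma csmooth_V: "csmooth (V i)"
  unfolding V_def by (intro csmooth_extend field_smooth chart)

lemma field_eq_V:
  assumes "m \<in> N"
  shows "F w m c = (\<Sum>i\<in>UNIV. w $ i *\<^sub>R V i (snd c m))"
proof -
  have "snd c m \<in> ball u0 r" "chart_inv c (snd c m) = m" using assms c_chart(3) by (auto simp: N_def)
  then show ?thesis by (subst field_expansion) (simp add: V_def extend_eq)
qed

lemma field_axis_eq_V: "m \<in> N \<Longrightarrow> F (axis i 1) m c = V i (snd c m)"
  using c_chart(3) by (auto simp: N_def V_def extend_eq)

lemma csmooth_extend_fun: "smooth_fun A f \<Longrightarrow> csmooth (extend f)"
  using chart by (intro csmooth_extend) (auto simp: smooth_fun_def o_def)

text \<open>Agreement with \<open>h\<close> on the inner ball suffices. This admits the inner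
  derivative \<open>field_deriv A (F w') f\<close> as the function, without showing that it is
  smooth on the manifold.\<close>

lemma field_deriv_eq:
  assumes "m \<in> N" and h: "csmooth h" and eq: "\<And>u. u \<in> ball u0 r \<Longrightarrow> f (chart_inv c u) = h u"
  shows "field_deriv A (F w) f m = fd h (snd c m) (F w m c)"
proof -
  have m: "m \<in> fst c" "snd c m \<in> ball u0 r" using assms(1) by (auto simp: N_def)
  have diff: "h differentiable at (snd c m)" using csmooth_has_derivative[OF h] differentiable_def by blast
  have "((f \<circ> chart_inv c) has_derivative fd h (snd c m)) (at (snd c m))"
    by (rule has_derivative_transform_within_open[OF csmooth_has_derivative[OF h] open_ball m(2)])
      (simp add: eq)
  then have "(f \<circ> chart_inv c) differentiable at (snd c m)" "fd (f \<circ> chart_inv c) (snd c m) = fd h (snd c m)"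
    by (auto simp: differentiable_def dest: fd_eqI)
  then show ?thesis
    using tangent_deriv_chart[OF field_tangent, of c m f w] m(1) chart
    by (simp add: field_deriv_def charts_at_def)
qed

lemma field_deriv_extend:
  assumes "m \<in> N" and f: "smooth_fun A f"
  shows "field_deriv A (F w) f m = (\<Sum>i\<in>UNIV. w $ i * fd (extend f) (snd c m) (V i (snd c m)))"
proof -
  note lin = csmooth_linear_fd[OF csmooth_extend_fun[OF f]]
  have "field_deriv A (F w) f m = fd (extend f) (snd c m) (F w m c)"
    using assms by (intro field_deriv_eq csmooth_extend_fun) (auto simp: extend_eq)
  then show ?thesis by (simp add: field_eq_V[OF assms(1)] linear_sum[OF lin] linear_scale[OF lin])
qed

lemma field_deriv_field_deriv_extend:
  assumes "m \<in> N" and f: "smooth_fun A f"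
  shows "field_deriv A (F (axis i 1)) (field_deriv A (F (axis j 1)) f) m
    = fd (\<lambda>u. fd (extend f) u (V j u)) (snd c m) (V i (snd c m))"
  unfolding field_axis_eq_V[OF assms(1), symmetric]
proof (rule field_deriv_eq[OF assms(1)])
  show "csmooth (\<lambda>u. fd (extend f) u (V j u))"
    by (intro csmooth_fd_field csmooth_extend_fun f csmooth_V)
  fix u assume u: "u \<in> ball u0 r"
  have "field_deriv A (F (axis j 1)) f (chart_inv c u)
      = fd (extend f) (snd c (chart_inv c u)) (F (axis j 1) (chart_inv c u) c)"
    using f by (intro field_deriv_eq csmooth_extend_fun chart_inv_N u) (auto simp: extend_eq)
  then show "field_deriv A (F (axis j 1)) f (chart_inv c u) = fd (extend f) u (V j u)"
    using u ball_in_chart by (simp add: field_axis_eq_V chart_inv_N c_chart(6))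
qed

lemma defect_eq:
  assumes f: "smooth_fun A f" and "y s \<in> N" "y t \<in> N"
  shows "defect f y s t = extend f (snd c (y t)) - extend f (snd c (y s))
    - (\<Sum>i\<in>UNIV. (x t - x s) $ i * fd (extend f) (snd c (y s)) (V i (snd c (y s))))
    - (\<Sum>i\<in>UNIV. \<Sum>j\<in>UNIV. X s t $ i $ j
        * fd (\<lambda>u. fd (extend f) u (V j u)) (snd c (y s)) (V i (snd c (y s))))"
proof -
  have "extend f (snd c m) = f m" if "m \<in> N" for m
    using that c_chart(3) by (auto simp: N_def extend_eq)
  then show ?thesis
    using assms by (simp add: defect_def eval_tensor_def field_deriv_extend field_deriv_field_deriv_extend)
qed

text \<open>A coordinate of the chart made into a function on the whole manifold, as a test function
  has to be.\<close>

definition coordinate :: "'e \<Rightarrow> 'm \<Rightarrow> real" where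
  "coordinate b m = (if m \<in> fst c then cut (snd c m) * (snd c m \<bullet> b) else 0)"

lemma smooth_coordinate: "smooth_fun A (coordinate b)"
proof -
  have "smooth_on UNIV (\<lambda>u. cut u *\<^sub>R (u \<bullet> b))"
    by (intro smooth_on_scaleR cut_smooth smooth_on_inner smooth_on_const
        smooth_on_bounded_linear bounded_linear_ident) auto
  then have "smooth_on UNIV (\<lambda>u. cut u * (u \<bullet> b))" by simp
  from smooth_fun_pullback[OF chart this compact_cball in_chart]
  show ?thesis unfolding coordinate_def using cut_0 by simp
qed

text \<open>On the inner ball the test function is linear in the chart, so its second derivative
  vanishes and the defect is a component of the Euler error exactly, without a remainder.\<close>

lemma defect_coordinate:
  assumes "y s \<in> N" "y t \<in> N"
  shows "defect (coordinate b) y s t = (snd c (y t) - euler V s t (snd c (y s))) \<bullet> b"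
proof -
  define u where "u = snd c (y s)"
  have u: "u \<in> ball u0 r" "snd c (y t) \<in> ball u0 r" using assms by (auto simp: u_def N_def)
  have ext: "extend (coordinate b) v = v \<bullet> b" if "v \<in> ball u0 r" for v
    using that ball_in_chart[OF that] by (simp add: extend_eq coordinate_def c_chart(6,7) cut_1)
  have fd_ext: "fd (extend (coordinate b)) v = (\<lambda>w. w \<bullet> b)" if "v \<in> ball u0 r" for v
    by (rule fd_eqI, rule has_derivative_transform_within_open[OF _ open_ball that])
      (auto intro!: derivative_eq_intros simp: ext)
  have "fd (\<lambda>v. fd (extend (coordinate b)) v (V j v)) u = (\<lambda>w. fd (V j) u w \<bullet> b)" for j
    by (rule fd_eqI, rule has_derivative_transform_within_open[OF _ open_ball u(1)],
        rule has_derivative_inner_left[OF csmooth_has_derivative[OF csmooth_V]]) (simp add: fd_ext)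
  then show ?thesis
    unfolding defect_eq[OF smooth_coordinate assms] u_def[symmetric]
    by (simp add: ext[OF u(1)] ext[OF u(2)] fd_ext[OF u(1)] euler_def increment_def comb_def inner_diff_left inner_add_left
        inner_sum_left)
qed

definition chart_solution_on :: "real \<Rightarrow> real \<Rightarrow> (real \<Rightarrow> 'm) \<Rightarrow> bool" where
  "chart_solution_on a b y \<longleftrightarrow> (\<exists>K\<ge>0. \<exists>\<delta>>0. \<forall>s t. a \<le> s \<and> s \<le> t \<and> t \<le> b \<and> t - s \<le> \<delta> \<longrightarrow>
     norm (snd c (y t) - euler V s t (snd c (y s))) \<le> K * \<kappa> s t ^ 3)"

lemma solution_on_imp_chart_solution_on:
  assumes "solution_on a b y" and N: "y ` {a..b} \<subseteq> N"
  shows "chart_solution_on a b y"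
proof -
  have "\<exists>C \<delta>. 0 < \<delta> \<and> (\<forall>s t. a \<le> s \<and> s \<le> t \<and> t \<le> b \<and> t - s \<le> \<delta> \<longrightarrow>
      \<bar>defect (coordinate e) y s t\<bar> \<le> C * \<kappa> s t ^ 3)" for e
    using assms(1) smooth_coordinate unfolding solution_on_def by blast
  then obtain C \<delta> where C: "\<And>e. 0 < \<delta> e"
    "\<And>e s t. a \<le> s \<and> s \<le> t \<and> t \<le> b \<and> t - s \<le> \<delta> e \<longrightarrow> \<bar>defect (coordinate e) y s t\<bar> \<le> C e * \<kappa> s t ^ 3"
    by metis
  define K where "K = (\<Sum>e\<in>onb. \<bar>C e\<bar>)"
  \<comment> \<open>The inserted \<open>1\<close> keeps the minimum meaningful when
    \<open>onb\<close> is empty.\<close>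
  define \<delta>' where "\<delta>' = Min (insert 1 (\<delta> ` onb))"
  have \<delta>': "0 < \<delta>'" using C(1) by (auto simp: \<delta>'_def)
  have "norm (snd c (y t) - euler V s t (snd c (y s))) \<le> K * \<kappa> s t ^ 3"
    if st: "a \<le> s" "s \<le> t" "t \<le> b" "t - s \<le> \<delta>'" for s t
  proof -
    have yN: "y s \<in> N" "y t \<in> N" using N st by auto
    have "norm (snd c (y t) - euler V s t (snd c (y s)))
        \<le> (\<Sum>e\<in>onb. \<bar>(snd c (y t) - euler V s t (snd c (y s))) \<bullet> e\<bar>)" by (rule norm_le_sum_onb)
    also have "\<dots> \<le> (\<Sum>e\<in>onb. \<bar>C e\<bar> * \<kappa> s t ^ 3)"
    proof (rule sum_mono)
      fix e :: 'e assume "e \<in> onb"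
      then have "\<delta>' \<le> \<delta> e" unfolding \<delta>'_def by (intro Min_le) auto
      then have "\<bar>defect (coordinate e) y s t\<bar> \<le> C e * \<kappa> s t ^ 3" using C(2) st by force
      also have "\<dots> \<le> \<bar>C e\<bar> * \<kappa> s t ^ 3" by (intro mult_right_mono) auto
      finally show "\<bar>(snd c (y t) - euler V s t (snd c (y s))) \<bullet> e\<bar> \<le> \<bar>C e\<bar> * \<kappa> s t ^ 3"
        by (simp add: defect_coordinate[where y = y, OF yN])
    qed
    finally show ?thesis by (simp add: K_def sum_distrib_right)
  qed
  moreover have "0 \<le> K" by (simp add: K_def sum_nonneg)
  ultimately show ?thesis using \<delta>' unfolding chart_solution_on_def by blast
qed

lemma chart_solution_on_imp_solution_on:
  assumes "chart_solution_on a b y" and N: "y ` {a..b} \<subseteq> N" and ab: "0 \<le> a" "b \<le> T"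
    and cont: "continuous_on {a..b} y"
  shows "solution_on a b y"
  unfolding solution_on_def
proof (intro conjI allI impI cont)
  fix f assume f: "smooth_fun A f"
  obtain K \<delta> where K: "0 \<le> K" "0 < \<delta>"
    "\<forall>s t. a \<le> s \<and> s \<le> t \<and> t \<le> b \<and> t - s \<le> \<delta> \<longrightarrow>
       norm (snd c (y t) - euler V s t (snd c (y s))) \<le> K * \<kappa> s t ^ 3"
    using assms(1) unfolding chart_solution_on_def by blast
  obtain L where L: "\<forall>s t u v. 0 \<le> s \<and> s \<le> t \<and> t \<le> T \<and> \<omega> s t \<le> 1 \<and>
    norm (v - euler V s t u) \<le> K * \<kappa> s t ^ 3 \<longrightarrow>
    \<bar>extend f v - extend f u - (\<Sum>i\<in>UNIV. (x t - x s) $ i * fd (extend f) u (V i u))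
      - (\<Sum>i\<in>UNIV. \<Sum>j\<in>UNIV. X s t $ i $ j * fd (\<lambda>u. fd (extend f) u (V j u)) u (V i u))\<bar> \<le> L * \<kappa> s t ^ 3"
    using euler_expansion[of V "extend f" K, OF csmooth_V csmooth_extend_fun[OF f] K(1)] by blast
  obtain \<delta>1 where \<delta>1: "0 < \<delta>1"
    "\<And>s t. 0 \<le> s \<Longrightarrow> s \<le> t \<Longrightarrow> t \<le> T \<Longrightarrow> t - s \<le> \<delta>1 \<Longrightarrow> \<omega> s t \<le> 1"
    using control_small[of 1] by auto
  show "\<exists>C. \<exists>\<delta>>0. \<forall>s t. a \<le> s \<and> s \<le> t \<and> t \<le> b \<and> t - s \<le> \<delta> \<longrightarrow> \<bar>defect f y s t\<bar> \<le> C * \<kappa> s t ^ 3"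
  proof (rule exI[of _ L], rule exI[of _ "min \<delta> \<delta>1"], intro conjI allI impI)
    fix s t assume st: "a \<le> s \<and> s \<le> t \<and> t \<le> b \<and> t - s \<le> min \<delta> \<delta>1"
    then have "y s \<in> N" "y t \<in> N" using N by auto
    moreover have "\<omega> s t \<le> 1" using \<delta>1(2) st ab by auto
    moreover have "norm (snd c (y t) - euler V s t (snd c (y s))) \<le> K * \<kappa> s t ^ 3"
      using st by (intro K(3)[rule_format]) auto
    ultimately show "\<bar>defect f y s t\<bar> \<le> L * \<kappa> s t ^ 3"
      unfolding defect_eq[OF f \<open>y s \<in> N\<close> \<open>y t \<in> N\<close>] using st ab by (intro L[rule_format]) auto
  qed (use K(2) \<delta>1(1) in auto)
qed

end

lemma (in rde) ex_rde_chart: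
  assumes "c \<in> charts A" "m \<in> fst c"
  obtains r cut where "rde_chart T p \<omega> x X A F c (snd c m) r cut"
proof -
  have "snd c m \<in> snd c ` fst c" using assms by blast
  then obtain R where R: "0 < R" "cball (snd c m) R \<subseteq> snd c ` fst c"
    using topological_chartD(2)[OF charts_topological[OF assms(1)]] open_contains_cball by metis
  obtain cut where "smooth_on UNIV cut" "\<And>u. u \<in> cball (snd c m) (R / 2) \<Longrightarrow> cut u = (1::real)"
    "\<And>u. u \<notin> ball (snd c m) (2 * (R / 2)) \<Longrightarrow> cut u = 0"
    using ex_cutoff[of "R / 2" "snd c m"] R(1) by auto
  then have "rde_chart T p \<omega> x X A F c (snd c m) (R / 2) cut"
    by unfold_locales (use assms R in auto)
  then show ?thesis by (rule that)
qed

section \<open>Solutions on the manifold\<close>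

lemma continuous_on_interval_nhd:
  fixes y :: "real \<Rightarrow> 'm::topological_space"
  assumes "continuous_on {a..b} y" "open N" "\<sigma> \<in> {a..b}" "y \<sigma> \<in> N"
  shows "\<exists>\<epsilon>>0. \<forall>t\<in>{a..b}. \<bar>t - \<sigma>\<bar> \<le> \<epsilon> \<longrightarrow> y t \<in> N"
proof -
  obtain U where U: "open U" "U \<inter> {a..b} = y -` N \<inter> {a..b}"
    using assms(1,2) continuous_on_open_invariant by metis
  then have "\<sigma> \<in> U" using assms(3,4) by blast
  then obtain \<epsilon> where \<epsilon>: "0 < \<epsilon>" "cball \<sigma> \<epsilon> \<subseteq> U" using U(1) open_contains_cball by blast
  have "y t \<in> N" if "t \<in> {a..b}" "\<bar>t - \<sigma>\<bar> \<le> \<epsilon>" for t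
  proof -
    have "t \<in> cball \<sigma> \<epsilon>" using that(2) by (simp add: dist_real_def abs_minus_commute)
    then show ?thesis using \<epsilon>(2) U(2) that(1) by blast
  qed
  then show ?thesis using \<epsilon>(1) by blast
qed

lemma (in rde_chart) open_chart_ball: "open {m \<in> fst c. snd c m \<in> ball u0 s}"
proof -
  have "{m \<in> fst c. snd c m \<in> ball u0 s} = fst c \<inter> snd c -` ball u0 s" by auto
  then show ?thesis
    using continuous_open_preimage[OF c_chart(4,1) open_ball, of u0 s] by simp
qed

lemma (in rde_chart) ex_almost_flow: obtains C where "almost_flow T p \<omega> (euler V) C"
  using almost_flow_euler[of V, OF csmooth_V] by blast

context rde begin

lemma solution_on_subset:
  assumes "solution_on a b y" "a \<le> a'" "b' \<le> b"
  shows "solution_on a' b' y"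
proof -
  have "continuous_on {a'..b'} y"
    using assms continuous_on_subset[of "{a..b}" y "{a'..b'}"] by (auto simp: solution_on_def)
  moreover have "\<exists>C. \<exists>\<delta>>0. \<forall>s t. a' \<le> s \<and> s \<le> t \<and> t \<le> b' \<and> t - s \<le> \<delta> \<longrightarrow>
      \<bar>defect f y s t\<bar> \<le> C * \<kappa> s t ^ 3" if f: "smooth_fun A f" for f
  proof -
    obtain C \<delta> where "0 < \<delta>" "\<forall>s t. a \<le> s \<and> s \<le> t \<and> t \<le> b \<and> t - s \<le> \<delta> \<longrightarrow>
      \<bar>defect f y s t\<bar> \<le> C * \<kappa> s t ^ 3"
      using assms(1) f unfolding solution_on_def by blast
    with assms(2,3) show ?thesis by (meson order_trans)
  qed
  ultimately show ?thesis by (simp add: solution_on_def)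
qed

lemma solution_on_cong:
  assumes "solution_on a b y" "\<And>t. t \<in> {a..b} \<Longrightarrow> y t = z t"
  shows "solution_on a b z"
proof -
  have "\<exists>C. \<exists>\<delta>>0. \<forall>s t. a \<le> s \<and> s \<le> t \<and> t \<le> b \<and> t - s \<le> \<delta> \<longrightarrow>
      \<bar>defect f z s t\<bar> \<le> C * \<kappa> s t ^ 3" if f: "smooth_fun A f" for f
  proof -
    obtain C \<delta> where C: "0 < \<delta>" "\<forall>s t. a \<le> s \<and> s \<le> t \<and> t \<le> b \<and> t - s \<le> \<delta> \<longrightarrow>
      \<bar>defect f y s t\<bar> \<le> C * \<kappa> s t ^ 3"
      using assms(1) f unfolding solution_on_def by blast
    have "defect f y s t = defect f z s t" if "a \<le> s" "s \<le> t" "t \<le> b" for s t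
      using assms(2)[of s] assms(2)[of t] that by (simp add: defect_def)
    with C show ?thesis by (metis (no_types, lifting))
  qed
  moreover have "continuous_on {a..b} z"
    using assms continuous_on_cong[of "{a..b}" "{a..b}" y z] by (auto simp: solution_on_def)
  ultimately show ?thesis by (simp add: solution_on_def)
qed

section \<open>Local existence, uniformly near a point and on compact sets\<close>

lemma ex_local_solution:
  obtains N h where "open N" "m0 \<in> N" "0 < h"
    "\<And>s t m. 0 \<le> s \<Longrightarrow> s \<le> t \<Longrightarrow> t \<le> T \<Longrightarrow> t - s \<le> h \<Longrightarrow> m \<in> N \<Longrightarrow> \<exists>y. solution_on s t y \<and> y s = m"
proof -
  obtain c where c: "c \<in> A" "m0 \<in> fst c" by (rule ex_atlas_chart)
  obtain r cut where "rde_chart T p \<omega> x X A F c (snd c m0) r cut"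
    using ex_rde_chart[OF atlas_subset_charts[OF c(1)] c(2)] .
  then interpret ch: rde_chart T p \<omega> x X A F c "snd c m0" r cut .
  obtain C where "almost_flow T p \<omega> (euler ch.V) C" by (rule ch.ex_almost_flow)
  then interpret fl: almost_flow T p \<omega> "euler ch.V" C .
  define M where "M = C + fl.K_flow"
  have M: "0 \<le> M" using fl.C_nonneg fl.K_flow_nonneg by (simp add: M_def)
  \<comment> \<open>The first bound makes short intervals \<open>small\<close>; by the second a path
    moves by at most \<open>r / 4\<close>, so from the ball of radius \<open>r / 2\<close> it stays
    where the cutoff is one. Neither depends on the starting time or point, and so neither does
    \<open>h\<close>.\<close>
  define \<epsilon> where "\<epsilon> = min ((1 - q) / (C + 1)) (r / (4 * (M + 1)))"
  have "0 < \<epsilon>" using fl.C_nonneg q_less_1 M ch.r_pos by (simp add: \<epsilon>_def)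
  from \<kappa>_small[OF this] obtain h where h: "0 < h"
    "\<And>s t. 0 \<le> s \<Longrightarrow> s \<le> t \<Longrightarrow> t \<le> T \<Longrightarrow> t - s \<le> h \<Longrightarrow> \<omega> s t \<le> 1 \<and> \<kappa> s t \<le> \<epsilon>" by metis
  define N' where "N' = {m \<in> fst c. snd c m \<in> ball (snd c m0) (r / 2)}"
  show ?thesis
  proof
    show "open N'" unfolding N'_def by (rule ch.open_chart_ball)
    show "m0 \<in> N'" using c ch.r_pos by (simp add: N'_def)
    show "0 < h" by (rule h(1))
    fix s t m assume st: "0 \<le> s" "s \<le> t" "t \<le> T" "t - s \<le> h" and m: "m \<in> N'"
    have \<kappa>: "\<omega> s t \<le> 1" "\<kappa> s t \<le> \<epsilon>" using h(2)[OF st] by auto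
    have "C * \<kappa> s t \<le> (C + 1) * \<epsilon>" using \<kappa> fl.C_nonneg by (intro mult_mono) auto
    also have "\<dots> \<le> (C + 1) * ((1 - q) / (C + 1))"
      using fl.C_nonneg by (intro mult_left_mono) (auto simp: \<epsilon>_def)
    also have "\<dots> = 1 - q" using fl.C_nonneg by simp
    finally have sm: "fl.small s t" using st \<kappa> by (simp add: fl.small_def)
    obtain \<eta> where \<eta>: "\<eta> s = snd c m" "fl.follows \<eta> s t fl.K_flow" using fl.ex_follows[OF sm] by blast
    have near: "\<eta> u \<in> ball (snd c m0) r" if u: "u \<in> {s..t}" for u
    proof -
      have "norm (\<eta> u - \<eta> s) \<le> M * \<kappa> s u"
        unfolding M_def using fl.follows_near[OF \<eta>(2) fl.K_flow_nonneg] st \<kappa> u by auto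
      also have "\<dots> \<le> (M + 1) * \<epsilon>"
        using M \<kappa>(2) \<kappa>_mono[of s s u t] st u by (intro mult_mono) auto
      also have "\<dots> \<le> (M + 1) * (r / (4 * (M + 1)))"
        using M by (intro mult_left_mono) (auto simp: \<epsilon>_def)
      also have "\<dots> = r / 4"
      proof -
        have "(l + 1) * (r / (4 * (l + 1))) = r / 4" if "0 \<le> l" for l using that by (simp add: divide_simps)
        then show ?thesis using M .
      qed
      finally have "dist (\<eta> s) (\<eta> u) \<le> r / 4" by (simp add: dist_norm norm_minus_commute)
      moreover have "dist (snd c m0) (\<eta> s) < r / 2" using m \<eta>(1) by (simp add: N'_def)
      ultimately show ?thesis
        using dist_triangle[of "snd c m0" "\<eta> u" "\<eta> s"] ch.r_pos by simp
    qed
    define y where "y u = chart_inv c (\<eta> u)" for u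
    have cy: "snd c (y u) = \<eta> u" if "u \<in> {s..t}" for u
      using near[OF that] ch.ball_in_chart ch.c_chart(6) by (simp add: y_def)
    have yN: "y ` {s..t} \<subseteq> ch.N" using near ch.chart_inv_N by (auto simp: y_def)
    have "continuous_on {s..t} \<eta>"
      using fl.follows_continuous[OF \<eta>(2) fl.K_flow_nonneg] st \<kappa> by auto
    then have cont: "continuous_on {s..t} y"
      unfolding y_def using near ch.ball_in_chart
      by (intro continuous_on_compose2[OF ch.c_chart(5)]) auto
    have "ch.chart_solution_on s t y"
      unfolding ch.chart_solution_on_def
      by (rule exI[of _ fl.K_flow], intro conjI fl.K_flow_nonneg exI[of _ 1])
        (use \<eta>(2) cy in \<open>auto simp: fl.follows_def\<close>)
    then have "solution_on s t y"
      using ch.chart_solution_on_imp_solution_on yN st cont by auto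
    moreover have "y s = m" using \<eta>(1) m ch.c_chart(3) by (simp add: y_def N'_def)
    ultimately show "\<exists>y. solution_on s t y \<and> y s = m" by blast
  qed
qed

lemma ex_local_solution_compact:
  assumes "compact K"
  obtains h where "0 < h"
    "\<And>s t m. 0 \<le> s \<Longrightarrow> s \<le> t \<Longrightarrow> t \<le> T \<Longrightarrow> t - s \<le> h \<Longrightarrow> m \<in> K \<Longrightarrow> \<exists>y. solution_on s t y \<and> y s = m"
proof -
  have "\<exists>N h. open N \<and> m0 \<in> N \<and> 0 < h \<and>
    (\<forall>s t m. 0 \<le> s \<and> s \<le> t \<and> t \<le> T \<and> t - s \<le> h \<and> m \<in> N \<longrightarrow> (\<exists>y. solution_on s t y \<and> y s = m))" for m0
    using ex_local_solution[of m0] by metis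
  then obtain N h where N: "\<And>m. open (N m)" "\<And>m. m \<in> N m" "\<And>m. 0 < h m"
    "\<And>m0 s t m. 0 \<le> s \<and> s \<le> t \<and> t \<le> T \<and> t - s \<le> h m0 \<and> m \<in> N m0 \<longrightarrow> (\<exists>y. solution_on s t y \<and> y s = m)"
    by metis
  obtain D where D: "D \<subseteq> K" "finite D" "K \<subseteq> (\<Union>m\<in>D. N m)"
    by (rule compactE_image[OF assms, of K N]) (use N in auto)
  define h0 where "h0 = Min (insert 1 (h ` D))"
  have "0 < h0" using D(2) N(3) by (auto simp: h0_def)
  moreover have "\<exists>y. solution_on s t y \<and> y s = m"
    if st: "0 \<le> s" "s \<le> t" "t \<le> T" "t - s \<le> h0" and m: "m \<in> K" for s t m
  proof -
    obtain m0 where m0: "m0 \<in> D" "m \<in> N m0" using D(3) m by blast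
    then have "h0 \<le> h m0" unfolding h0_def using D(2) by (intro Min_le) auto
    then show ?thesis using N(4)[of s t m0 m] st m0(2) by auto
  qed
  ultimately show ?thesis using that by blast
qed

section \<open>Uniqueness and concatenation on the manifold\<close>

lemma solution_unique_local:
  assumes y: "solution_on a b y" and z: "solution_on a b z" and "y a = z a"
    and ab: "0 \<le> a" "a < b" "b \<le> T"
  obtains d where "a < d" "d \<le> b" "\<And>t. t \<in> {a..d} \<Longrightarrow> y t = z t"
proof -
  obtain c where c: "c \<in> A" "y a \<in> fst c" by (rule ex_atlas_chart)
  obtain r cut where "rde_chart T p \<omega> x X A F c (snd c (y a)) r cut"
    using ex_rde_chart[OF atlas_subset_charts[OF c(1)] c(2)] .
  then interpret ch: rde_chart T p \<omega> x X A F c "snd c (y a)" r cut .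
  obtain C where "almost_flow T p \<omega> (euler ch.V) C" by (rule ch.ex_almost_flow)
  then interpret fl: almost_flow T p \<omega> "euler ch.V" C .
  have "y a \<in> ch.N" using c ch.r_pos by (simp add: ch.N_def)
  moreover from this have "z a \<in> ch.N" using assms(3) by metis
  moreover have "continuous_on {a..b} y" "continuous_on {a..b} z"
    using y z by (auto simp: solution_on_def)
  ultimately obtain \<epsilon>1 \<epsilon>2 where \<epsilon>: "0 < \<epsilon>1" "0 < \<epsilon>2"
    "\<forall>t\<in>{a..b}. \<bar>t - a\<bar> \<le> \<epsilon>1 \<longrightarrow> y t \<in> ch.N"
    "\<forall>t\<in>{a..b}. \<bar>t - a\<bar> \<le> \<epsilon>2 \<longrightarrow> z t \<in> ch.N"
    using continuous_on_interval_nhd[of a b y ch.N a] continuous_on_interval_nhd[of a b z ch.N a]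
      ch.open_N ab by auto
  define b' where "b' = min b (a + min \<epsilon>1 \<epsilon>2)"
  have b': "a < b'" "b' \<le> b" using ab \<epsilon> by (auto simp: b'_def)
  have yN: "y ` {a..b'} \<subseteq> ch.N" "z ` {a..b'} \<subseteq> ch.N" using \<epsilon>(3,4) by (auto simp: b'_def)
  have "ch.chart_solution_on a b' y" "ch.chart_solution_on a b' z"
    using ch.solution_on_imp_chart_solution_on solution_on_subset[OF y order_refl b'(2)]
      solution_on_subset[OF z order_refl b'(2)] yN by auto
  then obtain K1 \<delta>1 K2 \<delta>2 where K: "0 < \<delta>1" "0 < \<delta>2"
    "\<forall>s t. a \<le> s \<and> s \<le> t \<and> t \<le> b' \<and> t - s \<le> \<delta>1 \<longrightarrow>
      norm (snd c (y t) - euler ch.V s t (snd c (y s))) \<le> K1 * \<kappa> s t ^ 3"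
    "\<forall>s t. a \<le> s \<and> s \<le> t \<and> t \<le> b' \<and> t - s \<le> \<delta>2 \<longrightarrow>
      norm (snd c (z t) - euler ch.V s t (snd c (z s))) \<le> K2 * \<kappa> s t ^ 3"
    unfolding ch.chart_solution_on_def by blast
  \<comment> \<open>An interval of length at most \<open>\<delta>1\<close> and
    \<open>\<delta>2\<close> removes the proviso on \<open>t - s\<close>, which
    \<open>follows\<close> does not have.\<close>
  define e where "e = min b' (a + min \<delta>1 \<delta>2)"
  have e: "a < e" "e \<le> b'" "e \<le> T" using b' K(1,2) ab by (auto simp: e_def)
  have "fl.follows (\<lambda>t. snd c (y t)) a e K1"
    unfolding fl.follows_def by (intro allI impI K(3)[rule_format]) (auto simp: e_def)
  moreover have "fl.follows (\<lambda>t. snd c (z t)) a e K2"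
    unfolding fl.follows_def by (intro allI impI K(4)[rule_format]) (auto simp: e_def)
  ultimately obtain d where d: "a < d" "d \<le> e" "\<And>t. t \<in> {a..d} \<Longrightarrow> snd c (y t) = snd c (z t)"
    using fl.follows_unique_local[of "\<lambda>t. snd c (y t)" a e K1 "\<lambda>t. snd c (z t)" K2] assms(3) ab(1) e
    by metis
  have "y t = z t" if "t \<in> {a..d}" for t
  proof -
    have "t \<in> {a..b'}" using that d(2) e by auto
    then have "y t \<in> ch.N" "z t \<in> ch.N" using yN by blast+
    then have "y t \<in> fst c" "z t \<in> fst c" by (simp_all add: ch.N_def)
    then show ?thesis using d(3)[OF that] ch.c_chart(3) by metis
  qed
  then show ?thesis using that d b' e by (meson order_trans)
qed

text \<open>The paths agree up to a supremum; the Hausdorff property extends the agreement to that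
  time itself, and local uniqueness carries it further unless the time is \<open>b\<close>.\<close>

lemma solution_unique:
  assumes y: "solution_on a b y" and z: "solution_on a b z" and start: "y a = z a"
    and ab: "0 \<le> a" "b \<le> T" and t: "t \<in> {a..b}"
  shows "y t = z t"
proof -
  define S where "S = {t \<in> {a..b}. \<forall>s\<in>{a..t}. y s = z s}"
  define \<sigma> where "\<sigma> = Sup S"
  have aS: "a \<in> S" using start t by (auto simp: S_def)
  have bdd: "bdd_above S" by (rule bdd_aboveI[of _ b]) (auto simp: S_def)
  have Sb: "t \<le> b" if "t \<in> S" for t using that by (simp add: S_def)
  have "S \<noteq> {}" using aS by blast
  then have \<sigma>: "a \<le> \<sigma>" "\<sigma> \<le> b"
    unfolding \<sigma>_def using cSup_upper[OF aS bdd] cSup_least[of S b] Sb by simp_all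
  have before: "y s = z s" if s: "a \<le> s" "s < \<sigma>" for s
  proof -
    obtain t where "t \<in> S" "s < t"
      using less_cSupD[OF \<open>S \<noteq> {}\<close> s(2)[unfolded \<sigma>_def]] by blast
    then show ?thesis using s by (auto simp: S_def)
  qed
  have at: "y \<sigma> = z \<sigma>"
  proof (rule ccontr)
    assume ne: "y \<sigma> \<noteq> z \<sigma>"
    then have "a < \<sigma>" using start \<sigma>(1) by (cases "a = \<sigma>") auto
    obtain U U' where U: "open U" "open U'" "y \<sigma> \<in> U" "z \<sigma> \<in> U'" "U \<inter> U' = {}"
      using hausdorff[OF ne] by blast
    have "continuous_on {a..b} y" "continuous_on {a..b} z" using y z by (auto simp: solution_on_def)
    then obtain \<epsilon>1 \<epsilon>2 where \<epsilon>: "0 < \<epsilon>1" "0 < \<epsilon>2"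
      "\<forall>t\<in>{a..b}. \<bar>t - \<sigma>\<bar> \<le> \<epsilon>1 \<longrightarrow> y t \<in> U" "\<forall>t\<in>{a..b}. \<bar>t - \<sigma>\<bar> \<le> \<epsilon>2 \<longrightarrow> z t \<in> U'"
      using continuous_on_interval_nhd[of a b y U \<sigma>] continuous_on_interval_nhd[of a b z U' \<sigma>]
        U(1-4) \<sigma> by auto
    define s where "s = max a (\<sigma> - min \<epsilon>1 \<epsilon>2)"
    have s: "a \<le> s" "s < \<sigma>" "\<bar>s - \<sigma>\<bar> \<le> \<epsilon>1" "\<bar>s - \<sigma>\<bar> \<le> \<epsilon>2" "s \<in> {a..b}"
      using \<open>a < \<sigma>\<close> \<epsilon>(1,2) \<sigma> by (auto simp: s_def)
    then have "y s \<in> U" "z s \<in> U'" using \<epsilon>(3,4) by blast+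
    then show False using before[OF s(1,2)] U(5) by auto
  qed
  have "\<sigma> = b"
  proof (rule ccontr)
    assume "\<sigma> \<noteq> b"
    then have "\<sigma> < b" using \<sigma> by simp
    then obtain d where d: "\<sigma> < d" "d \<le> b" "\<And>t. t \<in> {\<sigma>..d} \<Longrightarrow> y t = z t"
      using solution_unique_local[OF solution_on_subset[OF y \<sigma>(1) order_refl]
          solution_on_subset[OF z \<sigma>(1) order_refl] at] \<sigma> ab by (metis order_trans)
    have "d \<in> S" using d \<sigma> before by (auto simp: S_def) (metis atLeastAtMost_iff not_le)
    then show False using cSup_upper[OF _ bdd] d(1) by (force simp: \<sigma>_def)
  qed
  then show ?thesis using before at t by (cases "t = b") auto
qed

text \<open>Only pairs straddling \<open>b\<close> are not covered by the two hypotheses. Near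
  \<open>b\<close> both pieces lie in one chart, where \<open>follows_concat\<close> joins their
  error bounds; the result is translated back to test functions on \<open>{a'..e'}\<close>.\<close>

lemma solution_on_concat:
  assumes y1: "solution_on a b y" and y2: "solution_on b e y" and ab: "0 \<le> a" "a \<le> b" "b \<le> e" "e \<le> T"
  shows "solution_on a e y"
proof -
  have "continuous_on ({a..b} \<union> {b..e}) y"
    using y1 y2 by (intro continuous_on_closed_Un) (auto simp: solution_on_def)
  then have cont: "continuous_on {a..e} y" using ab by (simp add: ivl_disj_un_two_touch)
  obtain c where c: "c \<in> A" "y b \<in> fst c" by (rule ex_atlas_chart)
  obtain r cut where "rde_chart T p \<omega> x X A F c (snd c (y b)) r cut"
    using ex_rde_chart[OF atlas_subset_charts[OF c(1)] c(2)] .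
  then interpret ch: rde_chart T p \<omega> x X A F c "snd c (y b)" r cut .
  obtain C where "almost_flow T p \<omega> (euler ch.V) C" by (rule ch.ex_almost_flow)
  then interpret fl: almost_flow T p \<omega> "euler ch.V" C .
  have "y b \<in> ch.N" using c ch.r_pos by (simp add: ch.N_def)
  then obtain \<epsilon> where \<epsilon>: "0 < \<epsilon>" "\<forall>t\<in>{a..e}. \<bar>t - b\<bar> \<le> \<epsilon> \<longrightarrow> y t \<in> ch.N"
    using continuous_on_interval_nhd[OF cont ch.open_N, of b] ab by auto
  define a' e' where "a' = max a (b - \<epsilon>)" and "e' = min e (b + \<epsilon>)"
  have a': "a \<le> a'" "a' \<le> b" "b \<le> e'" "e' \<le> e" using ab \<epsilon>(1) by (auto simp: a'_def e'_def)
  have yN: "y ` {a'..e'} \<subseteq> ch.N" using \<epsilon>(2) by (auto simp: a'_def e'_def)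
  have "ch.chart_solution_on a' b y"
    by (rule ch.solution_on_imp_chart_solution_on[OF solution_on_subset[OF y1 a'(1) order_refl]])
      (use yN a' in auto)
  then obtain K1 \<delta>1 where K1: "0 \<le> K1" "0 < \<delta>1" "\<forall>s t. a' \<le> s \<and> s \<le> t \<and> t \<le> b \<and> t - s \<le> \<delta>1 \<longrightarrow>
      norm (snd c (y t) - euler ch.V s t (snd c (y s))) \<le> K1 * \<kappa> s t ^ 3"
    unfolding ch.chart_solution_on_def by metis
  have "ch.chart_solution_on b e' y"
    by (rule ch.solution_on_imp_chart_solution_on[OF solution_on_subset[OF y2 order_refl a'(4)]])
      (use yN a' in auto)
  then obtain K2 \<delta>2 where K2: "0 \<le> K2" "0 < \<delta>2" "\<forall>s t. b \<le> s \<and> s \<le> t \<and> t \<le> e' \<and> t - s \<le> \<delta>2 \<longrightarrow>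
      norm (snd c (y t) - euler ch.V s t (snd c (y s))) \<le> K2 * \<kappa> s t ^ 3"
    unfolding ch.chart_solution_on_def by metis
  obtain \<delta>3 where \<delta>3: "0 < \<delta>3"
    "\<And>s t. 0 \<le> s \<Longrightarrow> s \<le> t \<Longrightarrow> t \<le> T \<Longrightarrow> t - s \<le> \<delta>3 \<Longrightarrow> \<omega> s t \<le> 1"
    using control_small[of 1] by auto
  define K where "K = max K1 K2"
  have K: "0 \<le> K" using K1 by (simp add: K_def)
  have fol1: "fl.follows (\<lambda>t. snd c (y t)) s t K" if "a' \<le> s" "t \<le> b" "t - s \<le> \<delta>1" for s t
    unfolding fl.follows_def
  proof (intro allI impI, elim conjE)
    fix v w assume "s \<le> v" "v \<le> w" "w \<le> t"
    then have "norm (snd c (y w) - euler ch.V v w (snd c (y v))) \<le> K1 * \<kappa> v w ^ 3"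
      using that by (intro K1(3)[rule_format]) auto
    also have "\<dots> \<le> K * \<kappa> v w ^ 3" by (intro mult_right_mono) (auto simp: K_def)
    finally show "norm (snd c (y w) - euler ch.V v w (snd c (y v))) \<le> K * \<kappa> v w ^ 3" .
  qed
  have fol2: "fl.follows (\<lambda>t. snd c (y t)) s t K" if "b \<le> s" "t \<le> e'" "t - s \<le> \<delta>2" for s t
    unfolding fl.follows_def
  proof (intro allI impI, elim conjE)
    fix v w assume "s \<le> v" "v \<le> w" "w \<le> t"
    then have "norm (snd c (y w) - euler ch.V v w (snd c (y v))) \<le> K2 * \<kappa> v w ^ 3"
      using that by (intro K2(3)[rule_format]) auto
    also have "\<dots> \<le> K * \<kappa> v w ^ 3" by (intro mult_right_mono) (auto simp: K_def)
    finally show "norm (snd c (y w) - euler ch.V v w (snd c (y v))) \<le> K * \<kappa> v w ^ 3" .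
  qed
  define K' where "K' = K + (1 + C) * K + C"
  have K': "K \<le> K'" "0 \<le> K'" using K fl.C_nonneg by (auto simp: K'_def)
  have "ch.chart_solution_on a' e' y"
    unfolding ch.chart_solution_on_def
  proof (rule exI[of _ K'], intro conjI K'(2), rule exI[of _ "min (min \<delta>1 \<delta>2) \<delta>3"], intro conjI allI impI)
    fix s t assume st: "a' \<le> s \<and> s \<le> t \<and> t \<le> e' \<and> t - s \<le> min (min \<delta>1 \<delta>2) \<delta>3"
    show "norm (snd c (y t) - euler ch.V s t (snd c (y s))) \<le> K' * \<kappa> s t ^ 3"
    proof (cases "t \<le> b \<or> b \<le> s")
      case True
      then have "fl.follows (\<lambda>t. snd c (y t)) s t K" using fol1 fol2 st by auto
      then have "norm (snd c (y t) - euler ch.V s t (snd c (y s))) \<le> K * \<kappa> s t ^ 3"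
        using st by (auto simp: fl.follows_def)
      also have "\<dots> \<le> K' * \<kappa> s t ^ 3" using K'(1) by (intro mult_right_mono) auto
      finally show ?thesis .
    next
      case False
      then have "fl.follows (\<lambda>t. snd c (y t)) s t K'"
        unfolding K'_def using st a' ab \<delta>3(2)[of s t] K
        by (intro fl.follows_concat[of _ s b K t] fol1 fol2) auto
      then show ?thesis using st by (auto simp: fl.follows_def)
    qed
  qed (use K1(2) K2(2) \<delta>3(1) in auto)
  then have sol: "solution_on a' e' y"
    using ch.chart_solution_on_imp_solution_on yN a' ab continuous_on_subset[OF cont, of "{a'..e'}"] by auto
  show ?thesis
    unfolding solution_on_def
  proof (intro conjI cont allI impI)
    fix f assume f: "smooth_fun A f"
    obtain C1 d1 where f1: "0 < d1" "\<forall>s t. a \<le> s \<and> s \<le> t \<and> t \<le> b \<and> t - s \<le> d1 \<longrightarrow>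
      \<bar>defect f y s t\<bar> \<le> C1 * \<kappa> s t ^ 3" using y1 f unfolding solution_on_def by blast
    obtain C2 d2 where f2: "0 < d2" "\<forall>s t. b \<le> s \<and> s \<le> t \<and> t \<le> e \<and> t - s \<le> d2 \<longrightarrow>
      \<bar>defect f y s t\<bar> \<le> C2 * \<kappa> s t ^ 3" using y2 f unfolding solution_on_def by blast
    obtain C3 d3 where f3: "0 < d3" "\<forall>s t. a' \<le> s \<and> s \<le> t \<and> t \<le> e' \<and> t - s \<le> d3 \<longrightarrow>
      \<bar>defect f y s t\<bar> \<le> C3 * \<kappa> s t ^ 3" using sol f unfolding solution_on_def by blast
    define C0 where "C0 = max C1 (max C2 C3)"
    \<comment> \<open>Being at most \<open>\<epsilon>\<close>, \<open>d\<close> forces a straddling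
      pair into \<open>{a'..e'}\<close>.\<close>
    define d where "d = min (min d1 d2) (min d3 \<epsilon>)"
    show "\<exists>C. \<exists>\<delta>>0. \<forall>s t. a \<le> s \<and> s \<le> t \<and> t \<le> e \<and> t - s \<le> \<delta> \<longrightarrow> \<bar>defect f y s t\<bar> \<le> C * \<kappa> s t ^ 3"
    proof (rule exI[of _ C0], rule exI[of _ d], intro conjI allI impI, goal_cases)
      case 1
      then show ?case using f1(1) f2(1) f3(1) \<epsilon>(1) by (simp add: d_def)
    next
      case (2 s t)
      then have st: "a \<le> s" "s \<le> t" "t \<le> e" "t - s \<le> d" by auto
      consider "t \<le> b" | "b \<le> s" | "a' \<le> s" "t \<le> e'"
        using st by (auto simp: d_def a'_def e'_def) linarith
      then have "\<exists>C\<in>{C1, C2, C3}. \<bar>defect f y s t\<bar> \<le> C * \<kappa> s t ^ 3"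
      proof cases
        case 1
        have "\<bar>defect f y s t\<bar> \<le> C1 * \<kappa> s t ^ 3"
          by (rule f1(2)[rule_format])
            (use 1 st in \<open>auto simp: d_def\<close>)
        then show ?thesis by blast
      next
        case 2
        have "\<bar>defect f y s t\<bar> \<le> C2 * \<kappa> s t ^ 3"
          by (rule f2(2)[rule_format])
            (use 2 st in \<open>auto simp: d_def\<close>)
        then show ?thesis by blast
      next
        case 3
        have "\<bar>defect f y s t\<bar> \<le> C3 * \<kappa> s t ^ 3"
          by (rule f3(2)[rule_format])
            (use 3 st in \<open>auto simp: d_def\<close>)
        then show ?thesis by blast
      qed
      then obtain C' where C': "C' \<in> {C1, C2, C3}" "\<bar>defect f y s t\<bar> \<le> C' * \<kappa> s t ^ 3" by blast
      then have "C' \<le> C0" by (auto simp: C0_def)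
      with C'(2) show ?case using mult_right_mono[of C' C0 "\<kappa> s t ^ 3"] by simp
    qed
  qed
qed

subsection \<open>Solutions are controlled\<close>

text \<open>The given chart is cut off around \<open>y \<sigma>\<close>: there
  \<open>euler_first_order\<close> gives the second order bound, and the Lipschitz fields inherit
  the increments of order \<open>\<kappa>\<close> of the path. The neighbourhood of
  \<open>\<sigma>\<close> is two sided, as a covering of \<open>{a..b}\<close> requires.\<close>

lemma increment_bound_local:
  assumes sol: "solution_on a b y" and ab: "0 \<le> a" "b \<le> T" and c: "c \<in> charts A"
    and yc: "y ` {a..b} \<subseteq> fst c" and \<sigma>: "\<sigma> \<in> {a..b}"
  shows "\<exists>d>0. \<exists>C\<ge>0. \<forall>s t. a \<le> s \<and> s \<le> t \<and> t \<le> b \<and> \<bar>s - \<sigma>\<bar> \<le> d \<and>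
    \<bar>t - \<sigma>\<bar> \<le> d \<longrightarrow> norm (snd c (y t) - snd c (y s) - F (x t - x s) (y s) c) \<le> C * (\<kappa> s t)\<^sup>2 \<and>
      (\<forall>i. norm (F (axis i 1) (y t) c - F (axis i 1) (y s) c) \<le> C * \<kappa> s t)"
proof -
  have y\<sigma>: "y \<sigma> \<in> fst c" using yc \<sigma> by blast
  obtain r cut where "rde_chart T p \<omega> x X A F c (snd c (y \<sigma>)) r cut"
    using ex_rde_chart[OF c y\<sigma>] .
  then interpret ch: rde_chart T p \<omega> x X A F c "snd c (y \<sigma>)" r cut .
  obtain C where "almost_flow T p \<omega> (euler ch.V) C" by (rule ch.ex_almost_flow)
  then interpret fl: almost_flow T p \<omega> "euler ch.V" C .
  have "y \<sigma> \<in> ch.N" using y\<sigma> ch.r_pos by (simp add: ch.N_def)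
  moreover have "continuous_on {a..b} y" using sol by (simp add: solution_on_def)
  ultimately obtain \<epsilon> where \<epsilon>: "0 < \<epsilon>" "\<forall>t\<in>{a..b}. \<bar>t - \<sigma>\<bar> \<le> \<epsilon> \<longrightarrow> y t \<in> ch.N"
    using continuous_on_interval_nhd[OF _ ch.open_N \<sigma>, of y] by blast
  define a' b' where "a' = max a (\<sigma> - \<epsilon>)" and "b' = min b (\<sigma> + \<epsilon>)"
  have yN: "y ` {a'..b'} \<subseteq> ch.N" using \<epsilon>(2) by (auto simp: a'_def b'_def)
  have "solution_on a' b' y" by (rule solution_on_subset[OF sol]) (auto simp: a'_def b'_def)
  from ch.solution_on_imp_chart_solution_on[OF this yN]
  obtain K \<delta> where K: "0 \<le> K" "0 < \<delta>" "\<forall>s t. a' \<le> s \<and> s \<le> t \<and> t \<le> b' \<and> t - s \<le> \<delta> \<longrightarrow>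
      norm (snd c (y t) - euler ch.V s t (snd c (y s))) \<le> K * \<kappa> s t ^ 3"
    unfolding ch.chart_solution_on_def by blast
  obtain \<delta>1 where \<delta>1: "0 < \<delta>1"
    "\<And>s t. 0 \<le> s \<Longrightarrow> s \<le> t \<Longrightarrow> t \<le> T \<Longrightarrow> t - s \<le> \<delta>1 \<Longrightarrow> \<omega> s t \<le> 1"
    using control_small[of 1] by auto
  obtain L where L: "0 \<le> L" "\<forall>s t u v. 0 \<le> s \<and> s \<le> t \<and> t \<le> T \<and> \<omega> s t \<le> 1 \<and>
    norm (v - euler ch.V s t u) \<le> K * \<kappa> s t ^ 3 \<longrightarrow>
    norm (v - u - (\<Sum>i\<in>UNIV. (x t - x s) $ i *\<^sub>R ch.V i u)) \<le> L * (\<kappa> s t)\<^sup>2"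
    using euler_first_order[of ch.V K, OF ch.csmooth_V K(1)] by blast
  obtain M where "\<And>i. tame M (ch.V i)" using csmooth_tame_family[of ch.V] ch.csmooth_V by blast
  then have M: "0 \<le> M" "\<And>i u v. norm (ch.V i u - ch.V i v) \<le> M * norm (u - v)"
    using tameD(1,3) by blast+
  define d where "d = min \<epsilon> (min \<delta> \<delta>1 / 2)"
  have d: "0 < d" "d \<le> \<epsilon>" "d \<le> \<delta> / 2" "d \<le> \<delta>1 / 2" using \<epsilon>(1) K(2) \<delta>1(1) by (auto simp: d_def)
  define C' where "C' = L + M * (C + K)"
  have C': "0 \<le> C'" "L \<le> C'" "M * (C + K) \<le> C'"
    using L(1) M(1) fl.C_nonneg K(1) by (auto simp: C'_def)
  have "norm (snd c (y t) - snd c (y s) - F (x t - x s) (y s) c) \<le> C' * (\<kappa> s t)\<^sup>2 \<and>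
      (\<forall>i. norm (F (axis i 1) (y t) c - F (axis i 1) (y s) c) \<le> C' * \<kappa> s t)"
    if st: "a \<le> s" "s \<le> t" "t \<le> b" "\<bar>s - \<sigma>\<bar> \<le> d" "\<bar>t - \<sigma>\<bar> \<le> d" for s t
  proof -
    have N: "y s \<in> ch.N" "y t \<in> ch.N" using \<epsilon>(2) st d by auto
    have ts: "t - s \<le> \<delta>" "t - s \<le> \<delta>1" using st d by linarith+
    have st': "0 \<le> s" "t \<le> T" using st ab by auto
    have \<omega>1: "\<omega> s t \<le> 1" using \<delta>1(2)[OF st'(1) st(2) st'(2) ts(2)] .
    have in': "a' \<le> s" "t \<le> b'" using st d by (auto simp: a'_def b'_def)
    have step: "norm (snd c (y w) - euler ch.V v w (snd c (y v))) \<le> K * \<kappa> v w ^ 3"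
      if "s \<le> v" "v \<le> w" "w \<le> t" for v w
      using that ts(1) in' by (intro K(3)[rule_format]) auto
    have "norm (snd c (y t) - snd c (y s) - (\<Sum>i\<in>UNIV. (x t - x s) $ i *\<^sub>R ch.V i (snd c (y s)))) \<le> L * (\<kappa> s t)\<^sup>2"
      using step[of s t] st st' \<omega>1 by (intro L(2)[rule_format]) auto
    also have "\<dots> \<le> C' * (\<kappa> s t)\<^sup>2" using C' by (intro mult_right_mono) auto
    finally have 1: "norm (snd c (y t) - snd c (y s) - F (x t - x s) (y s) c) \<le> C' * (\<kappa> s t)\<^sup>2"
      unfolding ch.field_eq_V[OF N(1)] .
    have "fl.follows (\<lambda>t. snd c (y t)) s t K" using step by (auto simp: fl.follows_def)
    from fl.follows_near[OF this K(1) st'(1,2) \<omega>1 order_refl st(2) order_refl]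
    have near: "norm (snd c (y t) - snd c (y s)) \<le> (C + K) * \<kappa> s t" .
    have "norm (F (axis i 1) (y t) c - F (axis i 1) (y s) c) \<le> C' * \<kappa> s t" for i
    proof -
      have "norm (F (axis i 1) (y t) c - F (axis i 1) (y s) c) \<le> M * norm (snd c (y t) - snd c (y s))"
        unfolding ch.field_axis_eq_V[OF N(1)] ch.field_axis_eq_V[OF N(2)] by (rule M(2))
      also have "\<dots> \<le> M * ((C + K) * \<kappa> s t)" using near M(1) by (intro mult_left_mono)
      also have "\<dots> \<le> C' * \<kappa> s t" using C'(3) by (simp add: mult.assoc[symmetric] mult_right_mono)
      finally show ?thesis .
    qed
    with 1 show ?thesis by blast
  qed
  then show ?thesis using d(1) C'(1) by blast
qed

text \<open>Unlike the equation, a controlled path satisfies its bounds for all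
  \<open>s \<le> t\<close>. They survive the joining of adjacent intervals with a larger constant,
  so a bisection argument passes from local to global.\<close>

lemma increment_bound:
  assumes sol: "solution_on a b y" and ab: "0 \<le> a" "a \<le> b" "b \<le> T" and c: "c \<in> charts A"
    and yc: "y ` {a..b} \<subseteq> fst c"
  shows "\<exists>C\<ge>0. \<forall>s t. a \<le> s \<and> s \<le> t \<and> t \<le> b \<longrightarrow>
    norm (snd c (y t) - snd c (y s) - F (x t - x s) (y s) c) \<le> C * (\<kappa> s t)\<^sup>2 \<and>
      (\<forall>i. norm (F (axis i 1) (y t) c - F (axis i 1) (y s) c) \<le> C * \<kappa> s t)"
proof -
  define P where "P C s t \<longleftrightarrow> norm (snd c (y t) - snd c (y s) - F (x t - x s) (y s) c) \<le> C * (\<kappa> s t)\<^sup>2 \<and>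
      (\<forall>i. norm (F (axis i 1) (y t) c - F (axis i 1) (y s) c) \<le> C * \<kappa> s t)" for C s t
  define Q where "Q a' b' \<longleftrightarrow> a \<le> a' \<and> b' \<le> b \<longrightarrow>
    (\<exists>C\<ge>0. \<forall>s t. a' \<le> s \<and> s \<le> t \<and> t \<le> b' \<longrightarrow> P C s t)" for a' b'
  have P_mono: "P C' s t" if "P C s t" "C \<le> C'" for C C' s t
  proof -
    have "C * (\<kappa> s t)\<^sup>2 \<le> C' * (\<kappa> s t)\<^sup>2" "C * \<kappa> s t \<le> C' * \<kappa> s t"
      using that(2) by (intro mult_right_mono; simp)+
    then show ?thesis using that(1) unfolding P_def by (meson order_trans)
  qed
  have "Q a b"
    using ab(2)
  proof (induction rule: Bolzano)
    case (trans a1 b1 c1)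
    show ?case
      unfolding Q_def
    proof
      assume ac: "a \<le> a1 \<and> c1 \<le> b"
      obtain C1 C2 where C: "0 \<le> C1" "0 \<le> C2" "\<forall>s t. a1 \<le> s \<and> s \<le> t \<and> t \<le> b1 \<longrightarrow> P C1 s t"
        "\<forall>s t. b1 \<le> s \<and> s \<le> t \<and> t \<le> c1 \<longrightarrow> P C2 s t"
      proof -
        have "a \<le> a1 \<and> b1 \<le> b" "a \<le> b1 \<and> c1 \<le> b" using trans(3,4) ac by auto
        with trans(1,2)[unfolded Q_def] that show ?thesis by blast
      qed
      define n where "n = real CARD('k)"
      \<comment> \<open>The term \<open>n * C1\<close> pays for moving the base point of
        \<open>F\<close> from \<open>y b1\<close> to \<open>y s\<close>, component by component of
        \<open>x t - x b1\<close>.\<close>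
      define C' where "C' = C1 + C2 + n * C1"
      have n: "0 \<le> n" by (simp add: n_def)
      have C': "C1 \<le> C'" "C2 \<le> C'" "C1 + C2 \<le> C'" "0 \<le> C'" using C(1,2) n by (auto simp: C'_def)
      have "P C' s t" if st: "a1 \<le> s" "s \<le> t" "t \<le> c1" for s t
      proof (cases "t \<le> b1 \<or> b1 \<le> s")
        case True
        then have "P C1 s t \<or> P C2 s t" using C(3,4) st by blast
        then show ?thesis using P_mono C' by blast
      next
        case False
        let ?k = "\<kappa> s t"
        have "0 \<le> s" "t \<le> T" using st ac ab by auto
        then have k: "\<kappa> s b1 \<le> ?k" "\<kappa> b1 t \<le> ?k" using False by (auto intro!: \<kappa>_mono)
        have k2: "(\<kappa> s b1)\<^sup>2 \<le> ?k\<^sup>2" "(\<kappa> b1 t)\<^sup>2 \<le> ?k\<^sup>2" using k by (auto intro!: power_mono)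
        have P1: "P C1 s b1" and P2: "P C2 b1 t" using C(3,4) st False by auto
        have d1: "norm (F (axis i 1) (y b1) c - F (axis i 1) (y s) c) \<le> C1 * ?k" for i
          using P1 mult_left_mono[OF k(1) C(1)] unfolding P_def by (meson order_trans)
        have d2: "norm (F (axis i 1) (y t) c - F (axis i 1) (y b1) c) \<le> C2 * ?k" for i
          using P2 mult_left_mono[OF k(2) C(2)] unfolding P_def by (meson order_trans)
        have e1: "norm (snd c (y b1) - snd c (y s) - F (x b1 - x s) (y s) c) \<le> C1 * ?k\<^sup>2"
          using P1 mult_left_mono[OF k2(1) C(1)] unfolding P_def by (meson order_trans)
        have e2: "norm (snd c (y t) - snd c (y b1) - F (x t - x b1) (y b1) c) \<le> C2 * ?k\<^sup>2"
          using P2 mult_left_mono[OF k2(2) C(2)] unfolding P_def by (meson order_trans)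
        have e3: "norm (F (x t - x b1) (y b1) c - F (x t - x b1) (y s) c) \<le> n * (?k * (C1 * ?k))"
        proof -
          have "\<bar>(x t - x b1) $ i\<bar> \<le> ?k" for i
            using path_bound[of b1 t i] \<open>0 \<le> s\<close> \<open>t \<le> T\<close> False k(2) by auto
          then show ?thesis
            unfolding field_expansion[of "x t - x b1"] sum_subtractf[symmetric]
              scaleR_diff_right[symmetric] n_def
            by (intro norm_sum_UNIV_le d1) auto
        qed
        have "F (x t - x s) (y s) c = F (x t - x b1) (y s) c + F (x b1 - x s) (y s) c"
          using linear_add[OF field_linear, of "x t - x b1" "x b1 - x s"] by simp
        then have "norm (snd c (y t) - snd c (y s) - F (x t - x s) (y s) c)
            \<le> C1 * ?k\<^sup>2 + C2 * ?k\<^sup>2 + n * (?k * (C1 * ?k))"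
          using norm_triangle_mono[OF norm_triangle_mono[OF e1 e2] e3] by (simp add: algebra_simps)
        also have "\<dots> = C' * ?k\<^sup>2" by (simp add: C'_def algebra_simps power2_eq_square)
        finally have A: "norm (snd c (y t) - snd c (y s) - F (x t - x s) (y s) c) \<le> C' * ?k\<^sup>2" .
        have "norm (F (axis i 1) (y t) c - F (axis i 1) (y s) c) \<le> C' * ?k" for i
        proof -
          have "norm (F (axis i 1) (y t) c - F (axis i 1) (y s) c) \<le> (C1 + C2) * ?k"
            using norm_triangle_mono[OF d1[of i] d2[of i]] by (simp add: algebra_simps)
          also have "\<dots> \<le> C' * ?k" using C'(3) by (intro mult_right_mono) auto
          finally show ?thesis .
        qed
        with A show ?thesis unfolding P_def by blast
      qed
      then show "\<exists>C\<ge>0. \<forall>s t. a1 \<le> s \<and> s \<le> t \<and> t \<le> c1 \<longrightarrow> P C s t" using C'(4) by blast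
    qed
  next
    case (local \<sigma>)
    then have \<sigma>: "\<sigma> \<in> {a..b}" by simp
    obtain d C where d: "0 < d" "0 \<le> C" "\<forall>s t. a \<le> s \<and> s \<le> t \<and> t \<le> b \<and> \<bar>s - \<sigma>\<bar> \<le> d \<and>
      \<bar>t - \<sigma>\<bar> \<le> d \<longrightarrow> P C s t"
      using increment_bound_local[OF sol ab(1,3) c yc \<sigma>] unfolding P_def by blast
    have "Q a' b'" if "a' \<le> \<sigma>" "\<sigma> \<le> b'" "b' - a' < d" for a' b'
      unfolding Q_def using that d(2) by (intro impI exI[of _ C] conjI allI d(3)[rule_format]) auto
    then show ?case using d(1) by blast
  qed
  then show ?thesis by (simp add: Q_def P_def)
qed

lemma solution_controlled:
  assumes sol: "solution_on a b y" and ab: "0 \<le> a" "a \<le> b" "b \<le> T" and c: "c \<in> charts A"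
    and yc: "y ` {a..b} \<subseteq> fst c"
  shows "\<exists>C. \<forall>s t. a \<le> s \<and> s \<le> t \<and> t \<le> b \<longrightarrow>
    norm (snd c (y t) - snd c (y s) - F (x t - x s) (y s) c) \<le> C * \<omega> s t powr (2 / p) \<and>
    onorm (\<lambda>w. F w (y t) c - F w (y s) c) \<le> C * \<omega> s t powr (1 / p)"
proof -
  obtain C where C: "0 \<le> C" "\<forall>s t. a \<le> s \<and> s \<le> t \<and> t \<le> b \<longrightarrow>
    norm (snd c (y t) - snd c (y s) - F (x t - x s) (y s) c) \<le> C * (\<kappa> s t)\<^sup>2 \<and>
      (\<forall>i. norm (F (axis i 1) (y t) c - F (axis i 1) (y s) c) \<le> C * \<kappa> s t)"
    using increment_bound[OF assms] by blast
  define n where "n = real CARD('k)"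
  have n: "1 \<le> n" by (simp add: n_def Suc_le_eq)
  have nC: "C \<le> n * C" using mult_right_mono[OF n C(1)] by simp
  show ?thesis
    unfolding \<kappa>_power \<kappa>_def[symmetric]
  proof (rule exI[of _ "n * C"], intro allI impI conjI)
    fix s t assume st: "a \<le> s \<and> s \<le> t \<and> t \<le> b"
    have "norm (snd c (y t) - snd c (y s) - F (x t - x s) (y s) c) \<le> C * (\<kappa> s t)\<^sup>2" using C(2) st by blast
    also have "\<dots> \<le> n * C * (\<kappa> s t)\<^sup>2" using nC by (intro mult_right_mono) auto
    finally show "norm (snd c (y t) - snd c (y s) - F (x t - x s) (y s) c) \<le> n * C * (\<kappa> s t)\<^sup>2" .
    show "onorm (\<lambda>w. F w (y t) c - F w (y s) c) \<le> n * C * \<kappa> s t"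
    proof (rule onorm_le)
      fix w :: "real ^ 'k"
      have "norm (F w (y t) c - F w (y s) c) \<le> n * (norm w * (C * \<kappa> s t))"
        unfolding field_expansion[of w] sum_subtractf[symmetric] scaleR_diff_right[symmetric] n_def
        using C(2) st by (intro norm_sum_UNIV_le) (auto simp: component_le_norm_cart)
      then show "norm (F w (y t) c - F w (y s) c) \<le> n * C * \<kappa> s t * norm w" by (simp add: ac_simps)
    qed
  qed
qed

section \<open>Passage between solutions on closed intervals and paths with a derivative
  path\<close>

lemma field_in_tangent_linear_maps: "(\<lambda>w. F w m) \<in> tangent_linear_maps A m"
  by (simp add: tangent_linear_maps_def field_tangent field_linear)

lemma RDE_solution_fromI:
  assumes sol: "\<And>t. t \<in> I \<Longrightarrow> solution_on 0 t y" and y0: "y 0 = y0"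
    and I: "I \<subseteq> {0..T}" and cont: "continuous_on I y"
  shows "RDE_solution_from A F p \<omega> x X y0 I y (\<lambda>s w. F w (y s))"
proof -
  have sub: "solution_on a b y \<and> 0 \<le> a \<and> b \<le> T" if "{a..b} \<subseteq> I" "a \<le> b" for a b
  proof -
    have "a \<in> I" "b \<in> I" using that by auto
    then show ?thesis using solution_on_subset[OF sol[of b], of a b] I by auto
  qed
  have "controlled_rough_path A p \<omega> x I y (\<lambda>s w. F w (y s))"
    unfolding controlled_rough_path_def
  proof (intro conjI ballI allI impI cont field_in_tangent_linear_maps)
    fix c and w assume c: "c \<in> charts A"
    note tc = topological_chartD[OF charts_topological[OF c]]
    have "continuous_on (fst c) (\<lambda>m. F w (chart_inv c (snd c m)) c)"
      by (rule continuous_on_compose2[OF smooth_on_imp_continuous_on[OF field_smooth[OF c]] tc(4)]) auto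
    then have "continuous_on (fst c) (\<lambda>m. F w m c)"
      by (rule continuous_on_eq) (simp add: tc(3))
    then show "continuous_on {s \<in> I. y s \<in> fst c} (\<lambda>s. F w (y s) c)"
      by (rule continuous_on_compose2[OF _ continuous_on_subset[OF cont]]) auto
  next
    fix c a b assume c: "c \<in> charts A" and ab: "{a..b} \<subseteq> I \<and> y ` {a..b} \<subseteq> fst c"
    show "\<exists>C. \<forall>s t. a \<le> s \<and> s \<le> t \<and> t \<le> b \<longrightarrow>
      norm (snd c (y t) - snd c (y s) - F (x t - x s) (y s) c) \<le> C * \<omega> s t powr (2 / p) \<and>
      onorm (\<lambda>w. F w (y t) c - F w (y s) c) \<le> C * \<omega> s t powr (1 / p)"
    proof (cases "a \<le> b")
      case True
      then show ?thesis using sub[of a b] ab c by (intro solution_controlled) auto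
    next
      \<comment> \<open>For \<open>a > b\<close> the interval is empty and so contained in
        \<open>I\<close>; the bound is then vacuous.\<close>
      case False
      then have "\<not> (a \<le> s \<and> s \<le> t \<and> t \<le> b)" for s t by linarith
      then show ?thesis by blast
    qed
  qed
  moreover have "solves_RDE A F p \<omega> x X I y (\<lambda>s w. F w (y s))"
    unfolding solves_RDE_def \<kappa>_power
  proof (intro conjI ballI allI impI refl)
    fix f a b assume f: "smooth_fun A f" and ab: "{a..b} \<subseteq> I"
    show "\<exists>C. \<exists>\<delta>>0. \<forall>s t. a \<le> s \<and> s \<le> t \<and> t \<le> b \<and> t - s \<le> \<delta> \<longrightarrow>
       \<bar>f (y t) - f (y s) - field_deriv A (F (x t - x s)) f (y s)
         - eval_tensor (\<lambda>w w'. field_deriv A (F w) (field_deriv A (F w') f) (y s)) (X s t)\<bar>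
       \<le> C * \<kappa> s t ^ 3"
      unfolding defect_def[symmetric]
    proof (cases "a \<le> b")
      case True
      then show "\<exists>C. \<exists>\<delta>>0. \<forall>s t. a \<le> s \<and> s \<le> t \<and> t \<le> b \<and> t - s \<le> \<delta> \<longrightarrow>
          \<bar>defect f y s t\<bar> \<le> C * \<kappa> s t ^ 3"
        using sub[OF ab] f unfolding solution_on_def by blast
    next
      case False
      then have "\<not> (a \<le> s \<and> s \<le> t \<and> t \<le> b \<and> t - s \<le> 1)" for s t by linarith
      then show "\<exists>C. \<exists>\<delta>>0. \<forall>s t. a \<le> s \<and> s \<le> t \<and> t \<le> b \<and> t - s \<le> \<delta> \<longrightarrow>
          \<bar>defect f y s t\<bar> \<le> C * \<kappa> s t ^ 3"
        using zero_less_one by blast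
    qed
  qed
  ultimately show ?thesis using y0 by (simp add: RDE_solution_from_def)
qed

lemma RDE_solution_fromD:
  assumes "RDE_solution_from A F p \<omega> x X y0 J z z'" "{0..t} \<subseteq> J"
  shows "solution_on 0 t z" "z 0 = y0" "\<And>s. s \<in> J \<Longrightarrow> z' s = (\<lambda>w. F w (z s))"
proof -
  have z: "controlled_rough_path A p \<omega> x J z z'" "solves_RDE A F p \<omega> x X J z z'" "z 0 = y0"
    using assms(1) by (auto simp: RDE_solution_from_def)
  show "z 0 = y0" by (rule z(3))
  show "z' s = (\<lambda>w. F w (z s))" if "s \<in> J" for s
    using z(2) that by (auto simp: solves_RDE_def)
  have "continuous_on {0..t} z"
    using z(1) assms(2) continuous_on_subset by (auto simp: controlled_rough_path_def)
  moreover have "\<forall>f. smooth_fun A f \<longrightarrow> (\<exists>C. \<exists>\<delta>>0. \<forall>s u. 0 \<le> s \<and> s \<le> u \<and> u \<le> t \<and> u - s \<le> \<delta> \<longrightarrow>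
      \<bar>defect f z s u\<bar> \<le> C * \<kappa> s u ^ 3)"
    using z(2) assms(2) unfolding solves_RDE_def \<kappa>_power defect_def by blast
  ultimately show "solution_on 0 t z" by (simp add: solution_on_def)
qed

subsection \<open>The maximal solution\<close>

definition existence_times :: "'m \<Rightarrow> real set" where
  "existence_times y0 = {t \<in> {0..T}. \<exists>y. solution_on 0 t y \<and> y 0 = y0}"

text \<open>At each time a solution up to that time is chosen anew; uniqueness makes the choices fit
  together on the existence times.\<close>

definition maximal_solution :: "'m \<Rightarrow> real \<Rightarrow> 'm" where
  "maximal_solution y0 t = (SOME y. solution_on 0 t y \<and> y 0 = y0) t"

lemma existence_times_downward: "t \<in> existence_times y0 \<Longrightarrow> 0 \<le> s \<Longrightarrow> s \<le> t \<Longrightarrow> s \<in> existence_times y0"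
  using solution_on_subset[of 0 t _ 0 s] by (auto simp: existence_times_def)

lemma maximal_solution_eq:
  assumes "solution_on 0 t y" "y 0 = y0" "t \<le> T" "s \<in> {0..t}"
  shows "maximal_solution y0 s = y s"
proof -
  have y: "solution_on 0 s y \<and> y 0 = y0" using solution_on_subset[OF assms(1)] assms by auto
  define v where "v = (SOME y. solution_on 0 s y \<and> y 0 = y0)"
  have v: "solution_on 0 s v \<and> v 0 = y0"
    unfolding v_def by (rule someI[of "\<lambda>y. solution_on 0 s y \<and> y 0 = y0", OF y])
  have "v s = y s"
    by (rule solution_unique[of 0 s v y]) (use v y assms(3,4) in auto)
  then show ?thesis by (simp add: maximal_solution_def v_def)
qed

lemma maximal_solution:
  assumes "t \<in> existence_times y0"
  shows "solution_on 0 t (maximal_solution y0)" "maximal_solution y0 0 = y0"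
proof -
  obtain y where y: "solution_on 0 t y" "y 0 = y0" and t: "0 \<le> t" "t \<le> T"
    using assms by (auto simp: existence_times_def)
  show "solution_on 0 t (maximal_solution y0)"
    by (rule solution_on_cong[OF y(1)]) (simp add: maximal_solution_eq[OF y t(2)])
  show "maximal_solution y0 0 = y0" using maximal_solution_eq[OF y t(2), of 0] t y(2) by simp
qed

text \<open>The step \<open>h\<close> comes from \<open>K\<close> and does not depend on the time
  reached; the local solution is appended by \<open>solution_on_concat\<close>.\<close>

lemma maximal_solution_extend:
  assumes "compact K"
  obtains h where "0 < h" "\<And>t. t \<in> existence_times y0 \<Longrightarrow> maximal_solution y0 t \<in> K \<Longrightarrow>
    min T (t + h) \<in> existence_times y0"
proof -
  let ?y = "maximal_solution y0"
  obtain h where h: "0 < h"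
    "\<And>s t m. 0 \<le> s \<Longrightarrow> s \<le> t \<Longrightarrow> t \<le> T \<Longrightarrow> t - s \<le> h \<Longrightarrow> m \<in> K \<Longrightarrow> \<exists>y. solution_on s t y \<and> y s = m"
    using ex_local_solution_compact[OF assms] by blast
  have "min T (t + h) \<in> existence_times y0" if t: "t \<in> existence_times y0" "?y t \<in> K" for t
  proof -
    define t' where "t' = min T (t + h)"
    have t': "0 \<le> t" "t \<le> t'" "t' \<le> T" "t' - t \<le> h" using t(1) h(1) by (auto simp: existence_times_def t'_def)
    obtain z where z: "solution_on t t' z" "z t = ?y t" using h(2)[OF t' t(2)] by blast
    define v where "v s = (if s \<le> t then ?y s else z s)" for s
    have "solution_on 0 t v"
      by (rule solution_on_cong[OF maximal_solution(1)[OF t(1)]]) (simp add: v_def)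
    moreover have "solution_on t t' v"
      by (rule solution_on_cong[OF z(1)]) (use z(2) in \<open>auto simp: v_def\<close>)
    ultimately have "solution_on 0 t' v" using t' by (intro solution_on_concat[of 0 t _ t']) auto
    moreover have "v 0 = y0" using maximal_solution(2)[OF t(1)] t' by (simp add: v_def)
    ultimately show ?thesis using t' unfolding t'_def[symmetric] existence_times_def by auto
  qed
  then show ?thesis using that h(1) by blast
qed

lemma existence_times_cases:
  assumes "0 < T"
  shows "existence_times y0 = {0..T} \<or> (\<exists>\<tau>. 0 < \<tau> \<and> \<tau> \<le> T \<and> existence_times y0 = {0..<\<tau>} \<and>
    \<not> compact (closure (maximal_solution y0 ` {0..<\<tau>})))"
proof -
  let ?S = "existence_times y0" and ?y = "maximal_solution y0"
  obtain N h0 where "open N" "y0 \<in> N" "0 < h0"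
    "\<And>s t m. 0 \<le> s \<Longrightarrow> s \<le> t \<Longrightarrow> t \<le> T \<Longrightarrow> t - s \<le> h0 \<Longrightarrow> m \<in> N \<Longrightarrow> \<exists>y. solution_on s t y \<and> y s = m"
    by (rule ex_local_solution[of y0]) blast
  then have h0S: "min T h0 \<in> ?S" using assms by (simp add: existence_times_def)
  define \<tau> where "\<tau> = Sup ?S"
  have S_le: "t \<le> T" "0 \<le> t" if "t \<in> ?S" for t using that by (auto simp: existence_times_def)
  have bdd: "bdd_above ?S" using S_le by (intro bdd_aboveI[of _ T])
  have upper: "t \<le> \<tau>" if "t \<in> ?S" for t unfolding \<tau>_def by (rule cSup_upper[OF that bdd])
  have ne: "?S \<noteq> {}" using h0S by blast
  have \<tau>: "0 < \<tau>" "\<tau> \<le> T"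
    using upper[OF h0S] assms \<open>0 < h0\<close> cSup_least[OF ne, of T] S_le(1) by (auto simp: \<tau>_def)
  have below: "t \<in> ?S" if t: "0 \<le> t" "t < \<tau>" for t
  proof -
    obtain s where "s \<in> ?S" "t < s" using less_cSupD[OF ne t(2)[unfolded \<tau>_def]] by blast
    then show ?thesis using existence_times_downward t(1) by (meson less_imp_le)
  qed
  show ?thesis
  proof (cases "\<tau> \<in> ?S")
    case True
    \<comment> \<open>A single point is compact, so the solution continues past an attained supremum
      unless that is \<open>T\<close>.\<close>
    obtain h where h: "0 < h" "\<And>t. t \<in> ?S \<Longrightarrow> ?y t \<in> {?y \<tau>} \<Longrightarrow> min T (t + h) \<in> ?S"
      by (rule maximal_solution_extend[of "{?y \<tau>}"]) auto
    have "min T (\<tau> + h) \<le> \<tau>" using h(2)[OF True] upper by simp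
    then have "\<tau> = T" using h(1) \<tau>(2) by linarith
    have "t \<in> ?S" if "t \<in> {0..T}" for t
      using that below[of t] True \<open>\<tau> = T\<close> by (cases "t < T") auto
    then have "?S = {0..T}" using S_le by (meson atLeastAtMost_iff subsetI subset_antisym)
    then show ?thesis by blast
  next
    case False
    have "t < \<tau>" if "t \<in> ?S" for t using upper[OF that] that False by (cases "t = \<tau>") auto
    then have S: "?S = {0..<\<tau>}" using below S_le(2) by (meson atLeastLessThan_iff subsetI subset_antisym)
    have "\<not> compact (closure (?y ` {0..<\<tau>}))"
    proof
      assume "compact (closure (?y ` {0..<\<tau>}))"
      then obtain h where h: "0 < h"
        "\<And>t. t \<in> ?S \<Longrightarrow> ?y t \<in> closure (?y ` {0..<\<tau>}) \<Longrightarrow> min T (t + h) \<in> ?S"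
        by (rule maximal_solution_extend[of "closure (?y ` {0..<\<tau>})"]) auto
      \<comment> \<open>At most \<open>h / 2\<close> before \<open>\<tau>\<close>, so a step of
        length \<open>h\<close> reaches it; the maximum with \<open>0\<close> keeps \<open>t\<close>
        an existence time.\<close>
      define t where "t = max 0 (\<tau> - h / 2)"
      have t: "t \<in> {0..<\<tau>}" "\<tau> \<le> min T (t + h)" using \<tau> h(1) by (auto simp: t_def)
      have "?y t \<in> closure (?y ` {0..<\<tau>})"
        by (rule subsetD[OF closure_subset imageI[OF t(1)]])
      then have "min T (t + h) \<in> ?S" using h(2) t(1) S by blast
      then show False using t(2) S by auto
    qed
    then show ?thesis using \<tau> S by blast
  qed
qed

text \<open>The domain may be half-open, so no single solution on a closed interval covers it.
  Continuity at \<open>t\<close> is taken from a solution up to a later existence time, or up to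
  \<open>t\<close> itself if \<open>t\<close> is the last one.\<close>

lemma continuous_on_maximal_solution: "continuous_on (existence_times y0) (maximal_solution y0)"
  unfolding continuous_on_eq_continuous_within
proof
  let ?S = "existence_times y0"
  fix t assume t: "t \<in> ?S"
  then have t0: "0 \<le> t" by (simp add: existence_times_def)
  show "continuous (at t within ?S) (maximal_solution y0)"
  proof (cases "\<exists>t'\<in>?S. t < t'")
    case True
    then obtain t' where t': "t' \<in> ?S" "t < t'" by blast
    have "continuous (at t within {0..t'}) (maximal_solution y0)"
      using maximal_solution(1)[OF t'(1)] t0 t'(2)
      by (simp add: solution_on_def continuous_on_eq_continuous_within)
    moreover have "at t within ?S = at t within {0..t'}"
    proof (rule at_within_nhd[of t "{..<t'}"])
      show "?S \<inter> {..<t'} - {t} = {0..t'} \<inter> {..<t'} - {t}"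
        using existence_times_downward[OF t'(1)] by (auto simp: existence_times_def)
    qed (use t'(2) in auto)
    ultimately show ?thesis by simp
  next
    case False
    then have "s \<le> t" if "s \<in> ?S" for s using that by force
    moreover have "0 \<le> s" if "s \<in> ?S" for s using that by (simp add: existence_times_def)
    ultimately have "?S = {0..t}"
      using existence_times_downward[OF t] by (meson atLeastAtMost_iff subsetI subset_antisym)
    then show ?thesis
      using maximal_solution(1)[OF t] t0 by (simp add: solution_on_def continuous_on_eq_continuous_within)
  qed
qed

end

theorem theorem5p5:
  fixes A :: "('m::{t2_space,second_countable_topology}, 'e::{real_inner,heine_borel}) chart set"
    and F :: "real ^ 'k \<Rightarrow> 'm \<Rightarrow> ('m, 'e) tangent"
    and T p :: real
    and \<omega> :: "real \<Rightarrow> real \<Rightarrow> real"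
    and x :: "real \<Rightarrow> real ^ 'k"
    and X :: "real \<Rightarrow> real \<Rightarrow> real ^ 'k ^ 'k"
    and y0 :: 'm
  assumes "smooth_atlas A"
    and "linear_vector_fields A F"
    and "0 < T" and "1 \<le> p" and "p < 3"
    and "control T \<omega>"
    and "weak_geometric_rough_path T p \<omega> x X"
  shows "\<exists>I y y'.
    RDE_solution_from A F p \<omega> x X y0 I y y' \<and> global_or_explodes T I y \<and>
    (\<forall>J z z'. initial_interval T J \<and> RDE_solution_from A F p \<omega> x X y0 J z z' \<longrightarrow>
       J \<subseteq> I \<and> (\<forall>s\<in>J. z s = y s \<and> z' s = y' s) \<and> (global_or_explodes T J z \<longrightarrow> J = I))"
proof -
  interpret rde T p \<omega> x X A F
    by unfold_locales (use assms in auto)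
  define I where "I = existence_times y0"
  define y where "y = maximal_solution y0"
  have I_le: "I \<subseteq> {0..T}" by (auto simp: I_def existence_times_def)
  note I_cases = existence_times_cases[OF assms(3), of y0, folded I_def y_def]
  have "0 \<in> I" using I_cases assms(3) by auto
  then have y_0: "y 0 = y0" unfolding I_def y_def by (rule maximal_solution(2))
  have cont: "continuous_on I y" unfolding I_def y_def by (rule continuous_on_maximal_solution)
  have sol: "RDE_solution_from A F p \<omega> x X y0 I y (\<lambda>s w. F w (y s))"
    by (rule RDE_solution_fromI[OF _ y_0 I_le cont]) (simp add: I_def y_def maximal_solution)
  moreover have "global_or_explodes T I y"
    unfolding global_or_explodes_def by (rule I_cases)
  moreover have "J \<subseteq> I \<and> (\<forall>s\<in>J. z s = y s \<and> z' s = (\<lambda>w. F w (y s))) \<and> (global_or_explodes T J z \<longrightarrow> J = I)"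
    if J: "initial_interval T J" and z: "RDE_solution_from A F p \<omega> x X y0 J z z'" for J z z'
  proof -
    have sub: "{0..t} \<subseteq> J" "0 \<le> t" "t \<le> T" if "t \<in> J" for t
      using J that by (auto simp: initial_interval_def)
    have JI: "J \<subseteq> I"
      using RDE_solution_fromD(1,2)[OF z sub(1)] sub(2,3) by (auto simp: I_def existence_times_def)
    have zy: "z s = y s" if "s \<in> J" for s
      using maximal_solution_eq[OF RDE_solution_fromD(1,2)[OF z sub(1)[OF that]] sub(3)[OF that], of s] sub[OF that]
      by (simp add: y_def)
    have z'y: "z' s = (\<lambda>w. F w (y s))" if "s \<in> J" for s
      using RDE_solution_fromD(3)[OF z sub(1)[OF that] that] zy[OF that] by simp
    have "J = I" if "global_or_explodes T J z"
      using that unfolding global_or_explodes_def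
    proof (elim disjE exE conjE)
      assume "J = {0..T}"
      then show ?thesis using JI I_le by blast
    next
      \<comment> \<open>If \<open>I\<close> reached further than \<open>J\<close>, it would contain
        \<open>\<tau>\<close>; then \<open>y\<close> has compact image on
        \<open>{0..\<tau>}\<close>, and \<open>z\<close>, which agrees with \<open>y\<close> before
        \<open>\<tau>\<close>, could not leave that image.\<close>
      fix \<tau> assume \<tau>: "0 < \<tau>" "J = {0..<\<tau>}" "\<not> compact (closure (z ` {0..<\<tau>}))"
      show ?thesis
      proof (rule ccontr)
        assume "J \<noteq> I"
        then obtain t where t: "t \<in> I" "\<tau> \<le> t" using JI \<tau>(2) I_le by force
        then have "\<tau> \<in> I" using existence_times_downward[of t y0 \<tau>] \<tau>(1) by (simp add: I_def)
        then have "{0..\<tau>} \<subseteq> I" using existence_times_downward[of \<tau> y0] by (auto simp: I_def)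
        then have "compact (y ` {0..\<tau>})"
          using cont continuous_on_subset by (intro compact_continuous_image) auto
        moreover have "z ` {0..<\<tau>} \<subseteq> y ` {0..\<tau>}" using zy \<tau>(2) by force
        then have "closure (z ` {0..<\<tau>}) \<subseteq> y ` {0..\<tau>}"
          using closure_minimal compact_imp_closed calculation by blast
        ultimately have "compact (closure (z ` {0..<\<tau>}))"
          using compact_Int_closed[OF _ closed_closure] by (metis inf.absorb2)
        with \<tau>(3) show False ..
      qed
    qed
    with JI zy z'y show ?thesis by blast
  qed
  ultimately show ?thesis by blast
qed

end
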